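(* For every $T>0$, the random variables $\eta_T^{\pm}(0)$ have the distribution $$\mathbb{P}\{\eta_T^{\pm}(0)\in dy\}=2\varphi_T(1)\,\delta_{x^{\pm}}(dy)+\psi_T(y)\,dy,\qquad 0\le y\le 1,$$ where $\delta_x$ is the Dirac measure of unit mass at the point $x$, with $x^-=0$ and $x^+=1$. Furthermore, the distribution of $\eta_T(0)$ is given by $$\mathbb{P}\{\eta_T(0)\in dy\}=\varphi_T(1)\,\delta_0(dy)+\varphi_T(1)\,\delta_1(dy)+\psi_T(y)\,dy,\qquad 0\le y\le 1.$$
   Context: Let $\lambda>0$ and $c>0$ be fixed. Let $(N_t,\,t\ge0)$ be a homogeneous Poisson process with rate $\lambda$, and let $V_0$ be a random variable independent of $(N_t)$ taking the values $+c$ and $-c$ with probability $1/2$ each. The telegraph process is $X_t:=V_0\int_0^t(-1)^{N_u}\,du$, $t\ge0$, and the conditional telegraph processes are $X_t^{\pm}:=\pm c\int_0^t(-1)^{N_u}\,du$, $t\ge0$. Formulas with $\pm$ combine two cases, one for the upper and one for the lower sign. Let $H(x)=1$ for $x>0$ and $H(x)=0$ for $x\le 0$. For $T>0$ and $x\in\mathbb{R}$ set $$\eta_T(x):=\frac1T\int_0^T H(x+X_t)\,dt,\qquad \eta_T^{\pm}(x):=\frac1T\int_0^T H(x+X_t^{\pm})\,dt.$$ For $T>0$ define $$\varphi_T(t):=\frac{1}{4\pi\lambda T}\int_0^t\frac{1-e^{-2\lambda Tu}}{u^{3/2}\sqrt{t-u}}\,du\quad(t>0),\qquad \varphi_T(0):=\frac12,$$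 and $$\psi_T(y):=2\lambda T\,\varphi_T(y)\,\varphi_T(1-y),\qquad 0\le y\le1.$$ *)

theory Defs
  imports "HOL-Probability.Probability"
begin

(* Paths are required to be non-decreasing and right-continuous for every outcome, so that the
   time integrals below are defined pathwise.  Only N t with t >= 0 is constrained. *)
locale poisson_process = prob_space M for M :: "'a measure" +
  fixes lam :: real and N :: "real \<Rightarrow> 'a \<Rightarrow> nat"
  assumes rate_pos: "0 < lam"
    and random_variable_N: "\<And>t. 0 \<le> t \<Longrightarrow> N t \<in> measurable M (count_space UNIV)"
    and N_zero: "\<And>\<omega>. \<omega> \<in> space M \<Longrightarrow> N 0 \<omega> = 0"
    and N_mono: "\<And>\<omega> s t. \<omega> \<in> space M \<Longrightarrow> 0 \<le> s \<Longrightarrow> s \<le> t \<Longrightarrow> N s \<omega> \<le> N t \<omega>"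
    and N_right_continuous:
      "\<And>\<omega> t. \<omega> \<in> space M \<Longrightarrow> 0 \<le> t \<Longrightarrow> continuous (at_right t) (\<lambda>s. N s \<omega>)"
    and indep_increments:
      "\<And>(n::nat) (t :: nat \<Rightarrow> real). 0 \<le> t 0 \<Longrightarrow> (\<And>i. i < n \<Longrightarrow> t i \<le> t (Suc i)) \<Longrightarrow>
         indep_vars (\<lambda>_. count_space UNIV) (\<lambda>i \<omega>. N (t (Suc i)) \<omega> - N (t i) \<omega>) {..<n}"
    and poisson_increments:
      "\<And>s t. 0 \<le> s \<Longrightarrow> s < t \<Longrightarrow>
         distr M (count_space UNIV) (\<lambda>\<omega>. N t \<omega> - N s \<omega>) = measure_pmf (poisson_pmf (lam * (t - s)))"

(* Independence of a real random variable V from the whole process (N t, t >= 0): independence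
   of the generated sigma-algebras (indep_var would force both to have the same value type). *)
definition indep_of_process ::
    "'a measure \<Rightarrow> ('a \<Rightarrow> real) \<Rightarrow> (real \<Rightarrow> 'a \<Rightarrow> nat) \<Rightarrow> bool" where
  "indep_of_process M V N \<longleftrightarrow>
     prob_space.indep_set M
       (sets (vimage_algebra (space M) V borel))
       (sets (vimage_algebra (space M) (\<lambda>\<omega>. \<lambda>t\<in>{0..}. N t \<omega>)
                (PiM {0..} (\<lambda>_. count_space UNIV))))"

definition symmetric_sign :: "'a measure \<Rightarrow> real \<Rightarrow> ('a \<Rightarrow> real) \<Rightarrow> bool" where
  "symmetric_sign M c V \<longleftrightarrow>
     V \<in> borel_measurable M \<and>
     measure M {\<omega> \<in> space M. V \<omega> = c} = 1 / 2 \<and>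
     measure M {\<omega> \<in> space M. V \<omega> = - c} = 1 / 2"

definition telegraph ::
    "('a \<Rightarrow> real) \<Rightarrow> (real \<Rightarrow> 'a \<Rightarrow> nat) \<Rightarrow> real \<Rightarrow> 'a \<Rightarrow> real" where
  "telegraph V N t \<omega> = V \<omega> * (LINT u:{0..t}|lborel. (- 1) ^ N u \<omega>)"

abbreviation telegraph_plus :: "real \<Rightarrow> (real \<Rightarrow> 'a \<Rightarrow> nat) \<Rightarrow> real \<Rightarrow> 'a \<Rightarrow> real" where
  "telegraph_plus c N \<equiv> telegraph (\<lambda>_. c) N"

abbreviation telegraph_minus :: "real \<Rightarrow> (real \<Rightarrow> 'a \<Rightarrow> nat) \<Rightarrow> real \<Rightarrow> 'a \<Rightarrow> real" where
  "telegraph_minus c N \<equiv> telegraph (\<lambda>_. - c) N"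

definition heaviside :: "real \<Rightarrow> real" where
  "heaviside x = (if x > 0 then 1 else 0)"

definition eta :: "(real \<Rightarrow> 'a \<Rightarrow> real) \<Rightarrow> real \<Rightarrow> real \<Rightarrow> 'a \<Rightarrow> real" where
  "eta X T x \<omega> = (1 / T) * (LINT t:{0..T}|lborel. heaviside (x + X t \<omega>))"

definition phi :: "real \<Rightarrow> real \<Rightarrow> real \<Rightarrow> real" where
  "phi lam T t =
     (if t = 0 then 1 / 2
      else 1 / (4 * pi * lam * T) *
        (LINT u:{0<..<t}|lborel. (1 - exp (- 2 * lam * T * u)) / (u powr (3 / 2) * sqrt (t - u))))"

definition psi :: "real \<Rightarrow> real \<Rightarrow> real \<Rightarrow> real" where
  "psi lam T y = 2 * lam * T * phi lam T y * phi lam T (1 - y)"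

end

theory Submission
  imports Defs
begin

text \<open>
  Write \<open>W\<close> for the integral of \<open>(-1)^N\<close> and \<open>A\<close> for the time \<open>W\<close> spends above \<open>0\<close>; then
  \<open>\<eta>\<^sup>+ = A_T / T\<close>, and \<open>\<eta>\<^sup>- = 1 - \<eta>\<^sup>+\<close> because \<open>W\<close> has only finitely many zeros. Let \<open>u\<close> be the
  bounded solution of the resolvent equation
  \<open>\<sigma> u_\<sigma>' = (q + \<lambda> + r H) u_\<sigma> - \<lambda> u_{-\<sigma>} - 1\<close>. Conditioning \<open>exp (-q t - r A_t) u(W_t)\<close> on the
  number of jumps in a short interval shows that its expectation has derivative
  \<open>-exp (-q t) E exp (-r A_t)\<close>, so the Laplace transform in \<open>t\<close> of \<open>E exp (-r A_t)\<close> is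
  \<open>u_+(0) = (s' - 1)(s + 1) / (2 \<lambda>)\<close>, where \<open>s\<^sup>2 = 1 + 2 \<lambda> / q\<close> and \<open>s'\<^sup>2 = 1 + 2 \<lambda> / (q + r)\<close>.
  Since \<open>\<phi>\<close> is a convolution with Laplace transform \<open>(s - 1) / (2 \<lambda>)\<close>, the claimed law has the
  same double transform, and both transforms are injective by Weierstrass approximation.
\<close>

section \<open>The function phi\<close>

text \<open>The obstacle is the jump of H at 0, which gives \<open>u\<close> a kink exactly where
  A_t changes regime. The expansion survives through a cancellation: along a straight piece of path
  the jump of H in the resolvent equation is offset by the same jump in the derivative of
  \<open>r * A_t\<close>, so the one-step error is of order h^2 uniformly, also across 0. Jumps
  enter through a compensated term \<open>D * (k - lam * h)\<close>, where \<open>D\<close> is the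
  change of the functional under a sign flip and \<open>k\<close> the number of jumps.
  \<open>D\<close> is determined by the past and \<open>k\<close> is independent of it with mean
  \<open>lam * h\<close>, so the product has mean 0.

  The factorised value of u_+(0) is what produces the law. With P = (s - 1) / (2 lam) and P' = (s' -
  1) / (2 lam) it equals 2 P' + 2 lam P' P: the first term is the atom at 1, the second the
  convolution behind psi. Transforms are compared at natural arguments only, where the substitution
  x = exp (- t) turns them into moments; continuity in t then gives the identity at every T instead
  of almost every T.\<close>

lemma beta_half_integrable:
  "set_integrable lborel {0<..<1::real} (\<lambda>v. v powr (-1/2) * (1 - v) powr (-1/2))"
  using set_integrable_subset[OF integrable_Beta[of "1/2" "1/2"], of "{0<..<1}"] by (simp add: greaterThanLessThan_subseteq_atLeastAtMost_iff)

text \<open>The integrand of \<open>phi\<close> after the substitution \<open>u = y * v\<close>. The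
  domain becomes fixed and the whole dependence on the endpoint moves into
  \<open>a = 2 * lam * T * y\<close>, which suits dominated convergence.\<close>

definition phi_kernel :: "real \<Rightarrow> real \<Rightarrow> real" where
  "phi_kernel a v = (1 - exp (- a * v)) / (v powr (3/2) * sqrt (1 - v))"

text \<open>Since \<open>1 - exp (- a * v) \<le> a * v\<close>, one power of \<open>v\<close>
  cancels and the singularity at 0 drops from order 3/2 to the integrable order 1/2. The majorant is
  the Beta(1/2, 1/2) weight, linear in \<open>a\<close>.\<close>

lemma phi_kernel_bound:
  assumes "0 \<le> a" "0 < v" "v < 1"
  shows "0 \<le> phi_kernel a v" "phi_kernel a v \<le> a * (v powr (-1/2) * (1 - v) powr (-1/2))"
proof -
  show "0 \<le> phi_kernel a v" using assms by (simp add: phi_kernel_def)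
  have "1 - exp (- a * v) \<le> a * v" using exp_ge_add_one_self[of "- a * v"] by simp
  hence "phi_kernel a v \<le> (a * v) / (v powr (3/2) * sqrt (1 - v))"
    unfolding phi_kernel_def using assms by (intro divide_right_mono) auto
  also have "v powr (3/2) = v * v powr (1/2)"
    using assms powr_add[of v 1 "1/2"] by simp
  also have "(a * v) / (v * v powr (1/2) * sqrt (1 - v)) = a * (v powr (-1/2) * (1 - v) powr (-1/2))"
    using assms by (simp add: powr_half_sqrt powr_minus_divide field_simps)
  finally show "phi_kernel a v \<le> a * (v powr (-1/2) * (1 - v) powr (-1/2))" .
qed

lemma phi_kernel_measurable [measurable]: "phi_kernel a \<in> borel_measurable borel"
  unfolding phi_kernel_def by measurable

lemma phi_kernel_integrable:
  assumes "0 \<le> a" shows "set_integrable lborel {0<..<1} (phi_kernel a)"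
  by (rule set_integrable_bound[OF set_integrable_mult_right[OF beta_half_integrable, of a]])
     (use assms phi_kernel_bound in \<open>auto simp: set_borel_measurable_def\<close>)

lemma phi_eq_kernel:
  assumes "0 < lam" "0 < T" "0 < y"
  shows "phi lam T y = 1 / (4 * pi * lam * (T * y)) * (LINT v:{0<..<1}|lborel. phi_kernel (2 * lam * (T * y)) v)"
proof -
  have "(LINT u:{0<..<y}|lborel. (1 - exp (- 2 * lam * T * u)) / (u powr (3 / 2) * sqrt (y - u)))
     = \<bar>y\<bar> *\<^sub>R (LINT v|lborel. indicator {0<..<y} (0 + y * v) *\<^sub>R
        ((1 - exp (- 2 * lam * T * (0 + y * v))) / ((0 + y * v) powr (3 / 2) * sqrt (y - (0 + y * v)))))"
    unfolding set_lebesgue_integral_def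
    by (rule lborel_integral_real_affine) (use assms in auto)
  also have "\<dots> = y * (LINT v|lborel. indicator {0<..<1} v *\<^sub>R (phi_kernel (2 * lam * (T * y)) v / y^2))"
  proof -
    have "indicator {0<..<y} (0 + y * v) *\<^sub>R
        ((1 - exp (- 2 * lam * T * (0 + y * v))) / ((0 + y * v) powr (3 / 2) * sqrt (y - (0 + y * v))))
        = indicator {0<..<1} v *\<^sub>R (phi_kernel (2 * lam * (T * y)) v / y^2)" for v
    proof (cases "0 < v \<and> v < 1")
      case True
      \<comment> \<open>The denominator contributes \<open>3/2 + 1/2 = 2\<close> powers of
        \<open>y\<close>; against the Jacobian \<open>y\<close> a factor \<open>1 / y\<close>
        remains.\<close>
      have e: "(y * v) powr (3/2) * sqrt (y - y * v) = y^2 * (v powr (3/2) * sqrt (1 - v))"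
      proof -
        have "sqrt (y - y * v) = y powr (1/2) * sqrt (1 - v)"
          using assms by (simp add: powr_half_sqrt flip: real_sqrt_mult) (simp add: algebra_simps)
        moreover have "y powr (3/2) * y powr (1/2) = y^2"
          using assms by (simp flip: powr_add)
        ultimately show ?thesis using assms True by (simp add: powr_mult)
      qed
      have "y * v < y" "0 < y * v" using True assms by auto
      thus ?thesis using True e by (simp add: phi_kernel_def algebra_simps)
    next
      case False
      have "\<not> (0 < y * v \<and> y * v < y)" using False assms by (auto simp: zero_less_mult_iff)
      thus ?thesis using False by (auto simp: indicator_def)
    qed
    thus ?thesis using assms by simp
  qed
  also have "\<dots> = 1 / y * (LINT v:{0<..<1}|lborel. phi_kernel (2 * lam * (T * y)) v)"
    unfolding set_lebesgue_integral_def using assms by (simp add: power2_eq_square)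
  finally show ?thesis using assms by (simp add: phi_def)
qed

text \<open>By \<open>phi_eq_kernel\<close> only the product \<open>T * y\<close> matters, so
  everything reduces to the single function \<open>phi lam 1\<close> of unscaled time.\<close>

lemma phi_scale:
  assumes "0 < lam" "0 < T" "0 \<le> y" shows "phi lam T y = phi lam 1 (T * y)"
proof (cases "y = 0")
  case False thus ?thesis using assms by (simp add: phi_eq_kernel)
qed (simp add: phi_def)

lemma phi_nonneg:
  assumes "0 < lam" "0 < T" "0 \<le> y" shows "0 \<le> phi lam T y"
proof (cases "y = 0")
  case False thus ?thesis using assms
    by (auto simp: phi_eq_kernel set_lebesgue_integral_def indicator_def phi_kernel_bound intro!: mult_nonneg_nonneg integral_nonneg_AE)
qed (simp add: phi_def)

text \<open>The majorant of the kernel is linear in \<open>t\<close>, which cancels the prefactor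
  \<open>1 / t\<close>. The summand \<open>1 / 2\<close> covers the value assigned at
  \<open>t = 0\<close>.\<close>

lemma phi_bounded:
  assumes "0 < lam"
  obtains B where "0 \<le> B" "\<And>t. 0 \<le> t \<Longrightarrow> phi lam 1 t \<le> B"
proof -
  define b where "b = (LINT v:{0<..<1::real}|lborel. v powr (-1/2) * (1 - v) powr (-1/2))"
  have "b \<ge> 0" unfolding b_def set_lebesgue_integral_def by (intro integral_nonneg_AE) auto
  have "phi lam 1 t \<le> 1 / 2 + b / (2 * pi)" if "0 \<le> t" for t
  proof (cases "t = 0")
    case False
    hence t: "0 < t" using that by simp
    have "(LINT v:{0<..<1}|lborel. phi_kernel (2 * lam * t) v) \<le> (LINT v:{0<..<1}|lborel. (2 * lam * t) * (v powr (-1/2) * (1 - v) powr (-1/2)))"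
      using assms t by (intro set_integral_mono phi_kernel_integrable set_integrable_mult_right beta_half_integrable phi_kernel_bound) auto
    also have "\<dots> = 2 * lam * t * b" unfolding b_def by simp
    finally have I: "(LINT v:{0<..<1}|lborel. phi_kernel (2 * lam * t) v) \<le> 2 * lam * t * b" .
    have "phi lam 1 t = 1 / (4 * pi * lam * t) * (LINT v:{0<..<1}|lborel. phi_kernel (2 * lam * t) v)"
      using assms t by (simp add: phi_eq_kernel)
    also have "\<dots> \<le> 1 / (4 * pi * lam * t) * (2 * lam * t * b)"
      by (intro mult_left_mono I) (use assms t in auto)
    also have "\<dots> = b / (2 * pi)" using assms t by simp
    finally show ?thesis by simp
  qed (use \<open>b \<ge> 0\<close> in \<open>simp add: phi_def\<close>)
  thus ?thesis using that[of "1 / 2 + b / (2 * pi)"] \<open>b \<ge> 0\<close> by auto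
qed

lemma phi_continuous:
  assumes "0 < lam" shows "continuous_on {0<..} (phi lam 1)"
proof -
  have "isCont (phi lam 1) t" if t: "0 < t" for t
    unfolding isCont_def
  proof (rule tendsto_at_iff_sequentially[THEN iffD2, rule_format])
    fix X :: "nat \<Rightarrow> real" assume "\<And>i. X i \<in> UNIV - {t}" and X: "X \<longlonglongrightarrow> t"
    have ev: "eventually (\<lambda>n. 0 < X n \<and> X n < 2 * t) sequentially"
      using X t by (intro eventually_conj order_tendstoD[of X t]) auto
    \<comment> \<open>From \<open>n0\<close> on \<open>X n < 2 * t\<close>, so one majorant with
      \<open>a = 4 * lam * t\<close> serves the whole tail.\<close>
    have "(\<lambda>n. (LINT v:{0<..<1}|lborel. phi_kernel (2 * lam * X n) v)) \<longlonglongrightarrow> (LINT v:{0<..<1}|lborel. phi_kernel (2 * lam * t) v)"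
    proof -
      obtain n0 where n0: "\<And>n. n \<ge> n0 \<Longrightarrow> 0 < X n \<and> X n < 2 * t"
        using ev by (auto simp: eventually_sequentially)
      have "(\<lambda>n. (LINT v:{0<..<1}|lborel. phi_kernel (2 * lam * X (n + n0)) v)) \<longlonglongrightarrow> (LINT v:{0<..<1}|lborel. phi_kernel (2 * lam * t) v)"
        unfolding set_lebesgue_integral_def
      proof (rule integral_dominated_convergence)
        show "integrable lborel (\<lambda>v. indicator {0<..<1} v *\<^sub>R (4 * lam * t * (v powr (-1/2) * (1 - v) powr (-1/2))))"
          using set_integrable_mult_right[OF beta_half_integrable, of "4 * lam * t"] by (simp add: set_integrable_def)
        show "AE v in lborel. (\<lambda>n. indicator {0<..<1} v *\<^sub>R phi_kernel (2 * lam * X (n + n0)) v) \<longlonglongrightarrow> indicator {0<..<1} v *\<^sub>R phi_kernel (2 * lam * t) v"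
        proof (intro AE_I2 tendsto_intros)
          fix v :: real
          show "(\<lambda>n. phi_kernel (2 * lam * X (n + n0)) v) \<longlonglongrightarrow> phi_kernel (2 * lam * t) v"
          \<comment> \<open>Where the denominator vanishes, division by 0 makes every term of the
            sequence and its limit equal to 0.\<close>
          proof (cases "v powr (3/2) * sqrt (1 - v) = 0")
            case False
            thus ?thesis unfolding phi_kernel_def
              by (intro tendsto_intros LIMSEQ_ignore_initial_segment[OF X]) auto
          qed (auto simp: phi_kernel_def)
        qed
        show "AE v in lborel. norm (indicator {0<..<1} v *\<^sub>R phi_kernel (2 * lam * X (n + n0)) v)
           \<le> indicator {0<..<1} v *\<^sub>R (4 * lam * t * (v powr (-1/2) * (1 - v) powr (-1/2)))" for n
        proof (intro AE_I2)
          fix v :: real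
          have "0 < X (n + n0)" "X (n + n0) < 2 * t" using n0[of "n + n0"] by auto
          moreover have "phi_kernel (2 * lam * X (n + n0)) v \<le> 4 * lam * t * (v powr (-1/2) * (1 - v) powr (-1/2))" if "0 < v" "v < 1"
            using assms calculation that
            by (intro order_trans[OF phi_kernel_bound(2)] mult_right_mono) auto
          ultimately show "norm (indicator {0<..<1} v *\<^sub>R phi_kernel (2 * lam * X (n + n0)) v)
             \<le> indicator {0<..<1} v *\<^sub>R (4 * lam * t * (v powr (-1/2) * (1 - v) powr (-1/2)))"
            using assms phi_kernel_bound(1)[of "2 * lam * X (n + n0)" v] by (auto simp: indicator_def)
        qed
      qed simp_all
      thus ?thesis by (rule LIMSEQ_offset)
    qed
    hence lim: "(\<lambda>n. 1 / (4 * pi * lam * (1 * X n)) * (LINT v:{0<..<1}|lborel. phi_kernel (2 * lam * (1 * X n)) v))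
       \<longlonglongrightarrow> 1 / (4 * pi * lam * (1 * t)) * (LINT v:{0<..<1}|lborel. phi_kernel (2 * lam * (1 * t)) v)"
      using assms t X by (intro tendsto_intros) auto
    have "eventually (\<lambda>n. phi lam 1 (X n) = 1 / (4 * pi * lam * (1 * X n)) * (LINT v:{0<..<1}|lborel. phi_kernel (2 * lam * (1 * X n)) v)) sequentially"
      by (rule eventually_mono[OF ev]) (use assms in \<open>auto simp: phi_eq_kernel\<close>)
    from tendsto_cong[OF this] lim show "((phi lam 1) \<circ> X) \<longlonglongrightarrow> phi lam 1 t"
      using assms t by (simp add: phi_eq_kernel[of lam 1 t] comp_def)
  qed
  thus ?thesis by (simp add: continuous_on_eq_continuous_at)
qed

text \<open>Extended by 0 outside the positive half-line, \<open>phi lam 1\<close> can be convolved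
  over the whole line; the cut-off to \<open>{0<..<t}\<close> is then automatic.\<close>

lemma phi_measurable:
  assumes "0 < lam" shows "(\<lambda>t. indicator {0<..} t * phi lam 1 t) \<in> borel_measurable borel"
  using borel_measurable_continuous_on_indicator[OF _ phi_continuous[OF assms]] by simp

section \<open>Laplace transforms\<close>

text \<open>Working with \<open>ennreal\<close> values makes this pure Tonelli: measurability
  suffices and \<open>q\<close> may be any real. Functions on the half-line enter through extension
  by 0.\<close>

lemma nn_laplace_convolution:
  fixes f g :: "real \<Rightarrow> ennreal"
  assumes [measurable]: "f \<in> borel_measurable borel" "g \<in> borel_measurable borel"
  shows "(\<integral>\<^sup>+ t. (\<integral>\<^sup>+ u. f u * g (t - u) \<partial>lborel) * ennreal (exp (- q * t)) \<partial>lborel) =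
    (\<integral>\<^sup>+ t. f t * ennreal (exp (- q * t)) \<partial>lborel) * (\<integral>\<^sup>+ t. g t * ennreal (exp (- q * t)) \<partial>lborel)"
proof -
  have "(\<integral>\<^sup>+ t. (\<integral>\<^sup>+ u. f u * g (t - u) \<partial>lborel) * ennreal (exp (- q * t)) \<partial>lborel) =
    (\<integral>\<^sup>+ t. (\<integral>\<^sup>+ u. f u * g (t - u) * ennreal (exp (- q * t)) \<partial>lborel) \<partial>lborel)"
    by (intro nn_integral_cong nn_integral_multc[symmetric]) measurable
  also have "\<dots> = (\<integral>\<^sup>+ u. (\<integral>\<^sup>+ t. f u * g (t - u) * ennreal (exp (- q * t)) \<partial>lborel) \<partial>lborel)"
    by (rule lborel_pair.Fubini') measurable
  also have "\<dots> = (\<integral>\<^sup>+ u. (f u * ennreal (exp (- q * u))) * (\<integral>\<^sup>+ t. g t * ennreal (exp (- q * t)) \<partial>lborel) \<partial>lborel)"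
  proof (intro nn_integral_cong)
    fix u :: real
    have "(\<integral>\<^sup>+ t. f u * g (t - u) * ennreal (exp (- q * t)) \<partial>lborel)
      = (\<integral>\<^sup>+ t. f u * g (u + 1 * t - u) * ennreal (exp (- q * (u + 1 * t))) \<partial>lborel)"
      by (subst nn_integral_real_affine[where c = 1 and t = u]) simp_all
    also have "\<dots> = (\<integral>\<^sup>+ t. (f u * ennreal (exp (- q * u))) * (g t * ennreal (exp (- q * t))) \<partial>lborel)"
    proof (intro nn_integral_cong)
      fix t :: real
      have "exp (- q * (u + 1 * t)) = exp (- q * u) * exp (- q * t)"
        by (simp add: algebra_simps flip: exp_add)
      thus "f u * g (u + 1 * t - u) * ennreal (exp (- q * (u + 1 * t)))
        = (f u * ennreal (exp (- q * u))) * (g t * ennreal (exp (- q * t)))"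
        by (simp only: ennreal_mult' exp_ge_zero) (simp add: mult_ac)
    qed
    also have "\<dots> = (f u * ennreal (exp (- q * u))) * (\<integral>\<^sup>+ t. g t * ennreal (exp (- q * t)) \<partial>lborel)"
      by (rule nn_integral_cmult) measurable
    finally show "(\<integral>\<^sup>+ t. f u * g (t - u) * ennreal (exp (- q * t)) \<partial>lborel)
      = (f u * ennreal (exp (- q * u))) * (\<integral>\<^sup>+ t. g t * ennreal (exp (- q * t)) \<partial>lborel)" .
  qed
  also have "\<dots> = (\<integral>\<^sup>+ t. f t * ennreal (exp (- q * t)) \<partial>lborel) * (\<integral>\<^sup>+ t. g t * ennreal (exp (- q * t)) \<partial>lborel)"
    by (rule nn_integral_multc) measurable
  finally show ?thesis .
qed

text \<open>This is Gamma(1/2) = sqrt pi after rescaling time by \<open>q\<close>.\<close>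

lemma nn_laplace_inverse_sqrt:
  assumes q: "0 < q"
  shows "(\<integral>\<^sup>+ t. ennreal (indicator {0<..} t * t powr (-1/2)) * ennreal (exp (- q * t)) \<partial>lborel) = ennreal (sqrt (pi / q))"
proof -
  have "(\<integral>\<^sup>+ t. ennreal (indicator {0..} t * (t powr (1/2 - 1) / exp t)) \<partial>lborel) = ennreal (sqrt pi)"
    using Gamma_conv_nn_integral_real[of "1/2"] by (simp add: Gamma_one_half_real)
  also have "(\<integral>\<^sup>+ t. ennreal (indicator {0..} t * (t powr (1/2 - 1) / exp t)) \<partial>lborel)
    = ennreal \<bar>q\<bar> * (\<integral>\<^sup>+ t. ennreal (indicator {0..} (0 + q * t) * ((0 + q * t) powr (1/2 - 1) / exp (0 + q * t))) \<partial>lborel)"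
    by (rule nn_integral_real_affine) (use q in auto)
  also have "\<dots> = (\<integral>\<^sup>+ t. ennreal (sqrt q) * (ennreal (indicator {0<..} t * t powr (-1/2)) * ennreal (exp (- q * t))) \<partial>lborel)"
  proof (subst nn_integral_cmult[symmetric], measurable, intro nn_integral_cong)
    fix t :: real
    have "q * (indicator {0..} (0 + q * t) * ((0 + q * t) powr (1/2 - 1) / exp (0 + q * t)))
      = sqrt q * (indicator {0<..} t * t powr (-1/2) * exp (- q * t))"
    proof (cases "0 < t")
      case True
      have "q * (q * t) powr (-1/2) = sqrt q * t powr (-1/2)"
        using q True by (simp add: powr_mult powr_minus_divide powr_half_sqrt real_div_sqrt field_simps)
      thus ?thesis using True q by (simp add: exp_minus field_simps)
    next
      case False
      thus ?thesis using q by (auto simp: indicator_def zero_le_mult_iff)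
    qed
    thus "ennreal \<bar>q\<bar> * ennreal (indicator {0..} (0 + q * t) * ((0 + q * t) powr (1/2 - 1) / exp (0 + q * t)))
      = ennreal (sqrt q) * (ennreal (indicator {0<..} t * t powr (-1/2)) * ennreal (exp (- q * t)))"
      using q by (simp flip: ennreal_mult)
  qed
  also have "\<dots> = ennreal (sqrt q) * (\<integral>\<^sup>+ t. ennreal (indicator {0<..} t * t powr (-1/2)) * ennreal (exp (- q * t)) \<partial>lborel)"
    by (rule nn_integral_cmult) measurable
  finally have e: "ennreal (sqrt q) * (\<integral>\<^sup>+ t. ennreal (indicator {0<..} t * t powr (-1/2)) * ennreal (exp (- q * t)) \<partial>lborel) = ennreal (sqrt pi)" .
  have "(\<integral>\<^sup>+ t. ennreal (indicator {0<..} t * t powr (-1/2)) * ennreal (exp (- q * t)) \<partial>lborel)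
    = ennreal (1 / sqrt q) * (ennreal (sqrt q) * (\<integral>\<^sup>+ t. ennreal (indicator {0<..} t * t powr (-1/2)) * ennreal (exp (- q * t)) \<partial>lborel))"
    using q by (simp flip: mult.assoc ennreal_mult)
  also have "\<dots> = ennreal (sqrt (pi / q))"
    unfolding e using q by (simp flip: ennreal_mult add: real_sqrt_divide)
  finally show ?thesis .
qed

text \<open>The two terms cannot be transformed separately, because t^(-3/2) is not integrable at 0.
  Instead \<open>1 - exp (- a * t)\<close> is the integral of \<open>t * exp (- t * v)\<close> over
  v in [0, a]; the extra \<open>t\<close> tames the singularity, and Tonelli reduces to the
  transform of t^(-1/2) at \<open>q + v\<close>.\<close>

lemma nn_laplace_one_minus_exp:
  assumes q: "0 < q" and a: "0 < a"
  shows "(\<integral>\<^sup>+ t. ennreal (indicator {0<..} t * ((1 - exp (- a * t)) * t powr (-3/2))) * ennreal (exp (- q * t)) \<partial>lborel)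
     = ennreal (2 * sqrt pi * (sqrt (q + a) - sqrt q))"
proof -
  have inner: "(\<integral>\<^sup>+ v. ennreal (indicator {0..a} v * (t * exp (- t * v))) \<partial>lborel) = ennreal (1 - exp (- a * t))"
    if t: "0 < t" for t :: real
  proof -
    have "((\<lambda>v. t * exp (- t * v)) has_integral (- exp (- t * a)) - (- exp (- t * 0))) {0..a}"
      using a by (intro fundamental_theorem_of_calculus)
        (auto intro!: derivative_eq_intros simp flip: has_real_derivative_iff_has_vector_derivative)
    hence "(\<integral>\<^sup>+ v. ennreal (t * exp (- t * v)) * indicator {0..a} v \<partial>lborel) = ennreal (1 - exp (- a * t))"
      using t nn_integral_has_integral_lebesgue'[of "{0..a}" "\<lambda>v. t * exp (- t * v)"] by (simp add: mult.commute)
    thus ?thesis using t by (simp add: ennreal_mult' ennreal_indicator mult.commute)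
  qed
  have "(\<integral>\<^sup>+ t. ennreal (indicator {0<..} t * ((1 - exp (- a * t)) * t powr (-3/2))) * ennreal (exp (- q * t)) \<partial>lborel)
    = (\<integral>\<^sup>+ t. (\<integral>\<^sup>+ v. ennreal (indicator {0..a} v * (t * exp (- t * v))) * ennreal (indicator {0<..} t * t powr (-3/2) * exp (- q * t)) \<partial>lborel) \<partial>lborel)"
  proof (intro nn_integral_cong)
    fix t :: real
    show "ennreal (indicator {0<..} t * ((1 - exp (- a * t)) * t powr (-3/2))) * ennreal (exp (- q * t))
      = (\<integral>\<^sup>+ v. ennreal (indicator {0..a} v * (t * exp (- t * v))) * ennreal (indicator {0<..} t * t powr (-3/2) * exp (- q * t)) \<partial>lborel)"
    proof (cases "0 < t")
      case True
      have "(\<integral>\<^sup>+ v. ennreal (indicator {0..a} v * (t * exp (- t * v))) * ennreal (indicator {0<..} t * t powr (-3/2) * exp (- q * t)) \<partial>lborel)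
        = ennreal (1 - exp (- a * t)) * ennreal (indicator {0<..} t * t powr (-3/2) * exp (- q * t))"
        by (subst nn_integral_multc, measurable) (simp only: inner[OF True])
      thus ?thesis using a True by (simp flip: ennreal_mult)
    qed simp
  qed
  also have "\<dots> = (\<integral>\<^sup>+ v. (\<integral>\<^sup>+ t. ennreal (indicator {0..a} v * (t * exp (- t * v))) * ennreal (indicator {0<..} t * t powr (-3/2) * exp (- q * t)) \<partial>lborel) \<partial>lborel)"
    by (rule lborel_pair.Fubini') measurable
  also have "\<dots> = (\<integral>\<^sup>+ v. (\<integral>\<^sup>+ t. ennreal (indicator {0..a} v) * (ennreal (indicator {0<..} t * t powr (-1/2)) * ennreal (exp (- (q + v) * t))) \<partial>lborel) \<partial>lborel)"
  proof (intro nn_integral_cong)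
    fix v t :: real
    have "t * t powr (-3/2) = t powr (-1/2)" if "0 < t"
      using that powr_add[of t 1 "-3/2"] by simp
    thus "ennreal (indicator {0..a} v * (t * exp (- t * v))) * ennreal (indicator {0<..} t * t powr (-3/2) * exp (- q * t))
       = ennreal (indicator {0..a} v) * (ennreal (indicator {0<..} t * t powr (-1/2)) * ennreal (exp (- (q + v) * t)))"
      by (auto simp: indicator_def algebra_simps exp_add exp_diff exp_minus field_simps simp flip: ennreal_mult)
  qed
  also have "\<dots> = (\<integral>\<^sup>+ v. ennreal (sqrt (pi / (q + v))) * indicator {0..a} v \<partial>lborel)"
  proof (intro nn_integral_cong)
    fix v :: real
    have "(\<integral>\<^sup>+ t. ennreal (indicator {0<..} t * t powr (-1/2)) * ennreal (exp (- (q + v) * t)) \<partial>lborel)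
      = ennreal (sqrt (pi / (q + v)))" if "0 \<le> v" using nn_laplace_inverse_sqrt[of "q + v"] that q by simp
    thus "(\<integral>\<^sup>+ t. ennreal (indicator {0..a} v) * (ennreal (indicator {0<..} t * t powr (-1/2)) * ennreal (exp (- (q + v) * t))) \<partial>lborel)
      = ennreal (sqrt (pi / (q + v))) * indicator {0..a} v"
      by (subst nn_integral_cmult) (auto simp: indicator_def)
  qed
  also have "\<dots> = ennreal (2 * sqrt pi * (sqrt (q + a) - sqrt q))"
  proof -
    have "((\<lambda>v. sqrt (pi / (q + v))) has_integral (2 * sqrt pi * sqrt (q + a)) - (2 * sqrt pi * sqrt (q + 0))) {0..a}"
      using a q by (intro fundamental_theorem_of_calculus)
        (auto intro!: derivative_eq_intros simp: real_sqrt_divide divide_simps simp flip: has_real_derivative_iff_has_vector_derivative)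
    thus ?thesis using q a
      by (subst nn_integral_has_integral_lebesgue') (auto simp: algebra_simps)
  qed
  finally show ?thesis .
qed

text \<open>Up to \<open>1 / (4 * pi * lam)\<close>, \<open>phi lam 1\<close> is the convolution of
  the functions treated in the two preceding lemmas, with \<open>a = 2 * lam\<close>. Their
  transforms each carry a factor sqrt pi, which together cancel the pi of the constant.\<close>

lemma nn_laplace_phi:
  assumes lam: "0 < lam" and q: "0 < q"
  shows "(\<integral>\<^sup>+ t. ennreal (indicator {0<..} t * phi lam 1 t) * ennreal (exp (- q * t)) \<partial>lborel)
    = ennreal ((sqrt (1 + 2 * lam / q) - 1) / (2 * lam))"
proof -
  define f where "f u = ennreal (indicator {0<..} u * ((1 - exp (- (2 * lam) * u)) * u powr (-3/2)))" for u :: real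
  define g where "g u = ennreal (indicator {0<..} u * u powr (-1/2))" for u :: real
  have [measurable]: "f \<in> borel_measurable borel" "g \<in> borel_measurable borel"
    unfolding f_def g_def by measurable
  have conv: "ennreal (indicator {0<..} t * phi lam 1 t) = ennreal (1 / (4 * pi * lam)) * (\<integral>\<^sup>+ u. f u * g (t - u) \<partial>lborel)" for t
  proof (cases "0 < t")
    case False
    have "f u * g (t - u) = 0" for u using False by (auto simp: f_def g_def indicator_def)
    thus ?thesis using False by (simp del: mult_eq_0_iff)
  next
    case t: True
    have h: "f (0 + t * v) * g (t - (0 + t * v)) = ennreal (1 / t^2) * ennreal (indicator {0<..<1} v *\<^sub>R phi_kernel (2 * lam * t) v)" for v
    proof (cases "0 < v \<and> v < 1")
      case True
      have "t - t * v = t * (1 - v)" by (simp add: algebra_simps)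
      hence g: "g (t - (0 + t * v)) = ennreal (1 / (sqrt t * sqrt (1 - v)))"
        using t True by (simp add: g_def powr_minus_divide powr_half_sqrt real_sqrt_mult)
      have "(t * v) powr (-3/2) = 1 / (t * sqrt t * v powr (3/2))"
        using t True powr_add[of t 1 "1/2"] by (simp add: powr_minus_divide powr_mult powr_half_sqrt)
      hence f: "f (0 + t * v) = ennreal ((1 - exp (- (2 * lam * t) * v)) / (t * sqrt t * v powr (3/2)))"
        using t True by (simp add: f_def algebra_simps)
      show ?thesis unfolding f g using True t lam
        by (simp add: phi_kernel_def power2_eq_square flip: ennreal_mult)
    next
      case False
      have "t * v \<le> 0 \<or> t - t * v \<le> 0" using False t by (auto simp: mult_le_0_iff)
      hence "f (0 + t * v) * g (t - (0 + t * v)) = 0" by (auto simp: f_def g_def)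
      thus ?thesis using False by auto
    qed
    have "(\<integral>\<^sup>+ u. f u * g (t - u) \<partial>lborel) = ennreal \<bar>t\<bar> * (\<integral>\<^sup>+ v. f (0 + t * v) * g (t - (0 + t * v)) \<partial>lborel)"
      by (rule nn_integral_real_affine) (use t in auto)
    also have "\<dots> = ennreal (1 / t) * (\<integral>\<^sup>+ v. ennreal (indicator {0<..<1} v *\<^sub>R phi_kernel (2 * lam * t) v) \<partial>lborel)"
      unfolding h using t by (subst nn_integral_cmult) (auto simp: power2_eq_square simp flip: ennreal_mult mult.assoc)
    also have "(\<integral>\<^sup>+ v. ennreal (indicator {0<..<1} v *\<^sub>R phi_kernel (2 * lam * t) v) \<partial>lborel)
       = ennreal (LINT v:{0<..<1}|lborel. phi_kernel (2 * lam * t) v)"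
      unfolding set_lebesgue_integral_def using lam t phi_kernel_integrable[of "2 * lam * t"] unfolding set_integrable_def
      by (intro nn_integral_eq_integral) (auto simp: indicator_def phi_kernel_bound)
    finally show ?thesis using t lam
      by (simp add: phi_eq_kernel flip: ennreal_mult' mult.assoc)
  qed
  have "(\<integral>\<^sup>+ t. ennreal (indicator {0<..} t * phi lam 1 t) * ennreal (exp (- q * t)) \<partial>lborel)
    = ennreal (1 / (4 * pi * lam)) * (\<integral>\<^sup>+ t. (\<integral>\<^sup>+ u. f u * g (t - u) \<partial>lborel) * ennreal (exp (- q * t)) \<partial>lborel)"
    unfolding conv mult.assoc by (rule nn_integral_cmult) measurable
  also have "\<dots> = ennreal (1 / (4 * pi * lam)) * (ennreal (2 * sqrt pi * (sqrt (q + 2 * lam) - sqrt q)) * ennreal (sqrt (pi / q)))"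
    unfolding nn_laplace_convolution[OF \<open>f \<in> _\<close> \<open>g \<in> _\<close>]
    unfolding f_def g_def using lam q by (subst nn_laplace_one_minus_exp, simp, simp, subst nn_laplace_inverse_sqrt) auto
  also have "\<dots> = ennreal (1 / (4 * pi * lam) * ((2 * sqrt pi * (sqrt (q + 2 * lam) - sqrt q)) * sqrt (pi / q)))"
  proof -
    have "0 \<le> 2 * sqrt pi * (sqrt (q + 2 * lam) - sqrt q)" "0 \<le> sqrt (pi / q)" using lam q by auto
    thus ?thesis using lam by (subst (1 2) ennreal_mult) auto
  qed
  also have "1 / (4 * pi * lam) * ((2 * sqrt pi * (sqrt (q + 2 * lam) - sqrt q)) * sqrt (pi / q))
    = (sqrt (1 + 2 * lam / q) - 1) / (2 * lam)"
  proof -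
    have "1 + 2 * lam / q = (q + 2 * lam) / q" using q by (simp add: field_simps)
    hence s: "sqrt (1 + 2 * lam / q) = sqrt (q + 2 * lam) / sqrt q" by (simp add: real_sqrt_divide)
    define p where "p = sqrt pi"
    have p: "pi = p * p" "p \<noteq> 0" by (auto simp: p_def)
    have r: "sqrt (pi / q) = p / sqrt q" by (simp add: p_def real_sqrt_divide)
    show ?thesis unfolding s r p_def[symmetric] unfolding p(1) using q lam p(2) by (simp add: field_simps)
  qed
  finally show ?thesis .
qed

text \<open>The Laplace transform at \<open>r\<close> of the claimed law of A_t itself, before
  division by the horizon: an atom of mass \<open>2 * phi lam 1 t\<close> at \<open>t\<close> and
  the density \<open>2 * lam * phi lam 1 y * phi lam 1 (t - y)\<close> on (0, t).\<close>

definition occ_law_laplace :: "real \<Rightarrow> real \<Rightarrow> real \<Rightarrow> real" where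
  "occ_law_laplace lam r t = 2 * phi lam 1 t * exp (- r * t) +
     2 * lam * (LINT y:{0<..<t}|lborel. exp (- r * y) * phi lam 1 y * phi lam 1 (t - y))"

lemma phi_set_measurable:
  assumes "0 < lam"
  shows "(\<lambda>y. indicator {0<..<t} y * (exp (- r * y) * phi lam 1 y * phi lam 1 (t - y))) \<in> borel_measurable borel"
proof -
  note [measurable] = phi_measurable[OF assms]
  have "(\<lambda>y. exp (- r * y) * (indicator {0<..} y * phi lam 1 y) * (indicator {0<..} (t - y) * phi lam 1 (t - y))) \<in> borel_measurable borel"
    by measurable
  thus ?thesis
    by (rule measurable_cong[THEN iffD1, rotated]) (auto simp: indicator_def)
qed

lemma phi_conv_bound:
  assumes "0 < lam" "0 \<le> r"
  obtains B where "0 \<le> B" "\<And>t. 0 \<le> t \<Longrightarrow> phi lam 1 t \<le> B"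
    "\<And>t y. norm (indicator {0<..<t} y * (exp (- r * y) * phi lam 1 y * phi lam 1 (t - y))) \<le> B^2 * indicator {0..t} y"
proof -
  obtain B where B: "0 \<le> B" "\<And>t. 0 \<le> t \<Longrightarrow> phi lam 1 t \<le> B" using phi_bounded[OF assms(1)] by blast
  have "norm (indicator {0<..<t} y * (exp (- r * y) * phi lam 1 y * phi lam 1 (t - y))) \<le> B^2 * indicator {0..t} y" for t y
  proof (cases "0 < y \<and> y < t")
    case True
    have "exp (- r * y) * phi lam 1 y * phi lam 1 (t - y) \<le> 1 * B * B"
      using True assms B by (intro mult_mono) (auto intro: phi_nonneg mult_nonneg_nonneg)
    moreover have "0 \<le> exp (- r * y) * phi lam 1 y * phi lam 1 (t - y)"
      using True assms by (auto intro!: mult_nonneg_nonneg phi_nonneg)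
    ultimately show ?thesis using True by (simp add: power2_eq_square)
  qed (auto simp: indicator_def)
  thus ?thesis using B by (intro that)
qed

lemma phi_conv_integrable:
  assumes "0 < lam" "0 \<le> r"
  shows "integrable lborel (\<lambda>y. indicator {0<..<t} y * (exp (- r * y) * phi lam 1 y * phi lam 1 (t - y)))"
proof -
  obtain B where "0 \<le> B" "\<And>t. 0 \<le> t \<Longrightarrow> phi lam 1 t \<le> B"
    and B: "\<And>t y. norm (indicator {0<..<t} y * (exp (- r * y) * phi lam 1 y * phi lam 1 (t - y))) \<le> B^2 * indicator {0..t} y"
    by (rule phi_conv_bound[OF assms]) (rule that)
  show ?thesis
  proof (rule Bochner_Integration.integrable_bound)
    show "integrable lborel (\<lambda>y. B^2 * indicator {0..t} y :: real)"
      by (intro integrable_mult_right integrable_real_indicator) (auto simp: emeasure_lborel_Icc_eq)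
    show "AE x in lborel. norm (indicator {0<..<t} x * (exp (- r * x) * phi lam 1 x * phi lam 1 (t - x)))
         \<le> norm (B\<^sup>2 * indicator {0..t} x :: real)"
      by (intro AE_I2 order_trans[OF B]) simp
  qed (use phi_set_measurable[OF assms(1)] in simp)
qed

text \<open>The growth is in fact at most linear; \<open>exp t\<close> is the form required by
  \<open>laplace_transform_eq_0\<close>.\<close>

lemma occ_law_laplace_growth:
  assumes "0 < lam" "0 \<le> r"
  obtains C where "\<And>t. 0 < t \<Longrightarrow> \<bar>occ_law_laplace lam r t\<bar> \<le> C * exp t" "\<And>t. 0 < t \<Longrightarrow> 0 \<le> occ_law_laplace lam r t"
proof -
  obtain B where B: "0 \<le> B" "\<And>t. 0 \<le> t \<Longrightarrow> phi lam 1 t \<le> B"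
    "\<And>t y. norm (indicator {0<..<t} y * (exp (- r * y) * phi lam 1 y * phi lam 1 (t - y))) \<le> B^2 * indicator {0..t} y"
    by (rule phi_conv_bound[OF assms]) (rule that)
  have nn: "0 \<le> (LINT y:{0<..<t}|lborel. exp (- r * y) * phi lam 1 y * phi lam 1 (t - y))" for t
    unfolding set_lebesgue_integral_def using assms
    by (intro integral_nonneg_AE AE_I2) (auto simp: indicator_def intro!: mult_nonneg_nonneg phi_nonneg)
  have nn2: "0 \<le> occ_law_laplace lam r t" if "0 < t" for t
    unfolding occ_law_laplace_def using nn that assms
    by (auto intro!: add_nonneg_nonneg mult_nonneg_nonneg phi_nonneg)
  have "\<bar>occ_law_laplace lam r t\<bar> \<le> (2 * B + 2 * lam * B^2) * exp t" if t: "0 < t" for t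
  proof -
    have "(LINT y:{0<..<t}|lborel. exp (- r * y) * phi lam 1 y * phi lam 1 (t - y)) \<le> (LINT y|lborel. B^2 * indicator {0..t} y)"
      unfolding set_lebesgue_integral_def real_scaleR_def
    proof (rule integral_mono[OF phi_conv_integrable[OF assms]])
      show "integrable lborel (\<lambda>y. B^2 * indicator {0..t} y :: real)"
        by (intro integrable_mult_right integrable_real_indicator) (auto simp: emeasure_lborel_Icc_eq)
    qed (rule order_trans[OF abs_ge_self], use B(3)[of t] in simp)
    also have "\<dots> = B^2 * t" using t by simp
    finally have 1: "(LINT y:{0<..<t}|lborel. exp (- r * y) * phi lam 1 y * phi lam 1 (t - y)) \<le> B^2 * t" .
    have "phi lam 1 t * exp (- r * t) \<le> B * 1"
      using t assms B by (intro mult_mono) auto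
    hence "occ_law_laplace lam r t \<le> 2 * B + 2 * lam * (B^2 * t)"
      unfolding occ_law_laplace_def using 1 assms by (intro add_mono mult_left_mono) auto
    also have "\<dots> \<le> 2 * B * exp t + 2 * lam * (B^2 * exp t)"
      using assms B t exp_ge_add_one_self[of t] mult_left_mono[of 1 "exp t" "2 * B"]
      by (intro add_mono mult_left_mono) (auto simp del: exp_ge_add_one_self)
    finally show ?thesis using nn2[OF t] by (simp add: algebra_simps)
  qed
  thus ?thesis using nn2 that by blast
qed

text \<open>Dominated convergence with a moving endpoint. The point \<open>y = t\<close> is
  discarded as a null set: there the indicator may flip along the sequence, and
  \<open>phi lam 1\<close> would be evaluated at 0, where its continuity has not been
  established.\<close>

lemma occ_law_laplace_continuous:
  assumes "0 < lam" "0 \<le> r"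
  shows "continuous_on {0<..} (occ_law_laplace lam r)"
proof -
  obtain B where B: "0 \<le> B" "\<And>t. 0 \<le> t \<Longrightarrow> phi lam 1 t \<le> B"
    "\<And>t y. norm (indicator {0<..<t} y * (exp (- r * y) * phi lam 1 y * phi lam 1 (t - y))) \<le> B^2 * indicator {0..t} y"
    by (rule phi_conv_bound[OF assms]) (rule that)
  define F where "F t y = indicator {0<..<t} y * (exp (- r * y) * phi lam 1 y * phi lam 1 (t - y))" for t y
  have "isCont (\<lambda>t. LINT y|lborel. F t y) t" if t: "0 < t" for t
    unfolding isCont_def
  proof (rule tendsto_at_iff_sequentially[THEN iffD2, rule_format])
    fix X :: "nat \<Rightarrow> real" assume "\<And>i. X i \<in> UNIV - {t}" and X: "X \<longlonglongrightarrow> t"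
    \<comment> \<open>Confines the tail to one compact window, on which the constant majorant is
      integrable.\<close>
    have "eventually (\<lambda>n. X n < t + 1) sequentially"
      using X t by (intro order_tendstoD[of X t]) auto
    then obtain n0 where n0: "\<And>n. n \<ge> n0 \<Longrightarrow> X n < t + 1"
      by (auto simp: eventually_sequentially)
    have "(\<lambda>n. (LINT y|lborel. F (X (n + n0)) y)) \<longlonglongrightarrow> (LINT y|lborel. F t y)"
    proof (rule integral_dominated_convergence)
      show "integrable lborel (\<lambda>y. B^2 * indicator {0..t + 1} y :: real)"
        by (intro integrable_mult_right integrable_real_indicator) (auto simp: emeasure_lborel_Icc_eq)
      show "AE y in lborel. (\<lambda>n. F (X (n + n0)) y) \<longlonglongrightarrow> F t y"
        using AE_lborel_singleton[of t]
      proof eventually_elim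
        case (elim y)
        note X' = LIMSEQ_ignore_initial_segment[OF X, of n0]
        show ?case
        proof (cases "0 < y \<and> y < t")
          case True
          have ev: "eventually (\<lambda>n. y < X (n + n0)) sequentially"
            using True X' by (intro order_tendstoD[of _ t]) auto
          have "isCont (phi lam 1) (t - y)"
            using phi_continuous[OF assms(1)] True by (simp add: continuous_on_eq_continuous_at)
          hence "(\<lambda>n. phi lam 1 (X (n + n0) - y)) \<longlonglongrightarrow> phi lam 1 (t - y)"
            by (rule isCont_tendsto_compose) (intro tendsto_intros X')
          hence "(\<lambda>n. 1 * (exp (- r * y) * phi lam 1 y * phi lam 1 (X (n + n0) - y))) \<longlonglongrightarrow> F t y"
            unfolding F_def using True by (auto intro!: tendsto_intros)
          thus ?thesis
          proof (rule Lim_transform_eventually)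
            show "eventually (\<lambda>n. 1 * (exp (- r * y) * phi lam 1 y * phi lam 1 (X (n + n0) - y)) = F (X (n + n0)) y) sequentially"
              by (rule eventually_mono[OF ev]) (use True in \<open>auto simp: F_def\<close>)
          qed
        next
          case False
          have ev: "eventually (\<lambda>n. \<not> (0 < y \<and> y < X (n + n0))) sequentially"
          proof (cases "0 < y")
            case True
            have "eventually (\<lambda>n. X (n + n0) < y) sequentially"
              using True False elim X' by (intro order_tendstoD[of _ t]) auto
            thus ?thesis by (rule eventually_mono) auto
          qed simp
          have "F t y = 0" using False by (auto simp: F_def indicator_def)
          moreover have "eventually (\<lambda>n. F (X (n + n0)) y = 0) sequentially"
            by (rule eventually_mono[OF ev]) (auto simp: F_def indicator_def)
          ultimately show ?thesis by (simp add: tendsto_eventually)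
        qed
      qed
      show "AE y in lborel. norm (F (X (n + n0)) y) \<le> B^2 * indicator {0..t + 1} y" for n
        using B(3)[of "X (n + n0)"] n0[of "n + n0"] unfolding F_def
        by (intro AE_I2 order_trans[OF B(3)]) (auto simp: indicator_def)
    qed (use phi_set_measurable[OF assms(1)] in \<open>simp_all add: F_def\<close>)
    thus "((\<lambda>t. LINT y|lborel. F t y) \<circ> X) \<longlonglongrightarrow> (LINT y|lborel. F t y)"
      unfolding comp_def by (rule LIMSEQ_offset)
  qed
  hence "continuous_on {0<..} (\<lambda>t. LINT y|lborel. F t y)"
    by (simp add: continuous_on_eq_continuous_at)
  thus ?thesis unfolding occ_law_laplace_def set_lebesgue_integral_def real_scaleR_def F_def
    by (intro continuous_intros phi_continuous assms)
qed

text \<open>The weight \<open>exp (- r * u)\<close> sits on the first convolution factor only, so it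
  shifts \<open>q\<close> to \<open>q + r\<close> in one of the two transforms. This is where s and
  s' separate.\<close>

lemma nn_laplace_occ_law:
  assumes lam: "0 < lam" and q: "0 < q" and r: "0 \<le> r"
  shows "(\<integral>\<^sup>+ t. ennreal (indicator {0<..} t * occ_law_laplace lam r t) * ennreal (exp (- q * t)) \<partial>lborel)
    = ennreal ((sqrt (1 + 2 * lam / (q + r)) - 1) * (sqrt (1 + 2 * lam / q) + 1) / (2 * lam))"
proof -
  define g where "g u = ennreal (indicator {0<..} u * phi lam 1 u)" for u :: real
  define f where "f u = ennreal (exp (- r * u)) * g u" for u :: real
  note [measurable] = phi_measurable[OF lam]
  have [measurable]: "g \<in> borel_measurable borel" unfolding g_def by measurable
  have [measurable]: "f \<in> borel_measurable borel" unfolding f_def by measurable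
  let ?P = "(sqrt (1 + 2 * lam / q) - 1) / (2 * lam)" and ?P' = "(sqrt (1 + 2 * lam / (q + r)) - 1) / (2 * lam)"
  have Pnn: "0 \<le> ?P" "0 \<le> ?P'" using lam q r by auto
  have Lg: "(\<integral>\<^sup>+ t. g t * ennreal (exp (- q * t)) \<partial>lborel) = ennreal ?P"
    unfolding g_def using nn_laplace_phi[OF lam q] .
  have Lf: "(\<integral>\<^sup>+ t. f t * ennreal (exp (- q * t)) \<partial>lborel) = ennreal ?P'"
  proof -
    have "f t * ennreal (exp (- q * t)) = g t * ennreal (exp (- (q + r) * t))" for t
    proof -
      have "exp (- (q + r) * t) = exp (- r * t) * exp (- q * t)" by (simp add: algebra_simps flip: exp_add)
      thus ?thesis unfolding f_def by (simp only: ennreal_mult' exp_ge_zero) (simp add: mult_ac)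
    qed
    thus ?thesis unfolding g_def using nn_laplace_phi[OF lam, of "q + r"] q r by simp
  qed
  have eq: "ennreal (indicator {0<..} t * occ_law_laplace lam r t) = 2 * f t + ennreal (2 * lam) * (\<integral>\<^sup>+ u. f u * g (t - u) \<partial>lborel)" for t
  proof (cases "0 < t")
    case False
    have "f u * g (t - u) = 0" for u using False by (auto simp: f_def g_def indicator_def)
    thus ?thesis using False by (simp add: f_def g_def del: mult_eq_0_iff)
  next
    case True
    have "(\<integral>\<^sup>+ u. f u * g (t - u) \<partial>lborel) = (\<integral>\<^sup>+ u. ennreal (indicator {0<..<t} u * (exp (- r * u) * phi lam 1 u * phi lam 1 (t - u))) \<partial>lborel)"
    proof (intro nn_integral_cong)
      fix u
      show "f u * g (t - u) = ennreal (indicator {0<..<t} u * (exp (- r * u) * phi lam 1 u * phi lam 1 (t - u)))"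
        using lam by (auto simp: f_def g_def indicator_def phi_nonneg simp flip: ennreal_mult)
    qed
    also have "\<dots> = ennreal (LINT y:{0<..<t}|lborel. exp (- r * y) * phi lam 1 y * phi lam 1 (t - y))"
      unfolding set_lebesgue_integral_def real_scaleR_def using lam
      by (intro nn_integral_eq_integral phi_conv_integrable r)
         (auto simp: indicator_def intro!: mult_nonneg_nonneg phi_nonneg)
    finally have c: "(\<integral>\<^sup>+ u. f u * g (t - u) \<partial>lborel) = ennreal (LINT y:{0<..<t}|lborel. exp (- r * y) * phi lam 1 y * phi lam 1 (t - y))" .
    have i0: "0 \<le> (LINT y:{0<..<t}|lborel. exp (- r * y) * phi lam 1 y * phi lam 1 (t - y))"
      unfolding set_lebesgue_integral_def using lam
      by (intro integral_nonneg_AE AE_I2) (auto simp: indicator_def intro!: mult_nonneg_nonneg phi_nonneg)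
    have f2: "2 * f t = ennreal (2 * phi lam 1 t * exp (- r * t))"
      using True lam by (simp add: f_def g_def phi_nonneg ennreal_mult mult_ac)
    show ?thesis unfolding c f2 using True lam i0
      by (simp add: occ_law_laplace_def phi_nonneg flip: ennreal_mult ennreal_plus)
  qed
  have "(\<integral>\<^sup>+ t. ennreal (indicator {0<..} t * occ_law_laplace lam r t) * ennreal (exp (- q * t)) \<partial>lborel)
    = (\<integral>\<^sup>+ t. 2 * (f t * ennreal (exp (- q * t))) + ennreal (2 * lam) * ((\<integral>\<^sup>+ u. f u * g (t - u) \<partial>lborel) * ennreal (exp (- q * t))) \<partial>lborel)"
    unfolding eq by (simp add: algebra_simps)
  also have "\<dots> = 2 * ennreal ?P' + ennreal (2 * lam) * (ennreal ?P' * ennreal ?P)"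
    by (subst nn_integral_add, measurable, subst nn_integral_cmult, measurable, subst nn_integral_cmult, measurable)
       (simp only: nn_laplace_convolution[OF \<open>f \<in> _\<close> \<open>g \<in> _\<close>] Lf Lg)
  also have "\<dots> = ennreal (2 * ?P' + 2 * lam * (?P' * ?P))"
  proof -
    have "2 * ennreal ?P' = ennreal (2 * ?P')"
      by (subst ennreal_mult') (simp_all only: ennreal_numeral zero_le_numeral)
    moreover have "ennreal (2 * lam) * (ennreal ?P' * ennreal ?P) = ennreal (2 * lam * (?P' * ?P))"
      using ennreal_mult[OF Pnn(2,1)] ennreal_mult[OF _ mult_nonneg_nonneg[OF Pnn(2,1)], of "2 * lam"] lam
      by (simp only: mult_nonneg_nonneg less_imp_le zero_le_numeral)
    ultimately show ?thesis using Pnn lam by (subst ennreal_plus) (auto simp only: intro!: mult_nonneg_nonneg)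
  qed
  \<comment> \<open>\<open>2 * ?P' * (1 + lam * ?P)\<close>, and \<open>1 + lam * ?P\<close> is half
    of \<open>sqrt (1 + 2 * lam / q) + 1\<close>.\<close>
  also have "2 * ?P' + 2 * lam * (?P' * ?P) = (sqrt (1 + 2 * lam / (q + r)) - 1) * (sqrt (1 + 2 * lam / q) + 1) / (2 * lam)"
    using lam by (simp add: field_simps)
  finally show ?thesis .
qed

section \<open>Uniqueness of Laplace transforms\<close>

lemma polynomial_approximation_Icc:
  fixes f :: "real \<Rightarrow> real"
  assumes "continuous_on {a..b} f" "0 < e"
  obtains c n where "\<And>x. x \<in> {a..b} \<Longrightarrow> \<bar>f x - (\<Sum>i\<le>n. c i * x ^ i)\<bar> < e"
proof -
  obtain g where g: "real_polynomial_function g" "\<And>x. x \<in> {a..b} \<Longrightarrow> \<bar>f x - g x\<bar> < e"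
    using Stone_Weierstrass_real_polynomial_function[OF compact_Icc assms] by blast
  obtain c n where "g = (\<lambda>x. \<Sum>i\<le>n. c i * x ^ i)"
    using g(1) by (auto simp: real_polynomial_function_iff_sum)
  thus ?thesis using g(2) that by blast
qed

lemma exp_neg_integrable:
  assumes "0 < q" shows "set_integrable lborel {0<..} (\<lambda>t::real. exp (- q * t))"
  using integrable_I0i_exp_mscale[OF assms] by (simp add: mult.commute)

text \<open>A Weierstrass argument with \<open>f\<close> tested against a weighted copy of itself.
  Every polynomial in \<open>exp (- t)\<close> is orthogonal to \<open>exp (- 2 * t) * f t\<close>;
  hence so is every continuous function of \<open>exp (- t)\<close> on [0, 1], in particular
  \<open>G\<close>, and the resulting integral is a weighted square of \<open>f\<close>.\<close>

lemma laplace_transform_eq_0: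
  fixes f :: "real \<Rightarrow> real"
  assumes cont: "continuous_on {0<..} f"
    and bound: "\<And>t. 0 < t \<Longrightarrow> \<bar>f t\<bar> \<le> C * exp t"
    and zero: "\<And>n::nat. 2 \<le> n \<Longrightarrow> (LINT t:{0<..}|lborel. exp (- real n * t) * f t) = 0"
    and t: "0 < t"
  shows "f t = 0"
proof -
  have C: "0 \<le> C" using order_trans[OF abs_ge_zero bound[of 1]] by (simp add: zero_le_mult_iff)
  \<comment> \<open>\<open>f (- ln x)\<close> may grow like \<open>1 / x\<close> at 0 and need have
    no limit at 1. One factor \<open>x\<close> absorbs the growth, the second makes \<open>G\<close>
    vanish at 0, and \<open>1 - x\<close> makes it vanish at 1, so the extension by 0 is
    continuous.\<close>
  define G where "G x = (if 0 < x \<and> x < 1 then x\<^sup>2 * (1 - x) * f (- ln x) else 0)" for x :: real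
  have Gb: "\<bar>G x\<bar> \<le> C * max 0 (x * (1 - x))" for x
  proof (cases "0 < x \<and> x < 1")
    case True
    have "\<bar>f (- ln x)\<bar> \<le> C * exp (- ln x)" using True by (intro bound) auto
    also have "\<dots> = C / x" using True by (simp add: exp_minus inverse_eq_divide)
    finally have "\<bar>f (- ln x)\<bar> \<le> C / x" .
    hence "x\<^sup>2 * (1 - x) * \<bar>f (- ln x)\<bar> \<le> x\<^sup>2 * (1 - x) * (C / x)"
      using True by (intro mult_left_mono) auto
    also have "\<dots> = C * (x * (1 - x))" using True by (simp add: power2_eq_square)
    also have "\<dots> \<le> C * max 0 (x * (1 - x))" using C by (intro mult_left_mono) auto
    finally show ?thesis using True by (simp add: G_def abs_mult)
  next
    case False
    thus ?thesis using C by (auto simp: G_def)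
  qed
  have "isCont G x" for x
  proof (cases "0 < x \<and> x < 1")
    case True
    have fc: "isCont f (- ln x)" using cont True by (simp add: continuous_on_eq_continuous_at)
    have lnc: "isCont (\<lambda>x. - ln x) x" using True by (intro continuous_intros) auto
    have "isCont (\<lambda>x. f (- ln x)) x"
      using isCont_o2[OF lnc fc] .
    hence "isCont (\<lambda>x. x\<^sup>2 * (1 - x) * f (- ln x)) x"
      by (intro continuous_intros)
    moreover have "eventually (\<lambda>y. G y = y\<^sup>2 * (1 - y) * f (- ln y)) (nhds x)"
      using eventually_nhds_in_open[of "{0<..<1}" x] True by (auto elim!: eventually_mono simp: G_def)
    ultimately show ?thesis by (simp add: isCont_cong)
  next
    case False
    have "((\<lambda>x. C * max 0 (x * (1 - x))) \<longlongrightarrow> C * max 0 (x * (1 - x))) (at x)"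
      by (intro tendsto_intros)
    moreover have "x * (1 - x) \<le> 0" using False by (auto simp: mult_le_0_iff)
    hence "C * max 0 (x * (1 - x)) = 0" by (simp only: max_absorb1 mult_zero_right)
    ultimately have "((\<lambda>x. C * max 0 (x * (1 - x))) \<longlongrightarrow> 0) (at x)" by (simp only:)
    hence "(G \<longlongrightarrow> 0) (at x)"
      by (rule Lim_null_comparison[rotated]) (use Gb in simp)
    moreover have "G x = 0" using False by (auto simp: G_def)
    ultimately show ?thesis by (simp add: isCont_def)
  qed
  hence Gc: "continuous_on {0..1} G" by (simp add: continuous_at_imp_continuous_on)
  have [measurable]: "(\<lambda>t. indicator {0<..} t * f t) \<in> borel_measurable borel"
    using borel_measurable_continuous_on_indicator[OF _ cont] by simp
  have int: "integrable lborel (\<lambda>t. indicator {0<..} t * (exp (- real n * t) * f t))" if "2 \<le> n" for n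
  proof (rule Bochner_Integration.integrable_bound)
    show "integrable lborel (\<lambda>t. C * (indicator {0<..} t *\<^sub>R exp (- 1 * t)))"
      using exp_neg_integrable[of 1, OF zero_less_one] unfolding set_integrable_def by (intro integrable_mult_right)
    have "(\<lambda>t. exp (- real n * t) * (indicator {0<..} t * f t)) \<in> borel_measurable borel" by measurable
    thus "(\<lambda>t. indicator {0<..} t * (exp (- real n * t) * f t)) \<in> borel_measurable lborel"
      by (simp add: mult_ac)
    show "AE t in lborel. norm (indicator {0<..} t * (exp (- real n * t) * f t)) \<le> norm (C * (indicator {0<..} t *\<^sub>R exp (- 1 * t)))"
    proof (intro AE_I2)
      fix t :: real
      have "exp (- real n * t) * \<bar>f t\<bar> \<le> C * exp (- t)" if "0 < t"
      proof -
        have "exp (- real n * t) * \<bar>f t\<bar> \<le> exp (- 2 * t) * (C * exp t)"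
          using that \<open>2 \<le> n\<close> bound by (intro mult_mono) auto
        also have "\<dots> = C * exp (- t)" by (simp flip: exp_add)
        finally show ?thesis .
      qed
      thus "norm (indicator {0<..} t * (exp (- real n * t) * f t)) \<le> norm (C * (indicator {0<..} t *\<^sub>R exp (- 1 * t)))"
        using C by (auto simp: indicator_def abs_mult)
    qed
  qed
  define F where "F t = indicator {0<..} t * (exp (- 2 * t) * f t)" for t
  have Fint: "integrable lborel F" unfolding F_def using int[of 2] by simp
  have FGint: "integrable lborel (\<lambda>t. F t * G (exp (- t)))"
  proof (rule Bochner_Integration.integrable_bound)
    show "integrable lborel (\<lambda>t. C * F t)" using Fint by simp
    have "G \<in> borel_measurable borel"
      using \<open>\<And>x. isCont G x\<close> by (intro borel_measurable_continuous_onI continuous_at_imp_continuous_on) auto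
    thus "(\<lambda>t. F t * G (exp (- t))) \<in> borel_measurable lborel" using Fint by measurable
    have "\<bar>G x\<bar> \<le> C" if "x \<in> {0..1}" for x
    proof -
      have "x * (1 - x) \<le> 1 * 1" using that by (intro mult_mono) auto
      hence "C * max 0 (x * (1 - x)) \<le> C * 1" using C by (intro mult_left_mono) auto
      thus ?thesis using Gb[of x] by simp
    qed
    hence "\<bar>F t\<bar> * \<bar>G (exp (- t))\<bar> \<le> \<bar>F t\<bar> * C" for t
      by (cases "t > 0") (auto simp: F_def indicator_def intro!: mult_left_mono)
    thus "AE t in lborel. norm (F t * G (exp (- t))) \<le> norm (C * F t)"
      using C by (intro AE_I2) (simp add: abs_mult mult.commute)
  qed
  have small: "\<bar>LINT t|lborel. F t * G (exp (- t))\<bar> \<le> e * (LINT t|lborel. \<bar>F t\<bar>)" if e: "0 < e" for e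
  proof -
    obtain c n where c: "\<And>x. x \<in> {0..1} \<Longrightarrow> \<bar>G x - (\<Sum>i\<le>n. c i * x ^ i)\<bar> < e"
      by (rule polynomial_approximation_Icc[OF Gc e]) (rule that)
    \<comment> \<open>The factor \<open>exp (- 2 * t)\<close> in \<open>F\<close> shifts the
      exponents to \<open>i + 2\<close>, the range covered by the hypothesis
      \<open>zero\<close>.\<close>
    have pe: "F t * (\<Sum>i\<le>n. c i * exp (- t) ^ i) = (\<Sum>i\<le>n. c i * (indicator {0<..} t * (exp (- real (i + 2) * t) * f t)))" for t
    proof -
      have E: "exp (- real (i + 2) * t) = exp (- 2 * t) * exp (- t) ^ i" for i
        by (simp add: algebra_simps flip: exp_of_nat_mult exp_add)
      have "F t * (c i * exp (- t) ^ i) = c i * (indicator {0<..} t * (exp (- real (i + 2) * t) * f t))" for i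
        unfolding F_def E by (simp only: mult_ac)
      thus ?thesis unfolding sum_distrib_left by (intro sum.cong refl)
    qed
    have pint: "integrable lborel (\<lambda>t. F t * (\<Sum>i\<le>n. c i * exp (- t) ^ i))"
      unfolding pe by (intro Bochner_Integration.integrable_sum integrable_mult_right int) auto
    have "(LINT t|lborel. F t * (\<Sum>i\<le>n. c i * exp (- t) ^ i)) = 0"
      unfolding pe
    proof (subst Bochner_Integration.integral_sum)
      show "(\<Sum>i\<le>n. LINT t|lborel. c i * (indicator {0<..} t * (exp (- real (i + 2) * t) * f t))) = 0"
      proof (intro sum.neutral ballI)
        fix i
        show "(LINT t|lborel. c i * (indicator {0<..} t * (exp (- real (i + 2) * t) * f t))) = 0"
          using zero[of "i + 2"] unfolding set_lebesgue_integral_def by simp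
      qed
    qed (intro integrable_mult_right int, simp)
    hence "(LINT t|lborel. F t * G (exp (- t))) = (LINT t|lborel. F t * G (exp (- t)) - F t * (\<Sum>i\<le>n. c i * exp (- t) ^ i))"
      using FGint pint by simp
    also have "\<bar>\<dots>\<bar> \<le> (LINT t|lborel. \<bar>F t * G (exp (- t)) - F t * (\<Sum>i\<le>n. c i * exp (- t) ^ i)\<bar>)"
      by (rule integral_abs_bound)
    also have "\<dots> \<le> (LINT t|lborel. e * \<bar>F t\<bar>)"
    proof (rule integral_mono)
      show "\<bar>F t * G (exp (- t)) - F t * (\<Sum>i\<le>n. c i * exp (- t) ^ i)\<bar> \<le> e * \<bar>F t\<bar>" for t
      proof (cases "0 < t")
        case True
        have "\<bar>F t\<bar> * \<bar>G (exp (- t)) - (\<Sum>i\<le>n. c i * exp (- t) ^ i)\<bar> \<le> \<bar>F t\<bar> * e"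
          using True by (intro mult_left_mono[OF less_imp_le[OF c]]) auto
        thus ?thesis unfolding right_diff_distrib[symmetric] abs_mult by (simp only: mult.commute)
      qed (simp add: F_def)
    qed (use FGint pint Fint in auto)
    finally show ?thesis by simp
  qed
  have I0: "(LINT t|lborel. F t * G (exp (- t))) = 0"
  proof (rule ccontr)
    define I J where "I = (LINT t|lborel. F t * G (exp (- t)))" and "J = (LINT t|lborel. \<bar>F t\<bar>)"
    assume "(LINT t|lborel. F t * G (exp (- t))) \<noteq> 0"
    hence I: "0 < \<bar>I\<bar>" by (simp add: I_def)
    have J: "0 \<le> J" by (simp add: J_def)
    \<comment> \<open>The tolerance makes the bound smaller than \<open>\<bar>I\<bar>\<close>; the
      \<open>+ 1\<close> keeps the divisor positive when \<open>J = 0\<close>.\<close>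
    have "\<bar>I\<bar> \<le> \<bar>I\<bar> / (2 * (J + 1)) * J"
      using small[of "\<bar>I\<bar> / (2 * (J + 1))"] I J by (simp add: I_def[symmetric] J_def[symmetric])
    also have "\<dots> < \<bar>I\<bar>" using I J by (simp add: divide_simps)
    finally show False by simp
  qed
  \<comment> \<open>In this form the integrand is visibly nonnegative, so its vanishing integral
    forces it to vanish almost everywhere.\<close>
  have FG: "F s * G (exp (- s)) = indicator {0<..} s * (exp (- 4 * s) * (1 - exp (- s)) * (f s)\<^sup>2)" for s
  proof (cases "0 < s")
    case True
    have "exp (- 2 * s) * (exp (- s))\<^sup>2 = exp (- 4 * s)"
      by (simp flip: exp_of_nat_mult exp_add)
    thus ?thesis using True by (simp add: F_def G_def power2_eq_square mult_ac)
  qed (simp add: F_def)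
  have "AE s in lborel. F s * G (exp (- s)) = 0"
    using I0 by (subst (asm) integral_nonneg_eq_0_iff_AE[OF FGint]) (auto simp: FG indicator_def)
  hence ae: "AE s in lborel. 0 < s \<longrightarrow> f s = 0"
    by eventually_elim (auto simp: FG)
  show "f t = 0"
  proof (rule ccontr)
    assume "f t \<noteq> 0"
    \<comment> \<open>Continuity makes the set where \<open>f\<close> differs from 0 open; a
      nonempty open set cannot be null.\<close>
    define S where "S = {0<..} \<inter> f -` (- {0})"
    have S: "open S" unfolding S_def by (intro continuous_open_preimage cont) auto
    moreover have "t \<in> S" using t \<open>f t \<noteq> 0\<close> by (auto simp: S_def)
    ultimately have "\<not> negligible S" using open_not_negligible by blast
    moreover have "S \<in> null_sets lborel"
      using S ae by (subst AE_iff_null_sets) (auto simp: S_def elim!: eventually_mono)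
    hence "S \<in> null_sets lebesgue" by (rule null_sets_completionI)
    ultimately show False by (simp add: negligible_iff_null_sets)
  qed
qed

text \<open>The map y to exp (- y) is injective and continuous on [0, 1], with image [exp (-1), 1],
  so polynomials in exp (- y) are uniformly dense among continuous functions there. Testing with
  cosine and sine identifies the characteristic functions.\<close>

lemma prob_unit_interval_eqI:
  fixes \<mu> \<nu> :: "real measure"
  assumes \<mu>: "real_distribution \<mu>" "AE y in \<mu>. 0 \<le> y \<and> y \<le> 1"
    and \<nu>: "real_distribution \<nu>" "AE y in \<nu>. 0 \<le> y \<and> y \<le> 1"
    and eq: "\<And>n::nat. (LINT y|\<mu>. exp (- real n * y)) = (LINT y|\<nu>. exp (- real n * y))"
  shows "\<mu> = \<nu>"
proof -
  have bnd: "integrable m g" if "real_distribution m" "AE y in m. 0 \<le> y \<and> y \<le> 1" "continuous_on UNIV g"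
    for m and g :: "real \<Rightarrow> real"
  proof -
    interpret m: real_distribution m by (rule that(1))
    have "compact (g ` {0..1})"
      by (intro compact_continuous_image continuous_on_subset[OF that(3)]) auto
    hence "bounded (g ` {0..1})" by (rule compact_imp_bounded)
    then obtain B where B: "\<And>y. y \<in> {0..1} \<Longrightarrow> norm (g y) \<le> B" unfolding bounded_iff by blast
    have [measurable]: "g \<in> borel_measurable borel" using that(3) by (rule borel_measurable_continuous_onI)
    have "AE y in m. norm (g y) \<le> B" using that(2) by eventually_elim (rule B, simp)
    thus ?thesis by (rule m.integrable_const_bound) simp
  qed
  have fg: "(LINT y|\<mu>. g y) = (LINT y|\<nu>. g y)" if g: "continuous_on UNIV g" for g :: "real \<Rightarrow> real"
  proof (rule ccontr)
    assume ne: "(LINT y|\<mu>. g y) \<noteq> (LINT y|\<nu>. g y)"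
    \<comment> \<open>Replacing \<open>g\<close> by the exponential polynomial costs at most
      \<open>e\<close> under each measure, in total \<open>2 * e\<close>, less than the gap
      \<open>3 * e\<close>.\<close>
    define e where "e = \<bar>(LINT y|\<mu>. g y) - (LINT y|\<nu>. g y)\<bar> / 3"
    have e: "0 < e" using ne by (simp add: e_def)
    have "continuous_on {exp (-1)..1} (\<lambda>x. g (- ln x))"
      by (intro continuous_on_compose2[OF g] continuous_intros) (auto dest: order.strict_trans2[OF exp_gt_zero])
    then obtain c n where c: "\<And>x. x \<in> {exp (-1)..1} \<Longrightarrow> \<bar>g (- ln x) - (\<Sum>i\<le>n. c i * x ^ i)\<bar> < e"
      by (rule polynomial_approximation_Icc[OF _ e]) (rule that)
    let ?p = "\<lambda>y. \<Sum>i\<le>n. c i * exp (- real i * y)"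
    have gp: "\<bar>g y - ?p y\<bar> \<le> e" if "0 \<le> y" "y \<le> 1" for y
      using c[of "exp (- y)"] that by (simp add: exp_of_nat_mult[symmetric] less_imp_le)
    have near: "\<bar>(LINT y|m. g y) - (LINT y|m. ?p y)\<bar> \<le> e"
      if m: "real_distribution m" "AE y in m. 0 \<le> y \<and> y \<le> 1" for m
    proof -
      interpret m: real_distribution m by (rule m(1))
      have i: "integrable m g" "integrable m ?p" by (intro bnd m g continuous_intros)+
      have "\<bar>(LINT y|m. g y) - (LINT y|m. ?p y)\<bar> = \<bar>LINT y|m. g y - ?p y\<bar>" using i by simp
      also have "\<dots> \<le> (LINT y|m. \<bar>g y - ?p y\<bar>)" by (rule integral_abs_bound)
      also have "\<dots> \<le> (LINT y|m. e)"
      proof (rule integral_mono_AE)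
        show "AE y in m. \<bar>g y - ?p y\<bar> \<le> e" using m(2) by eventually_elim (rule gp, auto)
      qed (use i in auto)
      also have "\<dots> = e" using m.prob_space by simp
      finally show ?thesis .
    qed
    have "(LINT y|m. ?p y) = (\<Sum>i\<le>n. c i * (LINT y|m. exp (- real i * y)))"
      if m: "real_distribution m" "AE y in m. 0 \<le> y \<and> y \<le> 1" for m
      by (subst Bochner_Integration.integral_sum) (auto intro!: bnd m continuous_intros)
    from this[OF \<mu>] this[OF \<nu>] have "(LINT y|\<mu>. ?p y) = (LINT y|\<nu>. ?p y)" by (simp only: eq)
    hence "\<bar>(LINT y|\<mu>. g y) - (LINT y|\<nu>. g y)\<bar> \<le> 2 * e" using near[OF \<mu>] near[OF \<nu>] by linarith
    thus False using e by (simp add: e_def)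
  qed
  \<comment> \<open>Splitting into real and imaginary part lets the real-valued statement
    \<open>fg\<close> apply.\<close>
  have ch: "char m = (\<lambda>t. Complex (LINT y|m. cos (t * y)) (LINT y|m. sin (t * y)))"
    if m: "real_distribution m" "AE y in m. 0 \<le> y \<and> y \<le> 1" for m
  proof
    fix t
    interpret m: real_distribution m by (rule m(1))
    have "char m t = (CLINT y|m. iexp (t * y))" by (simp add: char_def)
    have i: "integrable m (\<lambda>y. iexp (t * y))"
      by (rule m.integrable_const_bound[of _ 1]) auto
    have "Re (char m t) = (LINT y|m. Re (iexp (t * y)))" "Im (char m t) = (LINT y|m. Im (iexp (t * y)))"
      unfolding char_def using i by (simp_all only: integral_Re integral_Im)
    thus "char m t = Complex (LINT y|m. cos (t * y)) (LINT y|m. sin (t * y))"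
      by (simp add: complex_eq_iff Re_exp Im_exp)
  qed
  have "char \<mu> = char \<nu>" unfolding ch[OF \<mu>] ch[OF \<nu>]
    by (intro ext arg_cong2[of _ _ _ _ Complex] fg continuous_intros)
  thus ?thesis by (intro Levy_uniqueness \<mu> \<nu>)
qed

section \<open>Sample paths\<close>

text \<open>\<open>zigzag\<close> and \<open>occupation\<close> are the W and A of the overview,
  taken as functionals of one deterministic path; probability enters only later.\<close>

definition zigzag :: "(real \<Rightarrow> nat) \<Rightarrow> real \<Rightarrow> real" where
  "zigzag n t = (LINT u:{0..t}|lborel. (- 1) ^ n u)"

definition occupation :: "(real \<Rightarrow> nat) \<Rightarrow> real \<Rightarrow> real" where
  "occupation n t = (LINT s:{0..t}|lborel. heaviside (zigzag n s))"

lemma heaviside_measurable [measurable]: "heaviside \<in> borel_measurable borel"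
  unfolding heaviside_def[abs_def] by measurable

text \<open>The positive part is the antiderivative of H away from the kink. Occupation along a
  straight piece thereby becomes a difference of positive parts.\<close>

lemma max_0_deriv:
  assumes "y \<noteq> 0" shows "((\<lambda>y. max 0 y) has_real_derivative heaviside y) (at y)"
proof (cases "0 < y")
  case True
  have "eventually (\<lambda>z. z = max 0 z) (nhds y)"
    using eventually_nhds_in_open[of "{0<..}" y] True by (auto elim!: eventually_mono)
  from DERIV_cong_ev[OF refl this refl, of 1] True show ?thesis by (simp add: heaviside_def)
next
  case False
  hence "y < 0" using assms by simp
  have "eventually (\<lambda>z. 0 = max 0 z) (nhds y)"
    using eventually_nhds_in_open[of "{..<0}" y] \<open>y < 0\<close> by (auto elim!: eventually_mono)
  from DERIV_cong_ev[OF refl this refl, of 0] \<open>y < 0\<close> show ?thesis by (simp add: heaviside_def)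
qed

lemma heaviside_bounds: "0 \<le> heaviside x" "heaviside x \<le> 1"
  by (auto simp: heaviside_def)

locale counting_path =
  fixes n :: "real \<Rightarrow> nat"
  assumes mono: "0 \<le> s \<Longrightarrow> s \<le> t \<Longrightarrow> n s \<le> n t"
begin

lemma sign_integrable:
  assumes "0 \<le> s" shows "set_integrable lborel {s..t} (\<lambda>u. (- 1 :: real) ^ n u)"
proof -
  \<comment> \<open>Negative times are unconstrained. Freezing the path at its value at 0 yields a
    monotone, hence Borel, function on the whole line.\<close>
  have "mono (\<lambda>u. real (n (max 0 u)))" by (intro monoI) (auto intro!: mono)
  hence "(\<lambda>u. real (n (max 0 u))) \<in> borel_measurable borel" by (rule borel_measurable_mono)
  hence "(\<lambda>u. (- 1 :: real) ^ (nat \<lfloor>real (n (max 0 u))\<rfloor>)) \<in> borel_measurable borel" by measurable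
  hence [measurable]: "(\<lambda>u. (- 1 :: real) ^ n (max 0 u)) \<in> borel_measurable borel" by simp
  have "set_integrable lborel {s..t} (\<lambda>u. (- 1 :: real) ^ n (max 0 u))"
    unfolding set_integrable_def
  proof (rule Bochner_Integration.integrable_bound)
    show "integrable lborel (\<lambda>u. indicator {s..t} u :: real)"
      by (intro integrable_real_indicator) (auto simp: emeasure_lborel_Icc_eq)
  qed (auto simp: indicator_def power_abs)
  moreover have "set_integrable lborel {s..t} (\<lambda>u. (- 1 :: real) ^ n (max 0 u)) \<longleftrightarrow> set_integrable lborel {s..t} (\<lambda>u. (- 1 :: real) ^ n u)"
    by (rule set_integrable_cong) (use assms in \<open>auto simp: max_def\<close>)
  ultimately show ?thesis by simp
qed

lemma zigzag_eq_integral: "zigzag n t = integral {0..t} (\<lambda>u. (- 1) ^ n u)"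
  unfolding zigzag_def using set_borel_integral_eq_integral(2)[OF sign_integrable] by simp

lemma zigzag_diff:
  assumes "0 \<le> s" "s \<le> t"
  shows "((\<lambda>u. (- 1) ^ n u) has_integral (zigzag n t - zigzag n s)) {s..t}"
proof -
  have i: "(\<lambda>u. (- 1 :: real) ^ n u) integrable_on {a..b}" if "0 \<le> a" for a b
    using set_borel_integral_eq_integral(1)[OF sign_integrable[OF that]] .
  have "integral {0..s} (\<lambda>u. (- 1 :: real) ^ n u) + integral {s..t} (\<lambda>u. (- 1) ^ n u) = integral {0..t} (\<lambda>u. (- 1) ^ n u)"
    using assms by (intro Henstock_Kurzweil_Integration.integral_combine i) auto
  hence "integral {s..t} (\<lambda>u. (- 1) ^ n u) = zigzag n t - zigzag n s"
    by (simp add: zigzag_eq_integral)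
  thus ?thesis using integrable_integral[OF i[OF assms(1), of t]] by simp
qed

lemma zigzag_0 [simp]: "zigzag n 0 = 0"
  by (simp add: zigzag_eq_integral)

lemma zigzag_lipschitz:
  assumes "0 \<le> s" "s \<le> t" shows "\<bar>zigzag n t - zigzag n s\<bar> \<le> t - s"
  using has_integral_bound_real[OF _ finite.emptyI zigzag_diff[OF assms], of 1] assms by (auto simp: power_abs)

lemma zigzag_affine:
  assumes "0 \<le> s" "s \<le> t" "n t = n s"
  shows "zigzag n t = zigzag n s + (- 1) ^ n s * (t - s)"
proof -
  have eq: "n u = n s" if "u \<in> {s..t}" for u
    using mono[of s u] mono[of u t] that assms by auto
  have "((\<lambda>u. (- 1) ^ n s) has_integral (zigzag n t - zigzag n s)) {s..t}"
    by (rule has_integral_eq[OF _ zigzag_diff[OF assms(1,2)]]) (drule eq, simp)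
  moreover have "((\<lambda>u. (- 1 :: real) ^ n s) has_integral (t - s) *\<^sub>R (- 1) ^ n s) {s..t}"
    using has_integral_const_real[of "(- 1 :: real) ^ n s" s t] assms by simp
  ultimately have "zigzag n t - zigzag n s = (t - s) * (- 1) ^ n s"
    by (auto dest: has_integral_unique)
  thus ?thesis by (simp add: mult.commute)
qed

lemma zigzag_continuous: "continuous_on {0..} (zigzag n)"
proof (rule continuous_on_iff[THEN iffD2], safe)
  fix x e :: real assume x: "0 \<le> x" and e: "0 < e"
  have "\<bar>zigzag n y - zigzag n x\<bar> \<le> \<bar>y - x\<bar>" if "0 \<le> y" for y
    using zigzag_lipschitz[of x y] zigzag_lipschitz[of y x] that x by (cases "x \<le> y") auto
  thus "\<exists>d>0. \<forall>x'\<in>{0..}. dist x' x < d \<longrightarrow> dist (zigzag n x') (zigzag n x) < e"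
    using e by (intro exI[of _ e]) (auto simp: dist_real_def intro: le_less_trans)
qed

text \<open>On each of the finitely many level intervals of the path the integral is affine with slope
  \<open>\<plusminus>1\<close>, so it vanishes at most once there.\<close>

lemma zigzag_zeros_finite: "finite {s \<in> {0..t}. zigzag n s = 0}"
proof -
  have "finite {s \<in> {0..t}. zigzag n s = 0 \<and> n s = k}" for k
  proof -
    let ?A = "{s \<in> {0..t}. zigzag n s = 0 \<and> n s = k}"
    have le: "s = s'" if "s \<in> ?A" "s' \<in> ?A" "s \<le> s'" for s s'
      using zigzag_affine[of s s'] that by auto
    have "s = s'" if "s \<in> ?A" "s' \<in> ?A" for s s'
      using le[OF that] le[OF that(2,1)] by (cases "s \<le> s'") auto
    hence "?A \<subseteq> {s}" if "s \<in> ?A" for s using that by blast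
    hence "?A = {} \<or> (\<exists>s. ?A \<subseteq> {s})" by blast
    thus ?thesis by (auto intro: finite_subset)
  qed
  hence "finite (\<Union>k\<le>n t. {s \<in> {0..t}. zigzag n s = 0 \<and> n s = k})" by (intro finite_UN_I finite_atMost)
  moreover have "{s \<in> {0..t}. zigzag n s = 0} \<subseteq> (\<Union>k\<le>n t. {s \<in> {0..t}. zigzag n s = 0 \<and> n s = k})"
  proof
    fix s assume "s \<in> {s \<in> {0..t}. zigzag n s = 0}"
    thus "s \<in> (\<Union>k\<le>n t. {s \<in> {0..t}. zigzag n s = 0 \<and> n s = k})" using mono[of s t] by simp
  qed
  ultimately show ?thesis by (rule rev_finite_subset)
qed

lemma heaviside_zigzag_integrable:
  assumes "0 \<le> s" shows "set_integrable lborel {s..t} (\<lambda>u. heaviside (c * zigzag n u))"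
proof -
  have [measurable]: "(\<lambda>u. indicator {s..t} u * zigzag n u) \<in> borel_measurable borel"
    using borel_measurable_continuous_on_indicator[OF _ continuous_on_subset[OF zigzag_continuous, of "{s..t}"]] assms by auto
  have "set_integrable lborel {s..t} (\<lambda>u. heaviside (c * (indicator {s..t} u * zigzag n u)))"
    unfolding set_integrable_def
  proof (rule Bochner_Integration.integrable_bound)
    show "integrable lborel (\<lambda>u. indicator {s..t} u :: real)"
      by (intro integrable_real_indicator) (auto simp: emeasure_lborel_Icc_eq)
    show "AE u in lborel. norm (indicator {s..t} u *\<^sub>R heaviside (c * (indicator {s..t} u * zigzag n u))) \<le> norm (indicator {s..t} u :: real)"
      by (intro AE_I2) (simp add: heaviside_bounds mult_left_le)
  qed measurable
  moreover have "set_integrable lborel {s..t} (\<lambda>u. heaviside (c * (indicator {s..t} u * zigzag n u))) \<longleftrightarrow> set_integrable lborel {s..t} (\<lambda>u. heaviside (c * zigzag n u))"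
    by (rule set_integrable_cong) auto
  ultimately show ?thesis by simp
qed

lemma occupation_eq_integral: "occupation n t = integral {0..t} (\<lambda>u. heaviside (zigzag n u))"
  unfolding occupation_def using set_borel_integral_eq_integral(2)[OF heaviside_zigzag_integrable[of 0 t 1]] by simp

lemma occupation_diff:
  assumes "0 \<le> s" "s \<le> t"
  shows "((\<lambda>u. heaviside (zigzag n u)) has_integral (occupation n t - occupation n s)) {s..t}"
proof -
  have i: "(\<lambda>u. heaviside (zigzag n u)) integrable_on {a..b}" if "0 \<le> a" for a b
    using set_borel_integral_eq_integral(1)[OF heaviside_zigzag_integrable[OF that, of b 1]] by simp
  have "integral {0..s} (\<lambda>u. heaviside (zigzag n u)) + integral {s..t} (\<lambda>u. heaviside (zigzag n u)) = integral {0..t} (\<lambda>u. heaviside (zigzag n u))"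
    using assms by (intro Henstock_Kurzweil_Integration.integral_combine i) auto
  hence "integral {s..t} (\<lambda>u. heaviside (zigzag n u)) = occupation n t - occupation n s"
    by (simp add: occupation_eq_integral)
  thus ?thesis using integrable_integral[OF i[OF assms(1), of t]] by simp
qed

lemma occupation_0 [simp]: "occupation n 0 = 0"
  by (simp add: occupation_eq_integral)

lemma occupation_mono:
  assumes "0 \<le> s" "s \<le> t" shows "occupation n s \<le> occupation n t" "occupation n t - occupation n s \<le> t - s"
proof -
  have "0 \<le> occupation n t - occupation n s"
    by (rule has_integral_nonneg[OF occupation_diff[OF assms]]) (rule heaviside_bounds)
  thus "occupation n s \<le> occupation n t" by simp
  have "norm (occupation n t - occupation n s) \<le> 1 * measure lborel {s..t}"
    by (rule has_integral_bound_real[OF _ finite.emptyI occupation_diff[OF assms]]) (auto simp: heaviside_bounds)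
  thus "occupation n t - occupation n s \<le> t - s" using assms by simp
qed

lemma occupation_nonneg: "0 \<le> t \<Longrightarrow> 0 \<le> occupation n t"
  using occupation_mono(1)[of 0 t] by simp

text \<open>Equal endpoint values of a monotone path mean no jump in between, so W moves with slope
  \<sigma> = \<open>(- 1) ^ n s\<close> and ds = \<sigma> dW. Integrating H(W) ds thus gives
  \<sigma> times the increment of the positive part of W.\<close>

lemma occupation_affine:
  assumes "0 \<le> s" "s \<le> t" "n t = n s"
  shows "occupation n t - occupation n s = (- 1) ^ n s * (max 0 (zigzag n t) - max 0 (zigzag n s))"
proof -
  let ?g = "\<lambda>u. (- 1) ^ n s * max 0 (zigzag n s + (- 1) ^ n s * (u - s))"
  have sgn: "(- 1 :: real) ^ n s = 1 \<or> (- 1 :: real) ^ n s = - 1" by (cases "even (n s)") simp_all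
  have z: "zigzag n u = zigzag n s + (- 1) ^ n s * (u - s)" if "u \<in> {s..t}" for u
    using mono[of s u] mono[of u t] that assms by (intro zigzag_affine) auto
  have "((\<lambda>u. heaviside (zigzag n s + (- 1) ^ n s * (u - s))) has_integral ?g t - ?g s) {s..t}"
  proof (rule fundamental_theorem_of_calculus_strong)
    \<comment> \<open>The only zero of the affine piece; the slope is its own inverse.\<close>
    let ?S = "{s - (- 1) ^ n s * zigzag n s}"
    show "finite ?S" by simp
    show "s \<le> t" by fact
    show "continuous_on {s..t} ?g" by (intro continuous_intros)
    fix u assume "u \<in> {s..t} - ?S"
    hence ne: "zigzag n s + (- 1) ^ n s * (u - s) \<noteq> 0" using sgn by auto
    have "((\<lambda>u. zigzag n s + (- 1) ^ n s * (u - s)) has_real_derivative (- 1) ^ n s) (at u)"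
      by (auto intro!: derivative_eq_intros)
    from DERIV_cmult[OF DERIV_chain2[OF max_0_deriv[OF ne] this], of "(- 1) ^ n s"]
    have "(?g has_real_derivative heaviside (zigzag n s + (- 1) ^ n s * (u - s))) (at u)"
      using sgn by auto
    thus "(?g has_vector_derivative heaviside (zigzag n s + (- 1) ^ n s * (u - s))) (at u)"
      by (simp add: has_real_derivative_iff_has_vector_derivative)
  qed
  hence "((\<lambda>u. heaviside (zigzag n u)) has_integral ?g t - ?g s) {s..t}"
    by (rule has_integral_eq[rotated]) (simp only: z)
  hence "occupation n t - occupation n s = ?g t - ?g s"
    using occupation_diff[OF assms(1,2)] by (rule has_integral_unique[rotated])
  thus ?thesis using z[of t] assms by (simp add: algebra_simps)
qed

lemma occupation_minus:
  assumes "0 \<le> t"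
  shows "(LINT s:{0..t}|lborel. heaviside (- zigzag n s)) = t - occupation n t"
proof -
  have i: "((\<lambda>u. heaviside (zigzag n u)) has_integral occupation n t) {0..t}"
    using occupation_diff[of 0 t] assms by simp
  have "((\<lambda>u. 1 - heaviside (zigzag n u)) has_integral (t - occupation n t)) {0..t}"
    using has_integral_diff[OF has_integral_const_real[of "1::real" 0 t] i] assms by simp
  hence "((\<lambda>u. heaviside (- zigzag n u)) has_integral (t - occupation n t)) {0..t}"
    by (rule has_integral_spike_finite[OF zigzag_zeros_finite, rotated]) (auto simp: heaviside_def)
  thus ?thesis
    using set_borel_integral_eq_integral(2)[OF heaviside_zigzag_integrable[of 0 t "-1"]]
    by (simp add: integral_unique)
qed

end

lemma heaviside_mult_pos: "0 < c \<Longrightarrow> heaviside (c * x) = heaviside x"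
  by (simp add: heaviside_def zero_less_mult_iff)

lemma (in counting_path) eta_eq_occupation:
  assumes "0 < c" "0 < T" "\<And>s. n s = N s \<omega>"
  shows "eta (telegraph_plus c N) T 0 \<omega> = occupation n T / T"
    "eta (telegraph_minus c N) T 0 \<omega> = 1 - occupation n T / T"
proof -
  have t: "telegraph V N s \<omega> = V \<omega> * zigzag n s" for V s
    by (simp add: telegraph_def zigzag_def assms(3))
  show "eta (telegraph_plus c N) T 0 \<omega> = occupation n T / T"
    unfolding eta_def t occupation_def using assms(1) by (simp add: heaviside_mult_pos)
  have "eta (telegraph_minus c N) T 0 \<omega> = 1 / T * (T - occupation n T)"
    unfolding eta_def t using assms heaviside_mult_pos[OF assms(1), of "- zigzag n _"]
    by (simp add: occupation_minus)
  thus "eta (telegraph_minus c N) T 0 \<omega> = 1 - occupation n T / T"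
    using assms(2) by (simp add: field_simps)
qed

section \<open>Measurability of path functionals\<close>

text \<open>Progressive measurability of the sign: joint in outcome and time, using only the
  variables \<open>N s\<close> with s in [0, t], so that \<open>G\<close> may be the history up to
  \<open>t\<close>.\<close>

lemma path_measurable_aux:
  fixes N :: "real \<Rightarrow> 'a \<Rightarrow> nat"
  assumes meas: "\<And>s. 0 \<le> s \<Longrightarrow> s \<le> t \<Longrightarrow> N s \<in> G \<rightarrow>\<^sub>M count_space UNIV"
    and rcont: "\<And>\<omega> s. \<omega> \<in> space G \<Longrightarrow> 0 \<le> s \<Longrightarrow> continuous (at_right s) (\<lambda>s. N s \<omega>)"
    and t: "0 \<le> t"
  shows "(\<lambda>(\<omega>, u). (- 1 :: real) ^ N (min t (max 0 u)) \<omega>) \<in> borel_measurable (G \<Otimes>\<^sub>M lborel)"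
proof (rule borel_measurable_LIMSEQ_metric)
  let ?g = "\<lambda>u::real. min t (max 0 u)"
  \<comment> \<open>The next point of the grid of mesh \<open>1 / Suc m\<close>, to the right of
    \<open>u\<close> as right-continuity demands. The clamp \<open>?g\<close> is applied after this
    rounding, so no time beyond \<open>t\<close> is ever evaluated.\<close>
  define a where "a m u = (of_int \<lfloor>u * real (Suc m)\<rfloor> + 1) / real (Suc m)" for m :: nat and u :: real
  let ?f = "\<lambda>m p. (- 1 :: real) ^ N (?g (a m (snd p))) (fst p)"
  fix m
  let ?h = "\<lambda>(i::int) p. (- 1 :: real) ^ N (?g ((of_int i + 1) / real (Suc m))) (fst p)"
  have "(\<lambda>p. ?h \<lfloor>snd p * real (Suc m)\<rfloor> p) \<in> borel_measurable (G \<Otimes>\<^sub>M lborel)"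
  \<comment> \<open>For a fixed grid index the expression depends on the outcome alone; countably
    many indices are glued.\<close>
  proof (rule measurable_compose_countable[where f = ?h])
    fix i :: int
    have [measurable]: "N (?g ((of_int i + 1) / real (Suc m))) \<in> G \<rightarrow>\<^sub>M count_space UNIV"
      using t by (intro meas) auto
    show "?h i \<in> borel_measurable (G \<Otimes>\<^sub>M lborel)"
      by measurable
  qed measurable
  thus "?f m \<in> borel_measurable (G \<Otimes>\<^sub>M lborel)" by (simp add: a_def)
next
  let ?g = "\<lambda>u::real. min t (max 0 u)"
  define a where "a m u = (of_int \<lfloor>u * real (Suc m)\<rfloor> + 1) / real (Suc m)" for m :: nat and u :: real
  fix p assume "p \<in> space (G \<Otimes>\<^sub>M (lborel :: real measure))"
  then obtain \<omega> u where p: "p = (\<omega>, u)" and \<omega>: "\<omega> \<in> space G" by (auto simp: space_pair_measure)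
  have a: "u \<le> a m u" "a m u \<le> u + 1 / real (Suc m)" for m
  proof -
    have "u * real (Suc m) / real (Suc m) \<le> a m u"
      unfolding a_def by (rule divide_right_mono) linarith+
    thus "u \<le> a m u" by simp
    have "a m u \<le> (u * real (Suc m) + 1) / real (Suc m)"
      unfolding a_def by (rule divide_right_mono) linarith+
    thus "a m u \<le> u + 1 / real (Suc m)" by (simp add: add_divide_distrib)
  qed
  have "((\<lambda>s. N s \<omega>) \<longlongrightarrow> N (?g u) \<omega>) (at_right (?g u))"
    using rcont[OF \<omega>, of "?g u"] t by (simp add: continuous_within)
  hence "eventually (\<lambda>s. N s \<omega> = N (?g u) \<omega>) (at_right (?g u))"
    by (simp add: tendsto_discrete)
  then obtain b where b: "b > ?g u" "\<And>s. ?g u < s \<Longrightarrow> s < b \<Longrightarrow> N s \<omega> = N (?g u) \<omega>"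
    by (auto simp: eventually_at_right_field)
  have "(\<lambda>m. 1 / real (Suc m)) \<longlonglongrightarrow> 0" using LIMSEQ_inverse_real_of_nat by (simp add: inverse_eq_divide)
  hence "eventually (\<lambda>m. 1 / real (Suc m) < b - ?g u) sequentially"
    using b(1) by (intro order_tendstoD(2)[of _ 0]) auto
  hence "eventually (\<lambda>m. (- 1 :: real) ^ N (?g (a m u)) \<omega> = (- 1) ^ N (?g u) \<omega>) sequentially"
  proof eventually_elim
    case (elim m)
    have "?g u \<le> ?g (a m u)" "?g (a m u) < b" using a[of m] elim by auto
    hence "N (?g (a m u)) \<omega> = N (?g u) \<omega>" using b(2)[of "?g (a m u)"] by (metis order_less_le)
    thus ?case by (simp only:)
  qed
  thus "(\<lambda>m. (- 1 :: real) ^ N (?g ((of_int \<lfloor>snd p * real (Suc m)\<rfloor> + 1) / real (Suc m))) (fst p)) \<longlonglongrightarrow>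
    (case p of (\<omega>, u) \<Rightarrow> (- 1) ^ N (?g u) \<omega>)"
    unfolding p a_def by (simp add: tendsto_eventually)
qed

text \<open>\<open>G\<close> stays general for three uses: the full space for eta, the history up to
  \<open>t\<close> for independence of future increments, and the sigma-algebra generated by the
  process for independence of the initial sign.\<close>

lemma path_functionals_measurable:
  fixes N :: "real \<Rightarrow> 'a \<Rightarrow> nat"
  assumes meas: "\<And>s. 0 \<le> s \<Longrightarrow> s \<le> t \<Longrightarrow> N s \<in> G \<rightarrow>\<^sub>M count_space UNIV"
    and rcont: "\<And>\<omega> s. \<omega> \<in> space G \<Longrightarrow> 0 \<le> s \<Longrightarrow> continuous (at_right s) (\<lambda>s. N s \<omega>)"
    and t: "0 \<le> t"
  shows "(\<lambda>\<omega>. zigzag (\<lambda>s. N s \<omega>) t) \<in> borel_measurable G"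
    "V \<in> borel_measurable G \<Longrightarrow> eta (telegraph V N) t 0 \<in> borel_measurable G"
    "(\<lambda>\<omega>. occupation (\<lambda>s. N s \<omega>) t) \<in> borel_measurable G"
proof -
  define F where "F p = (- 1 :: real) ^ N (min t (max 0 (snd p))) (fst p)" for p
  have F[measurable]: "F \<in> borel_measurable (G \<Otimes>\<^sub>M lborel)"
    using path_measurable_aux[OF meas rcont t] by (simp add: F_def[abs_def] split_beta)
  define Z where "Z p = (LINT u|lborel. (if 0 \<le> u \<and> u \<le> snd p then F (fst p, u) else 0))" for p
  have Z[measurable]: "Z \<in> borel_measurable (G \<Otimes>\<^sub>M lborel)"
    unfolding Z_def[abs_def] by (rule lborel.borel_measurable_lebesgue_integral) measurable
  have ZZ: "zigzag (\<lambda>s. N s \<omega>) s = Z (\<omega>, s)" if "s \<le> t" for s \<omega>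
    unfolding zigzag_def Z_def set_lebesgue_integral_def
    by (intro Bochner_Integration.integral_cong) (use that in \<open>auto simp: F_def\<close>)
  have "(\<lambda>\<omega>. Z (\<omega>, t)) \<in> borel_measurable G" by measurable
  thus "(\<lambda>\<omega>. zigzag (\<lambda>s. N s \<omega>) t) \<in> borel_measurable G" by (simp add: ZZ)
  have *: "(\<lambda>\<omega>. LINT s:{0..t}|lborel. heaviside (V \<omega> * zigzag (\<lambda>s. N s \<omega>) s)) \<in> borel_measurable G"
    if [measurable]: "V \<in> borel_measurable G" for V
  proof -
    have "(\<lambda>\<omega>. LINT s|lborel. indicator {0..t} s * heaviside (V \<omega> * Z (\<omega>, s))) \<in> borel_measurable G"
      by (rule lborel.borel_measurable_lebesgue_integral) measurable
    also have "(\<lambda>\<omega>. LINT s|lborel. indicator {0..t} s * heaviside (V \<omega> * Z (\<omega>, s))) =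
      (\<lambda>\<omega>. LINT s:{0..t}|lborel. heaviside (V \<omega> * zigzag (\<lambda>s. N s \<omega>) s))"
      unfolding set_lebesgue_integral_def
      by (intro ext Bochner_Integration.integral_cong) (auto simp: ZZ indicator_def)
    finally show ?thesis .
  qed
  show "(\<lambda>\<omega>. occupation (\<lambda>s. N s \<omega>) t) \<in> borel_measurable G"
    using *[of "\<lambda>_. 1"] by (simp add: occupation_def)
  show "eta (telegraph V N) t 0 \<in> borel_measurable G" if V: "V \<in> borel_measurable G"
    using *[OF V] unfolding eta_def[abs_def] telegraph_def zigzag_def by simp
qed

section \<open>Independence of increments and history\<close>

context poisson_process
begin

lemma path: "\<omega> \<in> space M \<Longrightarrow> counting_path (\<lambda>s. N s \<omega>)"
  by unfold_locales (rule N_mono)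

text \<open>A pi-system generating the natural filtration at time \<open>t\<close>; independence
  from an increment need only be checked on it.\<close>

definition cylinders :: "real \<Rightarrow> 'a set set" where
  "cylinders t = {{\<omega> \<in> space M. \<forall>s\<in>J. N s \<omega> \<in> B s} | J B. finite J \<and> J \<subseteq> {0..t}}"

lemma cylindersI:
  assumes "finite J" "J \<subseteq> {0..t}" shows "{\<omega> \<in> space M. \<forall>s\<in>J. N s \<omega> \<in> B s} \<in> cylinders t"
  unfolding cylinders_def by (rule CollectI, rule exI[of _ J], rule exI[of _ B]) (simp add: assms)

definition history :: "real \<Rightarrow> 'a measure" where
  "history t = sigma (space M) (cylinders t)"

lemma space_history [simp]: "space (history t) = space M"
  by (simp add: history_def space_measure_of_conv)

lemma sets_history: "sets (history t) = sigma_sets (space M) (cylinders t)"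
  unfolding history_def by (rule sets_measure_of) (auto simp: cylinders_def)

lemma cylinders_Int_stable: "Int_stable (cylinders t)"
proof (rule Int_stableI)
  fix a b assume "a \<in> cylinders t" "b \<in> cylinders t"
  then obtain J B J' B' where a: "a = {\<omega> \<in> space M. \<forall>s\<in>J. N s \<omega> \<in> B s}" "finite J" "J \<subseteq> {0..t}"
    and b: "b = {\<omega> \<in> space M. \<forall>s\<in>J'. N s \<omega> \<in> B' s}" "finite J'" "J' \<subseteq> {0..t}"
    unfolding cylinders_def by blast
  let ?B = "\<lambda>s. (if s \<in> J then B s else UNIV) \<inter> (if s \<in> J' then B' s else UNIV)"
  have "a \<inter> b = {\<omega> \<in> space M. \<forall>s\<in>J \<union> J'. N s \<omega> \<in> ?B s}" unfolding a b by auto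
  moreover have "finite (J \<union> J')" "J \<union> J' \<subseteq> {0..t}" using a b by auto
  ultimately show "a \<inter> b \<in> cylinders t" by (simp only: cylindersI)
qed

lemma cylinders_events: "cylinders t \<subseteq> events"
proof
  fix a assume "a \<in> cylinders t"
  then obtain J B where a: "a = {\<omega> \<in> space M. \<forall>s\<in>J. N s \<omega> \<in> B s}" "finite J" "J \<subseteq> {0..t}"
    unfolding cylinders_def by blast
  have "{\<omega> \<in> space M. N s \<omega> \<in> B s} \<in> events" if "s \<in> J" for s
  proof -
    have [measurable]: "N s \<in> M \<rightarrow>\<^sub>M count_space UNIV" using that a by (intro random_variable_N) auto
    show ?thesis by measurable
  qed
  thus "a \<in> events" unfolding a(1) using a(2) by (intro sets.sets_Collect_finite_All) auto
qed

lemma N_history_measurable: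
  assumes "0 \<le> s" "s \<le> t" shows "N s \<in> history t \<rightarrow>\<^sub>M count_space UNIV"
proof (rule measurableI)
  fix A :: "nat set"
  have "N s -` A \<inter> space M = {\<omega> \<in> space M. \<forall>s'\<in>{s}. N s' \<omega> \<in> A}" by auto
  also have "\<dots> \<in> cylinders t" using assms by (intro cylindersI) auto
  finally show "N s -` A \<inter> space (history t) \<in> sets (history t)" by (simp add: sets_history)
qed simp

lemma measurable_history_imp:
  assumes "f \<in> borel_measurable (history t)" shows "f \<in> borel_measurable M"
  using assms cylinders_events[of t]
  by (intro measurable_from_subalg[of M "history t"])
    (auto simp: subalgebra_def sets_history intro!: sets.sigma_sets_subset)

text \<open>The values of \<open>N\<close> at the times in \<open>J\<close> are partial sums of
  increments over a common grid that ends with the step from \<open>t\<close> to \<open>t'\<close>.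
  The cylinder is therefore a function of the earlier increments, and grouping independent variables
  gives the product.\<close>

lemma cylinder_increment_indep:
  assumes t: "0 \<le> t" "t \<le> t'" and a: "a \<in> cylinders t"
  shows "prob (a \<inter> {\<omega> \<in> space M. N t' \<omega> - N t \<omega> \<in> C}) = prob a * prob {\<omega> \<in> space M. N t' \<omega> - N t \<omega> \<in> C}"
proof -
  obtain J B where a: "a = {\<omega> \<in> space M. \<forall>s\<in>J. N s \<omega> \<in> B s}" "finite J" "J \<subseteq> {0..t}"
    using a unfolding cylinders_def by blast
  \<comment> \<open>Time 0 is added so that the grid starts where \<open>N\<close> vanishes and
    values are sums of increments alone.\<close>
  define xs where "xs = sorted_list_of_set (insert 0 J)"
  have xs: "set xs = insert 0 J" "sorted xs"
    unfolding xs_def using a(2) by (simp_all only: set_sorted_list_of_set finite_insert sorted_sorted_list_of_set)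
  define m where "m = length xs"
  \<comment> \<open>Indices below \<open>m\<close> run through the sorted times, index
    \<open>m\<close> is \<open>t\<close>, and all later ones are \<open>t'\<close>; increment number
    \<open>m\<close> is the one under study.\<close>
  define \<tau> where "\<tau> i = (if i < m then xs ! i else if i = m then t else t')" for i
  have m: "0 < m" using xs(1) by (auto simp: m_def)
  have mem: "xs ! i \<in> {0..t}" if "i < m" for i
    using nth_mem[of i xs] that a(3) t unfolding xs(1) m_def by auto
  have \<tau>0: "\<tau> 0 = 0"
  proof -
    obtain j where "j < m" "xs ! j = 0" using xs(1) by (metis in_set_conv_nth insertI1 m_def)
    hence "xs ! 0 \<le> 0" using xs(2) by (metis le0 m_def sorted_nth_mono)
    thus ?thesis using mem[OF m] m by (simp add: \<tau>_def)
  qed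
  have mono_Suc: "\<tau> i \<le> \<tau> (Suc i)" if "i < Suc m" for i
  proof -
    from that have "Suc i < m \<or> Suc i = m \<or> i = m" by linarith
    then consider "Suc i < m" | "Suc i = m" | "i = m" by blast
    thus ?thesis
    proof cases
      case 1 thus ?thesis using xs(2) by (simp add: \<tau>_def sorted_nth_mono m_def)
    next
      case 2 thus ?thesis using mem[of i] by (simp add: \<tau>_def)
    next
      case 3 thus ?thesis using t by (simp add: \<tau>_def)
    qed
  qed
  have \<tau>nn: "0 \<le> \<tau> i" for i using mem[of i] t by (auto simp: \<tau>_def)
  define I where "I i \<omega> = N (\<tau> (Suc i)) \<omega> - N (\<tau> i) \<omega>" for i \<omega>
  have ind: "indep_vars (\<lambda>_. count_space UNIV) I {..<Suc m}"
    unfolding I_def[abs_def] using \<tau>0 mono_Suc by (intro indep_increments) auto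
  have sum: "N (\<tau> j) \<omega> = (\<Sum>i<j. I i \<omega>)" if "j \<le> m" "\<omega> \<in> space M" for j \<omega>
    using that(1)
  proof (induction j)
    case 0 thus ?case using N_zero[OF that(2)] by (simp add: \<tau>0)
  next
    case (Suc j)
    have "N (\<tau> j) \<omega> \<le> N (\<tau> (Suc j)) \<omega>" using Suc.prems by (intro N_mono that(2) \<tau>nn mono_Suc) auto
    thus ?case using Suc by (simp add: I_def)
  qed
  have Im: "I m \<omega> = N t' \<omega> - N t \<omega>" for \<omega> by (simp add: I_def \<tau>_def)
  have "indep_var (PiM {..<m} (\<lambda>_. count_space UNIV)) (\<lambda>\<omega>. restrict (\<lambda>i. I i \<omega>) {..<m})
     (PiM {m} (\<lambda>_. count_space UNIV)) (\<lambda>\<omega>. restrict (\<lambda>i. I i \<omega>) {m})"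
    by (rule indep_var_restrict[OF ind]) auto
  \<comment> \<open>A finite product of countable discrete spaces is discrete, so the sets
    \<open>?A\<close> and \<open>?C\<close> are measurable at once.\<close>
  hence iv: "indep_var (count_space (PiE {..<m} (\<lambda>_. UNIV :: nat set))) (\<lambda>\<omega>. restrict (\<lambda>i. I i \<omega>) {..<m})
     (count_space (PiE {m} (\<lambda>_. UNIV :: nat set))) (\<lambda>\<omega>. restrict (\<lambda>i. I i \<omega>) {m})"
    by (simp add: count_space_PiM_finite)
  let ?A = "{f \<in> PiE {..<m} (\<lambda>_. UNIV :: nat set). \<forall>j<m. xs ! j \<in> J \<longrightarrow> (\<Sum>i<j. f i) \<in> B (xs ! j)}"
  let ?C = "{f \<in> PiE {m} (\<lambda>_. UNIV :: nat set). f m \<in> C}"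
  have A: "a = (\<lambda>\<omega>. restrict (\<lambda>i. I i \<omega>) {..<m}) -` ?A \<inter> space M"
  proof -
    have "(\<forall>s\<in>J. N s \<omega> \<in> B s) \<longleftrightarrow> (\<forall>j<m. xs ! j \<in> J \<longrightarrow> (\<Sum>i<j. restrict (\<lambda>i. I i \<omega>) {..<m} i) \<in> B (xs ! j))"
      if \<omega>: "\<omega> \<in> space M" for \<omega>
    proof -
      have e: "(\<Sum>i<j. restrict (\<lambda>i. I i \<omega>) {..<m} i) = N (xs ! j) \<omega>" if "j < m" for j
        using sum[of j \<omega>] that \<omega> by (simp add: \<tau>_def)
      have "(\<forall>s\<in>J. N s \<omega> \<in> B s) \<longleftrightarrow> (\<forall>j<m. xs ! j \<in> J \<longrightarrow> N (xs ! j) \<omega> \<in> B (xs ! j))"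
      proof safe
        fix s assume "\<forall>j<m. xs ! j \<in> J \<longrightarrow> N (xs ! j) \<omega> \<in> B (xs ! j)" "s \<in> J"
        moreover from \<open>s \<in> J\<close> obtain j where "j < m" "xs ! j = s"
          using xs(1) by (metis in_set_conv_nth insertI2 m_def)
        ultimately show "N s \<omega> \<in> B s" by blast
      qed blast
      thus ?thesis using e by auto
    qed
    thus ?thesis unfolding a(1) by auto
  qed
  have C: "{\<omega> \<in> space M. N t' \<omega> - N t \<omega> \<in> C} = (\<lambda>\<omega>. restrict (\<lambda>i. I i \<omega>) {m}) -` ?C \<inter> space M"
    by (auto simp: Im)
  have vim: "(f -` A \<inter> S) \<inter> (g -` B \<inter> S) = (\<lambda>x. (f x, g x)) -` (A \<times> B) \<inter> S"
    for f :: "'a \<Rightarrow> nat \<Rightarrow> nat" and g :: "'a \<Rightarrow> nat \<Rightarrow> nat" and A B S by auto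
  let ?X = "\<lambda>\<omega>. restrict (\<lambda>i. I i \<omega>) {..<m}" and ?Y = "\<lambda>\<omega>. restrict (\<lambda>i. I i \<omega>) {m}"
  have "(?X -` ?A \<inter> space M) \<inter> (?Y -` ?C \<inter> space M) = (\<lambda>\<omega>. (?X \<omega>, ?Y \<omega>)) -` (?A \<times> ?C) \<inter> space M"
    by (rule vim)
  moreover have "prob ((\<lambda>\<omega>. (?X \<omega>, ?Y \<omega>)) -` (?A \<times> ?C) \<inter> space M) = prob (?X -` ?A \<inter> space M) * prob (?Y -` ?C \<inter> space M)"
    by (rule indep_varD[OF iv]) auto
  ultimately show ?thesis unfolding A C by (simp only:)
qed

text \<open>The pi-system result passes to the generated sigma-algebras. The form with real random
  variables is the one that factorises an expectation of a product.\<close>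

lemma history_increment_indep:
  fixes Y :: "'a \<Rightarrow> real"
  assumes t: "0 \<le> t" "t \<le> t'" and Y: "Y \<in> borel_measurable (history t)"
  shows "indep_var borel Y borel (\<lambda>\<omega>. g (N t' \<omega> - N t \<omega>) :: real)"
proof -
  let ?E = "{{\<omega> \<in> space M. N t' \<omega> - N t \<omega> \<in> C} | C. True}"
  have [measurable]: "N t \<in> M \<rightarrow>\<^sub>M count_space UNIV" "N t' \<in> M \<rightarrow>\<^sub>M count_space UNIV"
    using t by (auto intro: random_variable_N)
  have ev: "{\<omega> \<in> space M. N t' \<omega> - N t \<omega> \<in> C} \<in> events" for C by measurable
  have "indep_set (cylinders t) ?E"
    using cylinders_events ev cylinder_increment_indep[OF t] by (intro indep_setI) auto
  moreover have "Int_stable ?E"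
  proof (rule Int_stableI)
    fix a b assume "a \<in> ?E" "b \<in> ?E"
    then obtain C D where "a = {\<omega> \<in> space M. N t' \<omega> - N t \<omega> \<in> C}" "b = {\<omega> \<in> space M. N t' \<omega> - N t \<omega> \<in> D}" by auto
    hence "a \<inter> b = {\<omega> \<in> space M. N t' \<omega> - N t \<omega> \<in> C \<inter> D}" by auto
    thus "a \<inter> b \<in> ?E" by blast
  qed
  ultimately have ind: "indep_set (sigma_sets (space M) (cylinders t)) (sigma_sets (space M) ?E)"
    by (intro indep_set_sigma_sets cylinders_Int_stable)
  show ?thesis unfolding indep_var_eq
  proof (intro conjI)
    show "Y \<in> borel_measurable M" by (rule measurable_history_imp[OF Y])
    show "(\<lambda>\<omega>. g (N t' \<omega> - N t \<omega>)) \<in> borel_measurable M" by measurable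
    have 1: "sigma_sets (space M) {Y -` A \<inter> space M | A. A \<in> sets borel} \<subseteq> sigma_sets (space M) (cylinders t)"
    proof (rule sigma_sets_mono, safe)
      fix A :: "real set" assume "A \<in> sets borel"
      thus "Y -` A \<inter> space M \<in> sigma_sets (space M) (cylinders t)"
        using measurable_sets[OF Y, of A] by (simp add: sets_history)
    qed
    have 2: "sigma_sets (space M) {(\<lambda>\<omega>. g (N t' \<omega> - N t \<omega>)) -` A \<inter> space M | A. A \<in> sets borel} \<subseteq> sigma_sets (space M) ?E"
    proof (rule sigma_sets_mono, safe)
      fix A :: "real set"
      have "(\<lambda>\<omega>. g (N t' \<omega> - N t \<omega>)) -` A \<inter> space M = {\<omega> \<in> space M. N t' \<omega> - N t \<omega> \<in> g -` A}" by auto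
      moreover have "{\<omega> \<in> space M. N t' \<omega> - N t \<omega> \<in> g -` A} \<in> ?E" by blast
      ultimately show "(\<lambda>\<omega>. g (N t' \<omega> - N t \<omega>)) -` A \<inter> space M \<in> sigma_sets (space M) ?E"
        by (simp only: sigma_sets.Basic)
    qed
    show "indep_set (sigma_sets (space M) {Y -` A \<inter> space M | A. A \<in> sets borel})
       (sigma_sets (space M) {(\<lambda>\<omega>. g (N t' \<omega> - N t \<omega>)) -` A \<inter> space M | A. A \<in> sets borel})"
      using ind 1 2 unfolding indep_sets2_eq by blast
  qed
qed

end

text \<open>An index shift turns \<open>k * r ^ k / fact k\<close> into \<open>r\<close> times the
  preceding term, so each moment sums from the previous one. The second factorial moment is the
  useful one: \<open>k * (k - 1)\<close> vanishes for at most one jump and has mean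
  \<open>r\<^sup>2\<close>.\<close>

lemma poisson_pmf_factorial_moments:
  assumes "0 < r"
  shows "integrable (measure_pmf (poisson_pmf r)) real"
    "measure_pmf.expectation (poisson_pmf r) real = r"
    "integrable (measure_pmf (poisson_pmf r)) (\<lambda>k. real k * (real k - 1))"
    "measure_pmf.expectation (poisson_pmf r) (\<lambda>k. real k * (real k - 1)) = r\<^sup>2"
proof -
  have E: "(\<lambda>k. r ^ k / fact k * exp (- r)) sums 1"
    using sums_mult2[OF exp_converges[of r], of "exp (- r)"]
    by (simp add: scaleR_conv_of_real divide_inverse mult.commute flip: exp_add)
  have "(\<lambda>k. r * (r ^ k / fact k * exp (- r))) sums (r * 1)" by (rule sums_mult[OF E])
  also have "(\<lambda>k. r * (r ^ k / fact k * exp (- r))) = (\<lambda>k. real (Suc k) * (r ^ Suc k / fact (Suc k) * exp (- r)))"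
    by (auto simp: fun_eq_iff divide_simps simp del: of_nat_Suc)
  finally have s1: "(\<lambda>k. real k * (r ^ k / fact k * exp (- r))) sums r"
    by (subst (asm) sums_Suc_iff) simp
  have "(\<lambda>k. r * (real k * (r ^ k / fact k * exp (- r)))) sums (r * r)" by (rule sums_mult[OF s1])
  also have "(\<lambda>k. r * (real k * (r ^ k / fact k * exp (- r)))) = (\<lambda>k. (real (Suc k) * (real (Suc k) - 1)) * (r ^ Suc k / fact (Suc k) * exp (- r)))"
    by (auto simp: fun_eq_iff divide_simps)
  finally have s2: "(\<lambda>k. (real k * (real k - 1)) * (r ^ k / fact k * exp (- r))) sums r\<^sup>2"
    by (subst (asm) sums_Suc_iff) (simp add: power2_eq_square)
  have gen: "integrable (measure_pmf (poisson_pmf r)) f \<and> measure_pmf.expectation (poisson_pmf r) f = s"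
    if s: "(\<lambda>k. f k * (r ^ k / fact k * exp (- r))) sums s" and nn: "\<And>k. 0 \<le> f k" for f s
  proof -
    have nn': "0 \<le> f k * (r ^ k / fact k * exp (- r))" for k using nn assms by simp
    have "0 \<le> s" using sums_le[OF nn' sums_zero s] .
    have "(\<integral>\<^sup>+ k. ennreal (f k) \<partial>measure_pmf (poisson_pmf r)) = (\<Sum>k. ennreal (f k * (r ^ k / fact k * exp (- r))))"
      using assms nn by (simp add: nn_integral_measure_pmf nn_integral_count_space_nat mult.commute flip: ennreal_mult')
    also have "\<dots> = ennreal s"
      by (rule suminf_ennreal_eq[OF nn' s])
    finally have *: "(\<integral>\<^sup>+ k. ennreal (f k) \<partial>measure_pmf (poisson_pmf r)) = ennreal s" .
    have "measure_pmf.expectation (poisson_pmf r) f = s"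
      using nn \<open>0 \<le> s\<close> by (subst integral_eq_nn_integral) (simp_all add: *)
    moreover have "integrable (measure_pmf (poisson_pmf r)) f"
      by (rule integrableI_nonneg) (simp_all add: * nn)
    ultimately show ?thesis by blast
  qed
  have nn: "0 \<le> real k * (real k - 1)" for k by (cases k) auto
  show "integrable (measure_pmf (poisson_pmf r)) real" "measure_pmf.expectation (poisson_pmf r) real = r"
    using gen[OF s1] by auto
  show "integrable (measure_pmf (poisson_pmf r)) (\<lambda>k. real k * (real k - 1))"
    "measure_pmf.expectation (poisson_pmf r) (\<lambda>k. real k * (real k - 1)) = r\<^sup>2"
    using gen[OF s2] nn by auto
qed

section \<open>The resolvent equation\<close>

lemma exp_lipschitz_nonpos:
  fixes a b :: real
  assumes "a \<le> 0" "b \<le> 0" shows "\<bar>exp a - exp b\<bar> \<le> \<bar>a - b\<bar>"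
proof -
  have *: "exp b - exp a \<le> b - a" if "a \<le> b" "b \<le> 0" for a b :: real
  proof -
    have "exp b - exp a = exp b * (1 - exp (a - b))" by (simp add: algebra_simps flip: exp_add)
    also have "1 - exp (a - b) \<le> b - a" using exp_ge_add_one_self[of "a - b"] by linarith
    hence "exp b * (1 - exp (a - b)) \<le> 1 * (b - a)" using that by (intro mult_mono) auto
    finally show ?thesis by simp
  qed
  show ?thesis using *[of a b] *[of b a] assms by (cases "a \<le> b") auto
qed

text \<open>The resolvent equation solved for the derivative, using that \<sigma> is its own
  inverse. At 0, where H jumps, only continuity is demanded.\<close>

locale feynman_kac_solution =
  fixes lam q r B :: real and u :: "real \<Rightarrow> real \<Rightarrow> real"
  assumes lam: "0 < lam" and q: "0 < q" and r: "0 \<le> r"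
    and cont: "\<And>\<sigma>. \<sigma> \<in> {-1, 1} \<Longrightarrow> continuous_on UNIV (u \<sigma>)"
    and bound: "\<And>\<sigma> x. \<sigma> \<in> {-1, 1} \<Longrightarrow> \<bar>u \<sigma> x\<bar> \<le> B"
    and deriv: "\<And>\<sigma> x. \<sigma> \<in> {-1, 1} \<Longrightarrow> x \<noteq> 0 \<Longrightarrow>
      (u \<sigma> has_real_derivative \<sigma> * ((q + lam + r * heaviside x) * u \<sigma> x - lam * u (- \<sigma>) x - 1)) (at x)"
begin

text \<open>Bounds the right-hand side of the equation when u is bounded by \<open>B\<close>:
  \<open>q + lam + r\<close> from the same sign, \<open>lam\<close> from the opposite sign, 1 from
  the source. Hence a Lipschitz constant of u.\<close>

definition L :: real where "L = (q + r + 2 * lam) * B + 1"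
text \<open>Growth rate of the integrand in \<open>flow_estimate\<close>: \<open>q + r\<close> for
  the exponential weight against the bound \<open>1 + 2 * lam * B\<close>, plus \<open>lam\<close>
  times the Lipschitz constant \<open>2 * L\<close> of the difference of the two signs.\<close>

definition K :: real where "K = (q + r) * (1 + 2 * lam * B) + 2 * lam * L"

lemma B_nonneg: "0 \<le> B" using order_trans[OF abs_ge_zero bound[of 1 0]] by simp

lemma L_nonneg: "0 \<le> L" unfolding L_def using B_nonneg lam q r by (intro add_nonneg_nonneg mult_nonneg_nonneg) auto

lemma K_nonneg: "0 \<le> K" unfolding K_def using B_nonneg L_nonneg lam q r by (intro add_nonneg_nonneg mult_nonneg_nonneg) auto

lemma u_lipschitz:
  assumes s: "\<sigma> \<in> {-1, 1}" shows "\<bar>u \<sigma> y - u \<sigma> x\<bar> \<le> L * \<bar>y - x\<bar>"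
proof -
  have *: "\<bar>u \<sigma> y - u \<sigma> x\<bar> \<le> L * (y - x)" if xy: "x \<le> y" for x y
  proof -
    let ?d = "\<lambda>x. \<sigma> * ((q + lam + r * heaviside x) * u \<sigma> x - lam * u (- \<sigma>) x - 1)"
    have "(?d has_integral (u \<sigma> y - u \<sigma> x)) {x..y}"
    proof (rule fundamental_theorem_of_calculus_strong[where S = "{0}"])
      show "continuous_on {x..y} (u \<sigma>)" by (rule continuous_on_subset[OF cont[OF s]]) simp
    qed (use xy deriv[OF s] in \<open>auto simp flip: has_real_derivative_iff_has_vector_derivative\<close>)
    moreover have "norm (?d z) \<le> L" for z
    proof -
      have s': "- \<sigma> \<in> {-1, 1}" using s by auto
      have "norm (?d z) = \<bar>(q + lam + r * heaviside z) * u \<sigma> z - lam * u (- \<sigma>) z - 1\<bar>"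
        using s by (auto simp: abs_mult)
      also have "\<dots> \<le> \<bar>(q + lam + r * heaviside z) * u \<sigma> z\<bar> + \<bar>lam * u (- \<sigma>) z\<bar> + 1" by linarith
      also have "\<bar>(q + lam + r * heaviside z) * u \<sigma> z\<bar> \<le> (q + lam + r * 1) * B"
        unfolding abs_mult using lam q r bound[OF s] heaviside_bounds[of z]
        by (intro mult_mono) (auto intro!: mult_left_le)
      also have "\<bar>lam * u (- \<sigma>) z\<bar> \<le> lam * B"
        unfolding abs_mult using lam bound[OF s'] by (intro mult_mono) auto
      finally show ?thesis by (simp add: L_def algebra_simps)
    qed
    ultimately have "norm (u \<sigma> y - u \<sigma> x) \<le> L * measure lborel {x..y}"
      by (intro has_integral_bound_real[OF L_nonneg finite.emptyI]) auto
    thus ?thesis using xy by simp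
  qed
  show ?thesis using *[of x y] *[of y x] by (cases "x \<le> y") (auto simp: abs_minus_commute)
qed

text \<open>Differentiating along the line \<open>x + \<sigma> * t\<close>, the terms with H cancel
  between the weight and the equation. The remaining integrand \<open>?d\<close> vanishes at
  \<open>t = 0\<close> and is bounded by \<open>K * t\<close>, even when the line crosses 0, so
  integration over [0, h] gives second order.\<close>

lemma flow_estimate:
  assumes s: "\<sigma> \<in> {-1, 1}" and h: "0 \<le> h"
  shows "\<bar>exp (- q * h - r * (\<sigma> * (max 0 (x + \<sigma> * h) - max 0 x))) * u \<sigma> (x + \<sigma> * h)
     - u \<sigma> x + h + lam * h * (u (- \<sigma>) x - u \<sigma> x)\<bar> \<le> K * h\<^sup>2"
proof -
  have s': "- \<sigma> \<in> {-1, 1}" and ss: "\<sigma> * \<sigma> = 1" using s by auto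
  define E where "E t = exp (- q * t - r * (\<sigma> * (max 0 (x + \<sigma> * t) - max 0 x)))" for t
  define D where "D t = u (- \<sigma>) (x + \<sigma> * t) - u \<sigma> (x + \<sigma> * t)" for t
  let ?f = "\<lambda>t. E t * u \<sigma> (x + \<sigma> * t) + t + lam * t * D 0"
  let ?d = "\<lambda>t. 1 + lam * D 0 - E t * (1 + lam * D t)"
  have "(?d has_integral (?f h - ?f 0)) {0..h}"
  \<comment> \<open>The exempt point is the time at which the line meets 0.\<close>
  proof (rule fundamental_theorem_of_calculus_strong[where S = "{- \<sigma> * x}"])
    show "continuous_on {0..h} ?f"
      unfolding E_def by (intro continuous_intros continuous_on_compose2[OF cont[OF s]]) auto
    fix t assume t: "t \<in> {0..h} - {- \<sigma> * x}"
    have ne: "x + \<sigma> * t \<noteq> 0" using t s by auto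
    have l: "((\<lambda>t. x + \<sigma> * t) has_real_derivative \<sigma>) (at t)" by (auto intro!: derivative_eq_intros)
    have m: "((\<lambda>t. max 0 (x + \<sigma> * t)) has_real_derivative heaviside (x + \<sigma> * t) * \<sigma>) (at t)"
      using DERIV_chain2[OF max_0_deriv[OF ne] l] .
    have uu: "((\<lambda>t. u \<sigma> (x + \<sigma> * t)) has_real_derivative
       \<sigma> * ((q + lam + r * heaviside (x + \<sigma> * t)) * u \<sigma> (x + \<sigma> * t) - lam * u (- \<sigma>) (x + \<sigma> * t) - 1) * \<sigma>) (at t)"
      using DERIV_chain2[OF deriv[OF s ne] l] .
    have e: "(E has_real_derivative E t * (- q - r * heaviside (x + \<sigma> * t))) (at t)"
      unfolding E_def by (rule derivative_eq_intros m refl | simp)+ (use ss in \<open>simp add: algebra_simps\<close>)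
    have "(?f has_real_derivative (E t * (- q - r * heaviside (x + \<sigma> * t))) * u \<sigma> (x + \<sigma> * t)
       + E t * (\<sigma> * ((q + lam + r * heaviside (x + \<sigma> * t)) * u \<sigma> (x + \<sigma> * t) - lam * u (- \<sigma>) (x + \<sigma> * t) - 1) * \<sigma>) + 1 + lam * D 0) (at t)"
      by (rule derivative_eq_intros e uu refl | simp)+
    also have "(E t * (- q - r * heaviside (x + \<sigma> * t))) * u \<sigma> (x + \<sigma> * t)
       + E t * (\<sigma> * ((q + lam + r * heaviside (x + \<sigma> * t)) * u \<sigma> (x + \<sigma> * t) - lam * u (- \<sigma>) (x + \<sigma> * t) - 1) * \<sigma>) + 1 + lam * D 0
       = ?d t"
      using s by (auto simp: D_def algebra_simps)
    finally show "(?f has_vector_derivative ?d t) (at t)"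
      by (simp add: has_real_derivative_iff_has_vector_derivative)
  qed (use h in auto)
  moreover have "norm (?d t) \<le> K * h" if t: "t \<in> {0..h} - {}" for t
  proof -
    have Lam: "0 \<le> \<sigma> * (max 0 (x + \<sigma> * t) - max 0 x)" "\<sigma> * (max 0 (x + \<sigma> * t) - max 0 x) \<le> t"
      using s t by (auto simp: max_def)
    have "r * (\<sigma> * (max 0 (x + \<sigma> * t) - max 0 x)) \<le> r * t" "0 \<le> r * (\<sigma> * (max 0 (x + \<sigma> * t) - max 0 x))"
      using r Lam by (auto intro!: mult_left_mono mult_nonneg_nonneg simp del: mult_le_cancel_left)
    moreover have "0 \<le> q * t" using q t by simp
    ultimately have "\<bar>exp 0 - E t\<bar> \<le> (q + r) * t"
      unfolding E_def by (intro order_trans[OF exp_lipschitz_nonpos]) (auto simp: algebra_simps)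
    hence E1: "\<bar>1 - E t\<bar> \<le> (q + r) * t" by simp
    have "\<bar>D t\<bar> \<le> 2 * B" unfolding D_def using bound[OF s, of "x + \<sigma> * t"] bound[OF s', of "x + \<sigma> * t"] by linarith
    hence "lam * \<bar>D t\<bar> \<le> lam * (2 * B)" using lam by (intro mult_left_mono) auto
    hence D1: "\<bar>1 + lam * D t\<bar> \<le> 1 + 2 * lam * B" using lam abs_triangle_ineq[of 1 "lam * D t"] abs_mult[of lam "D t"] by (simp only: abs_one abs_of_pos)
    have "\<bar>D 0 - D t\<bar> \<le> 2 * (L * t)"
      unfolding D_def using u_lipschitz[OF s, of "x + \<sigma> * t" x] u_lipschitz[OF s', of "x + \<sigma> * t" x] s t
      by (auto simp: abs_mult)
    hence D2: "lam * \<bar>D 0 - D t\<bar> \<le> lam * (2 * (L * t))" using lam by (intro mult_left_mono) auto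
    have "?d t = (1 - E t) * (1 + lam * D t) + lam * (D 0 - D t)" by (simp add: algebra_simps)
    hence "norm (?d t) \<le> \<bar>1 - E t\<bar> * \<bar>1 + lam * D t\<bar> + lam * \<bar>D 0 - D t\<bar>"
      using lam abs_triangle_ineq[of "(1 - E t) * (1 + lam * D t)" "lam * (D 0 - D t)"] by (simp add: abs_mult)
    also have "\<dots> \<le> (q + r) * t * (1 + 2 * lam * B) + lam * (2 * (L * t))"
      by (intro add_mono mult_mono[OF E1 D1] D2) (use q r t in auto)
    also have "\<dots> = K * t" by (simp add: K_def algebra_simps)
    also have "\<dots> \<le> K * h" using K_nonneg t by (intro mult_left_mono) auto
    finally show ?thesis .
  qed
  moreover have "0 \<le> K * h" using K_nonneg h by simp
  ultimately have "norm (?f h - ?f 0) \<le> (K * h) * measure lborel {0..h}"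
    by (intro has_integral_bound_real[OF _ finite.emptyI])
  moreover have "?f h - ?f 0 = exp (- q * h - r * (\<sigma> * (max 0 (x + \<sigma> * h) - max 0 x))) * u \<sigma> (x + \<sigma> * h)
     - u \<sigma> x + h + lam * h * (u (- \<sigma>) x - u \<sigma> x)"
    by (simp add: E_def D_def)
  ultimately show ?thesis using h by (simp add: power2_eq_square)
qed

text \<open>Collects the errors of \<open>path_estimate\<close>: \<open>K\<close> for no jump,
  \<open>(q + r) * B + L + 1 + 2 * B * lam\<close> for one, and \<open>4 * B\<close> together with
  \<open>1 + 2 * B * lam\<close> for two or more.\<close>

definition C :: real where "C = K + (q + r) * B + L + 1 + 4 * B + 2 * B * lam"

lemma C_nonneg: "0 \<le> C"
  unfolding C_def using B_nonneg K_nonneg L_nonneg lam q r by (intro add_nonneg_nonneg mult_nonneg_nonneg) auto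

definition Y :: "(real \<Rightarrow> nat) \<Rightarrow> real \<Rightarrow> real" where
  "Y n t = exp (- q * t - r * occupation n t) * u ((- 1) ^ n t) (zigzag n t)"

text \<open>The increment of \<open>Y\<close> is compared with that of the compensated jump martingale.\<close>

lemma path_estimate:
  assumes path: "counting_path n" and t: "0 \<le> t" and h: "0 \<le> h"
  defines "k \<equiv> real (n (t + h) - n t)"
  defines "E \<equiv> exp (- q * t - r * occupation n t)"
  defines "D \<equiv> E * (u (- ((- 1) ^ n t)) (zigzag n t) - u ((- 1) ^ n t) (zigzag n t))"
  shows "\<bar>Y n (t + h) - Y n t + h * E - D * (k - lam * h)\<bar> \<le> C * (h\<^sup>2 + h * k + k * (k - 1))"
proof -
  interpret counting_path n by (rule path)
  define \<sigma> :: real where "\<sigma> = (- 1) ^ n t"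
  define x where "x = zigzag n t"
  have s: "\<sigma> \<in> {-1, 1}" unfolding \<sigma>_def by (cases "even (n t)") auto
  have s': "- \<sigma> \<in> {-1, 1}" using s by auto
  have mn: "n t \<le> n (t + h)" using t h by (intro mono) auto
  have occ0: "0 \<le> r * occupation n t" using r occupation_nonneg[OF t] by simp
  have qt: "0 \<le> q * t" using q t by simp
  have E: "0 < E" "E \<le> 1" unfolding E_def using qt occ0 by auto
  have Y: "Y n t = E * u \<sigma> x" by (simp add: Y_def E_def \<sigma>_def x_def)
  have D: "D = E * (u (- \<sigma>) x - u \<sigma> x)" by (simp add: D_def \<sigma>_def x_def)
  have Db: "\<bar>D\<bar> \<le> 2 * B"
  proof -
    have "\<bar>u (- \<sigma>) x - u \<sigma> x\<bar> \<le> 2 * B" using bound[OF s, of x] bound[OF s', of x] by linarith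
    hence "E * \<bar>u (- \<sigma>) x - u \<sigma> x\<bar> \<le> 1 * (2 * B)" using E by (intro mult_mono) auto
    thus ?thesis using E by (simp add: D abs_mult)
  qed
  have Yb: "\<bar>Y n s\<bar> \<le> B" if "0 \<le> s" for s
  proof -
    have "(- 1 :: real) ^ n s \<in> {-1, 1}" by (cases "even (n s)") auto
    moreover have "exp (- q * s - r * occupation n s) \<le> 1"
      using mult_nonneg_nonneg[OF less_imp_le[OF q] that] mult_nonneg_nonneg[OF r occupation_nonneg[OF that]] by simp
    ultimately have "exp (- q * s - r * occupation n s) * \<bar>u ((- 1) ^ n s) (zigzag n s)\<bar> \<le> 1 * B"
      by (intro mult_mono bound) auto
    thus ?thesis by (simp add: Y_def abs_mult)
  qed
  have sq: "0 \<le> h\<^sup>2" by simp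
  \<comment> \<open>Each case is charged to its own term: no jump to \<open>h\<^sup>2\<close>, a
    single jump with its error of order h to \<open>h * k\<close>, and several jumps with a crude
    bound to \<open>k * (k - 1)\<close>. All three terms have mean of order h^2.\<close>
  consider "n (t + h) = n t" | "n (t + h) = Suc (n t)" | "n t + 2 \<le> n (t + h)" using mn by linarith
  thus ?thesis
  proof cases
    case 1
    hence k: "k = 0" by (simp add: k_def)
    have z: "zigzag n (t + h) = x + \<sigma> * h" using zigzag_affine[of t "t + h"] 1 t h by (simp add: x_def \<sigma>_def)
    have o: "occupation n (t + h) = occupation n t + \<sigma> * (max 0 (x + \<sigma> * h) - max 0 x)"
      using occupation_affine[of t "t + h"] 1 t h by (simp add: z) (simp add: x_def \<sigma>_def)
    have "Y n (t + h) = E * (exp (- q * h - r * (\<sigma> * (max 0 (x + \<sigma> * h) - max 0 x))) * u \<sigma> (x + \<sigma> * h))"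
      unfolding Y_def z o E_def mult.assoc[symmetric] exp_add[symmetric] using 1 by (simp add: \<sigma>_def algebra_simps)
    hence "Y n (t + h) - Y n t + h * E - D * (k - lam * h) = E * (exp (- q * h - r * (\<sigma> * (max 0 (x + \<sigma> * h) - max 0 x))) * u \<sigma> (x + \<sigma> * h)
       - u \<sigma> x + h + lam * h * (u (- \<sigma>) x - u \<sigma> x))"
      by (simp add: Y D k algebra_simps)
    also have "\<bar>\<dots>\<bar> \<le> 1 * (K * h\<^sup>2)"
      unfolding abs_mult using E flow_estimate[OF s h, of x] by (intro mult_mono) auto
    also have "\<dots> \<le> C * h\<^sup>2"
      unfolding mult_1 C_def using B_nonneg L_nonneg lam q r by (intro mult_right_mono) auto
    finally show ?thesis by (simp add: k)
  next
    case 2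
    hence k: "k = 1" by (simp add: k_def)
    have S: "(- 1) ^ n (t + h) = - \<sigma>" using 2 by (simp add: \<sigma>_def)
    \<comment> \<open>The jump time inside the interval is unknown, so the end state is compared
      with a flip placed at time \<open>t\<close>: the weight differs by at most
      \<open>(q + r) * h\<close> and the position by at most \<open>h\<close>.\<close>
    define E' where "E' = exp (- q * (t + h) - r * occupation n (t + h))"
    have om: "occupation n t \<le> occupation n (t + h)" "occupation n (t + h) - occupation n t \<le> h"
      using occupation_mono[of t "t + h"] t h by auto
    have "\<bar>E' - E\<bar> \<le> \<bar>(- q * (t + h) - r * occupation n (t + h)) - (- q * t - r * occupation n t)\<bar>"
      unfolding E'_def E_def
    proof (intro exp_lipschitz_nonpos)
      have "0 \<le> q * (t + h)" "0 \<le> r * occupation n (t + h)"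
        using q r t h occupation_nonneg[of "t + h"] by auto
      thus "- q * (t + h) - r * occupation n (t + h) \<le> 0" by simp
    qed (use qt occ0 in simp)
    also have "\<dots> = q * h + r * (occupation n (t + h) - occupation n t)"
    proof -
      have "0 \<le> q * h + r * (occupation n (t + h) - occupation n t)" using q r h om(1) by auto
      moreover have "(- q * (t + h) - r * occupation n (t + h)) - (- q * t - r * occupation n t)
        = - (q * h + r * (occupation n (t + h) - occupation n t))" by (simp add: algebra_simps)
      ultimately show ?thesis by (simp only: abs_minus_cancel abs_of_nonneg)
    qed
    also have "\<dots> \<le> (q + r) * h" using r om(2) mult_left_mono[OF om(2) r] by (simp add: algebra_simps)
    finally have e: "\<bar>E' - E\<bar> \<le> (q + r) * h" .
    have z: "\<bar>u (- \<sigma>) (zigzag n (t + h)) - u (- \<sigma>) x\<bar> \<le> L * h"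
    proof -
      have "\<bar>zigzag n (t + h) - x\<bar> \<le> h" using zigzag_lipschitz[of t "t + h"] t h by (simp add: x_def)
      thus ?thesis using u_lipschitz[OF s', of "zigzag n (t + h)" x] L_nonneg by (meson mult_left_mono order_trans)
    qed
    have "Y n (t + h) = E' * u (- \<sigma>) (zigzag n (t + h))" unfolding Y_def S E'_def ..
    hence "Y n (t + h) - E * u (- \<sigma>) x = (E' - E) * u (- \<sigma>) (zigzag n (t + h)) + E * (u (- \<sigma>) (zigzag n (t + h)) - u (- \<sigma>) x)"
      by (simp add: algebra_simps)
    also have "\<bar>\<dots>\<bar> \<le> \<bar>E' - E\<bar> * \<bar>u (- \<sigma>) (zigzag n (t + h))\<bar> + E * \<bar>u (- \<sigma>) (zigzag n (t + h)) - u (- \<sigma>) x\<bar>"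
      using E by (intro order_trans[OF abs_triangle_ineq]) (simp add: abs_mult)
    also have "\<dots> \<le> (q + r) * h * B + 1 * (L * h)"
      using e z E bound[OF s', of "zigzag n (t + h)"] by (intro add_mono mult_mono) auto
    finally have 1: "\<bar>Y n (t + h) - E * u (- \<sigma>) x\<bar> \<le> ((q + r) * B + L) * h" by (simp add: algebra_simps)
    have 2: "\<bar>h * E\<bar> \<le> h * 1" using E h by (auto simp: abs_mult intro!: mult_left_le)
    have 3: "\<bar>D * (lam * h)\<bar> \<le> 2 * B * (lam * h)"
      unfolding abs_mult[of D] using Db lam h by (intro mult_mono) auto
    have "Y n (t + h) - Y n t + h * E - D * (k - lam * h) = (Y n (t + h) - E * u (- \<sigma>) x) + h * E + D * (lam * h)"
      by (simp add: Y D k algebra_simps)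
    also have "\<bar>\<dots>\<bar> \<le> ((q + r) * B + L) * h + h * 1 + 2 * B * (lam * h)"
      using 1 2 3 by linarith
    also have "\<dots> = ((q + r) * B + L + 1 + 2 * B * lam) * h" by (simp add: algebra_simps)
    also have "\<dots> \<le> C * h" unfolding C_def using B_nonneg K_nonneg h by (intro mult_right_mono) auto
    also have "\<dots> \<le> C * (h\<^sup>2 + h * k + k * (k - 1))" using C_nonneg sq unfolding k by (intro mult_left_mono) auto
    finally show ?thesis .
  next
    case 3
    hence k: "2 \<le> k" by (simp add: k_def)
    have kk: "k \<le> k * (k - 1)" using k mult_left_mono[of 1 "k - 1" k] by simp
    have hk: "h \<le> h * k" using h k mult_left_mono[of 1 k h] by simp
    have 2: "\<bar>h * E\<bar> \<le> h * 1" using E h by (auto simp: abs_mult intro!: mult_left_le)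
    have "0 \<le> lam * h" using lam h by simp
    hence "\<bar>k - lam * h\<bar> \<le> k + lam * h" using k by auto
    hence 3: "\<bar>D * (k - lam * h)\<bar> \<le> 2 * B * (k + lam * h)"
      unfolding abs_mult[of D] using Db B_nonneg by (intro mult_mono) auto
    have "\<bar>Y n (t + h) - Y n t + h * E - D * (k - lam * h)\<bar> \<le> B + B + h * 1 + 2 * B * (k + lam * h)"
      using Yb[OF t] Yb[of "t + h"] t h 2 3 by linarith
    also have "\<dots> \<le> 2 * B * (k * (k - 1)) + h * k + 2 * B * (k * (k - 1)) + 2 * B * lam * (h * k)"
    proof -
      have k1: "1 \<le> k * (k - 1)" using k kk by linarith
      have "2 * B * 1 \<le> 2 * B * (k * (k - 1))" by (intro mult_left_mono k1) (use B_nonneg in simp)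
      moreover have "2 * B * k \<le> 2 * B * (k * (k - 1))" by (intro mult_left_mono kk) (use B_nonneg in simp)
      moreover have "2 * B * lam * h \<le> 2 * B * lam * (h * k)" by (intro mult_left_mono hk) (use B_nonneg lam in simp)
      ultimately show ?thesis using hk by (simp add: algebra_simps)
    qed
    also have "\<dots> = (1 + 2 * B * lam) * (h * k) + 4 * B * (k * (k - 1))" by (simp add: algebra_simps)
    also have "\<dots> \<le> C * (h * k) + C * (k * (k - 1))"
      unfolding C_def using B_nonneg K_nonneg L_nonneg lam q r h k
      by (intro add_mono mult_right_mono) (auto intro!: add_nonneg_nonneg mult_nonneg_nonneg)
    also have "\<dots> \<le> C * (h\<^sup>2 + h * k + k * (k - 1))" using C_nonneg sq by (simp add: algebra_simps)
    finally show ?thesis .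
  qed
qed

end

section \<open>Laplace transform of the occupation time\<close>

context poisson_process
begin

definition occ_mgf :: "real \<Rightarrow> real \<Rightarrow> real" where
  "occ_mgf r t = expectation (\<lambda>\<omega>. exp (- r * occupation (\<lambda>s. N s \<omega>) t))"

lemma path_functionals_history:
  assumes "0 \<le> t"
  shows "(\<lambda>\<omega>. zigzag (\<lambda>s. N s \<omega>) t) \<in> borel_measurable (history t)"
    "(\<lambda>\<omega>. occupation (\<lambda>s. N s \<omega>) t) \<in> borel_measurable (history t)"
  using path_functionals_measurable[of t N "history t"] assms N_history_measurable N_right_continuous by auto

lemma occupation_measurable:
  assumes "0 \<le> t" shows "(\<lambda>\<omega>. occupation (\<lambda>s. N s \<omega>) t) \<in> borel_measurable M"
  using measurable_history_imp[OF path_functionals_history(2)[OF assms]] .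

lemma occ_mgf_integrable:
  assumes "0 \<le> r" "0 \<le> t" shows "integrable M (\<lambda>\<omega>. exp (- r * occupation (\<lambda>s. N s \<omega>) t))"
proof (rule integrable_const_bound[of _ 1])
  show "AE \<omega> in M. norm (exp (- r * occupation (\<lambda>s. N s \<omega>) t)) \<le> 1"
    using assms counting_path.occupation_nonneg[OF path assms(2)] by (intro AE_I2) simp
qed (use occupation_measurable[OF assms(2)] in measurable)

lemma occ_mgf_bounds:
  assumes "0 \<le> r" "0 \<le> t" shows "0 \<le> occ_mgf r t" "occ_mgf r t \<le> 1"
proof -
  show "0 \<le> occ_mgf r t" unfolding occ_mgf_def by simp
  have "occ_mgf r t \<le> expectation (\<lambda>_. 1)" unfolding occ_mgf_def
    using assms counting_path.occupation_nonneg[OF path assms(2)]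
    by (intro integral_mono occ_mgf_integrable) auto
  thus "occ_mgf r t \<le> 1" by (simp add: prob_space)
qed

text \<open>Occupation changes by at most the elapsed time. The resulting continuity in
  \<open>t\<close> makes the Laplace inversion valid at each \<open>t\<close>.\<close>

lemma occ_mgf_lipschitz:
  assumes r: "0 \<le> r" and s: "0 \<le> s" "s \<le> t" shows "\<bar>occ_mgf r t - occ_mgf r s\<bar> \<le> r * (t - s)"
proof -
  have t: "0 \<le> t" using s by simp
  have "\<bar>occ_mgf r t - occ_mgf r s\<bar> = \<bar>expectation (\<lambda>\<omega>. exp (- r * occupation (\<lambda>s. N s \<omega>) t) - exp (- r * occupation (\<lambda>s. N s \<omega>) s))\<bar>"
    unfolding occ_mgf_def using occ_mgf_integrable[OF r] s t by simp
  also have "\<dots> \<le> expectation (\<lambda>\<omega>. \<bar>exp (- r * occupation (\<lambda>s. N s \<omega>) t) - exp (- r * occupation (\<lambda>s. N s \<omega>) s)\<bar>)"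
    by (rule integral_abs_bound)
  also have "\<dots> \<le> expectation (\<lambda>_. r * (t - s))"
  proof (rule integral_mono)
    show "integrable M (\<lambda>\<omega>. \<bar>exp (- r * occupation (\<lambda>s. N s \<omega>) t) - exp (- r * occupation (\<lambda>s. N s \<omega>) s)\<bar>)"
      using occ_mgf_integrable[OF r] s t by simp
    fix \<omega> assume \<omega>: "\<omega> \<in> space M"
    let ?o = "occupation (\<lambda>s. N s \<omega>)"
    note p = counting_path.occupation_nonneg[OF path[OF \<omega>]] counting_path.occupation_mono[OF path[OF \<omega>] s]
    have "\<bar>exp (- r * ?o t) - exp (- r * ?o s)\<bar> \<le> \<bar>- r * ?o t - - r * ?o s\<bar>"
      using r p(1)[OF t] p(1)[OF s(1)] by (intro exp_lipschitz_nonpos) auto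
    also have "\<dots> = r * (?o t - ?o s)"
      using mult_left_mono[OF p(2) r] by (simp add: algebra_simps)
    also have "\<dots> \<le> r * (t - s)" using p(3) r by (intro mult_left_mono) auto
    finally show "\<bar>exp (- r * ?o t) - exp (- r * ?o s)\<bar> \<le> r * (t - s)" .
  qed simp
  also have "\<dots> = r * (t - s)" by (simp add: prob_space)
  finally show ?thesis .
qed

lemma occ_mgf_continuous:
  assumes r: "0 \<le> r" shows "continuous_on {0..} (occ_mgf r)"
proof (rule continuous_on_iff[THEN iffD2], safe)
  fix x e :: real assume x: "0 \<le> x" and e: "0 < e"
  have *: "\<bar>occ_mgf r y - occ_mgf r x\<bar> \<le> r * \<bar>y - x\<bar>" if "0 \<le> y" for y
    using occ_mgf_lipschitz[OF r, of x y] occ_mgf_lipschitz[OF r, of y x] that x by (cases "x \<le> y") auto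
  have "\<bar>occ_mgf r y - occ_mgf r x\<bar> < e" if "0 \<le> y" "\<bar>y - x\<bar> < e / (r + 1)" for y
  proof -
    have "r * \<bar>y - x\<bar> \<le> (r + 1) * \<bar>y - x\<bar>" using r by (simp add: algebra_simps)
    also have "\<dots> < e" using that(2) r by (simp add: field_simps)
    finally show ?thesis using *[OF that(1)] by simp
  qed
  thus "\<exists>d>0. \<forall>x'\<in>{0..}. dist x' x < d \<longrightarrow> dist (occ_mgf r x') (occ_mgf r x) < e"
    using e r by (intro exI[of _ "e / (r + 1)"]) (auto simp: dist_real_def)
qed

lemma increment_moments:
  assumes t: "0 \<le> t" and h: "0 < h"
  defines "k \<equiv> \<lambda>\<omega>. real (N (t + h) \<omega> - N t \<omega>)"
  shows "integrable M k" "expectation k = lam * h"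
    "integrable M (\<lambda>\<omega>. k \<omega> * (k \<omega> - 1))" "expectation (\<lambda>\<omega>. k \<omega> * (k \<omega> - 1)) = (lam * h)\<^sup>2"
proof -
  have [measurable]: "N t \<in> M \<rightarrow>\<^sub>M count_space UNIV" "N (t + h) \<in> M \<rightarrow>\<^sub>M count_space UNIV"
    using t h by (auto intro: random_variable_N)
  have X: "(\<lambda>\<omega>. N (t + h) \<omega> - N t \<omega>) \<in> M \<rightarrow>\<^sub>M count_space UNIV" by measurable
  have d: "distr M (count_space UNIV) (\<lambda>\<omega>. N (t + h) \<omega> - N t \<omega>) = measure_pmf (poisson_pmf (lam * h))"
    using poisson_increments[of t "t + h"] t h by simp
  have lh: "0 < lam * h" using rate_pos h by simp
  note m = poisson_pmf_factorial_moments[OF lh, folded d]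
  show "integrable M k" "integrable M (\<lambda>\<omega>. k \<omega> * (k \<omega> - 1))"
    using m(1,3) unfolding k_def by (simp_all add: integrable_distr_eq[OF X])
  show "expectation k = lam * h" "expectation (\<lambda>\<omega>. k \<omega> * (k \<omega> - 1)) = (lam * h)\<^sup>2"
    using m(2,4) unfolding k_def by (simp_all add: integral_distr[OF X])
qed

end

section \<open>The expected functional and its time derivative\<close>

locale poisson_feynman_kac = poisson_process M lam N + feynman_kac_solution lam q r B u
  for M :: "'a measure" and lam N q r B u
begin

definition g :: "real \<Rightarrow> real" where "g t = expectation (\<lambda>\<omega>. Y (\<lambda>s. N s \<omega>) t)"

lemma u_sign_measurable:
  assumes "0 \<le> t"
  shows "(\<lambda>\<omega>. u ((- 1) ^ N t \<omega>) (zigzag (\<lambda>s. N s \<omega>) t)) \<in> borel_measurable (history t)"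
    "(\<lambda>\<omega>. u (- ((- 1) ^ N t \<omega>)) (zigzag (\<lambda>s. N s \<omega>) t)) \<in> borel_measurable (history t)"
proof -
  have [measurable]: "N t \<in> history t \<rightarrow>\<^sub>M count_space UNIV" using assms by (intro N_history_measurable) auto
  have [measurable]: "u 1 \<in> borel_measurable borel" "u (- 1) \<in> borel_measurable borel"
    using cont by (auto intro: borel_measurable_continuous_onI)
  note [measurable] = path_functionals_history(1)[OF assms]
  \<comment> \<open>Only the two functions \<open>u 1\<close> and \<open>u (- 1)\<close> are
    controlled, so dependence on the sign is resolved by parity.\<close>
  have e: "u ((- 1) ^ k) x = (if even k then u 1 x else u (- 1) x)"
    "u (- ((- 1) ^ k)) x = (if even k then u (- 1) x else u 1 x)" for k :: nat and x by auto
  show "(\<lambda>\<omega>. u ((- 1) ^ N t \<omega>) (zigzag (\<lambda>s. N s \<omega>) t)) \<in> borel_measurable (history t)"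
    "(\<lambda>\<omega>. u (- ((- 1) ^ N t \<omega>)) (zigzag (\<lambda>s. N s \<omega>) t)) \<in> borel_measurable (history t)"
    unfolding e by measurable
qed

lemma sign_mem: "(- 1 :: real) ^ k \<in> {-1, 1}" "- ((- 1 :: real) ^ k) \<in> {-1, 1}"
  by (cases "even k"; simp)+

lemma weight_bound:
  assumes "0 \<le> t" "\<omega> \<in> space M" "\<bar>v\<bar> \<le> b"
  shows "\<bar>exp (- q * t - r * occupation (\<lambda>s. N s \<omega>) t) * v\<bar> \<le> b"
proof -
  have "0 \<le> q * t" "0 \<le> r * occupation (\<lambda>s. N s \<omega>) t"
    using q r assms counting_path.occupation_nonneg[OF path[OF assms(2)]] by auto
  hence "exp (- q * t - r * occupation (\<lambda>s. N s \<omega>) t) * \<bar>v\<bar> \<le> 1 * b"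
    using assms(3) by (intro mult_mono) auto
  thus ?thesis by (simp add: abs_mult)
qed

lemma Y_integrable:
  assumes t: "0 \<le> t" shows "integrable M (\<lambda>\<omega>. Y (\<lambda>s. N s \<omega>) t)"
proof (rule integrable_const_bound[of _ B])
  show "AE \<omega> in M. norm (Y (\<lambda>s. N s \<omega>) t) \<le> B"
    unfolding Y_def real_norm_def using weight_bound[OF t] bound[OF sign_mem(1)] by (intro AE_I2) blast
  note [measurable] = measurable_history_imp[OF u_sign_measurable(1)[OF t]] occupation_measurable[OF t]
  show "(\<lambda>\<omega>. Y (\<lambda>s. N s \<omega>) t) \<in> borel_measurable M" unfolding Y_def by measurable
qed

text \<open>Expectation of \<open>path_estimate\<close>. \<open>D\<close> is measurable for the
  history up to \<open>t\<close> and \<open>k\<close> is independent of it with mean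
  \<open>lam * h\<close>, so the compensated term drops out. The factor
  \<open>1 + lam + lam\<^sup>2\<close> comes from the means of \<open>h\<^sup>2\<close>,
  \<open>h * k\<close> and \<open>k * (k - 1)\<close>.\<close>

lemma g_estimate:
  assumes t: "0 \<le> t" and h: "0 < h"
  shows "\<bar>g (t + h) - g t + h * (exp (- q * t) * occ_mgf r t)\<bar> \<le> C * (1 + lam + lam\<^sup>2) * h\<^sup>2"
proof -
  have th: "0 \<le> t + h" using t h by simp
  define k where "k \<omega> = real (N (t + h) \<omega> - N t \<omega>)" for \<omega>
  define E where "E \<omega> = exp (- q * t - r * occupation (\<lambda>s. N s \<omega>) t)" for \<omega>
  define D where "D \<omega> = E \<omega> * (u (- ((- 1) ^ N t \<omega>)) (zigzag (\<lambda>s. N s \<omega>) t) - u ((- 1) ^ N t \<omega>) (zigzag (\<lambda>s. N s \<omega>) t))" for \<omega>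
  note k = increment_moments[OF t h, folded k_def]
  note [measurable] = u_sign_measurable[OF t] path_functionals_history(2)[OF t]
  have Dh: "D \<in> borel_measurable (history t)" unfolding D_def[abs_def] E_def by measurable
  have "\<bar>u (- ((- 1) ^ j)) x - u ((- 1) ^ j) x\<bar> \<le> 2 * B" for j :: nat and x
    using bound[OF sign_mem(1)[of j], of x] bound[OF sign_mem(2)[of j], of x] by linarith
  hence "\<bar>D \<omega>\<bar> \<le> 2 * B" if "\<omega> \<in> space M" for \<omega> unfolding D_def E_def using that by (intro weight_bound t)
  hence Dint: "integrable M D" by (intro integrable_const_bound[of _ "2 * B"] measurable_history_imp[OF Dh]) auto
  have Eint: "integrable M E"
  proof -
    have "E = (\<lambda>\<omega>. exp (- q * t) * exp (- r * occupation (\<lambda>s. N s \<omega>) t))"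
      unfolding E_def by (simp flip: exp_add)
    thus ?thesis using occ_mgf_integrable[OF r t] by simp
  qed
  have Eexp: "expectation E = exp (- q * t) * occ_mgf r t"
  proof -
    have "E = (\<lambda>\<omega>. exp (- q * t) * exp (- r * occupation (\<lambda>s. N s \<omega>) t))"
      unfolding E_def by (simp flip: exp_add)
    thus ?thesis unfolding occ_mgf_def by simp
  qed
  have ind: "indep_var borel D borel k"
    unfolding k_def using history_increment_indep[OF t _ Dh, of "t + h" real] h by simp
  have Dk: "integrable M (\<lambda>\<omega>. D \<omega> * k \<omega>)" "expectation (\<lambda>\<omega>. D \<omega> * k \<omega>) = expectation D * (lam * h)"
    using indep_var_integrable[OF ind Dint k(1)] indep_var_lebesgue_integral[OF ind Dint k(1)] k(2) by auto
  have z: "expectation (\<lambda>\<omega>. D \<omega> * (k \<omega> - lam * h)) = 0"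
    using Dk Dint by (simp add: right_diff_distrib)
  have Dki: "integrable M (\<lambda>\<omega>. D \<omega> * (k \<omega> - lam * h))"
    using Dk Dint by (simp add: right_diff_distrib)
  define R where "R \<omega> = Y (\<lambda>s. N s \<omega>) (t + h) - Y (\<lambda>s. N s \<omega>) t + h * E \<omega> - D \<omega> * (k \<omega> - lam * h)" for \<omega>
  have "expectation R = g (t + h) - g t + h * expectation E - expectation (\<lambda>\<omega>. D \<omega> * (k \<omega> - lam * h))"
    unfolding R_def[abs_def] g_def using Y_integrable[OF t] Y_integrable[OF th] Eint Dki by simp
  hence eR: "g (t + h) - g t + h * (exp (- q * t) * occ_mgf r t) = expectation R" by (simp add: z Eexp)
  have Rint: "integrable M R" unfolding R_def[abs_def] using Y_integrable[OF t] Y_integrable[OF th] Eint Dki by simp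
  have "\<bar>expectation R\<bar> \<le> expectation (\<lambda>\<omega>. \<bar>R \<omega>\<bar>)" by (rule integral_abs_bound)
  also have "\<dots> \<le> expectation (\<lambda>\<omega>. C * (h\<^sup>2 + h * k \<omega> + k \<omega> * (k \<omega> - 1)))"
  proof (rule integral_mono)
    fix \<omega> assume "\<omega> \<in> space M"
    from path_estimate[OF path[OF this] t less_imp_le[OF h]]
    show "\<bar>R \<omega>\<bar> \<le> C * (h\<^sup>2 + h * k \<omega> + k \<omega> * (k \<omega> - 1))" by (simp only: R_def D_def E_def k_def)
  qed (use Rint k in auto)
  also have "\<dots> = C * (h\<^sup>2 + h * (lam * h) + (lam * h)\<^sup>2)" using k by (simp add: prob_space)
  also have "\<dots> = C * (1 + lam + lam\<^sup>2) * h\<^sup>2" by (simp add: algebra_simps power2_eq_square)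
  finally show ?thesis unfolding eR .
qed

text \<open>\<open>g_estimate\<close> looks forward only. A backward difference is obtained by
  starting it at the earlier point \<open>y\<close>; this produces \<open>m y\<close> instead of
  \<open>m t\<close>, and the Lipschitz bound on \<open>m\<close> repairs that at the cost
  \<open>q + r\<close> in \<open>C'\<close>.\<close>

lemma g_deriv:
  assumes t: "0 \<le> t"
  shows "(g has_real_derivative - (exp (- q * t) * occ_mgf r t)) (at t within {0..})"
proof -
  define m where "m s = exp (- q * s) * occ_mgf r s" for s
  define C' where "C' = C * (1 + lam + lam\<^sup>2) + (q + r)"
  have mlip: "\<bar>m y - m x\<bar> \<le> (q + r) * (y - x)" if xy: "0 \<le> x" "x \<le> y" for x y
  proof -
    have "m y - m x = (exp (- q * y) - exp (- q * x)) * occ_mgf r y + exp (- q * x) * (occ_mgf r y - occ_mgf r x)"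
      by (simp add: m_def algebra_simps)
    also have "\<bar>\<dots>\<bar> \<le> \<bar>exp (- q * y) - exp (- q * x)\<bar> * occ_mgf r y + exp (- q * x) * \<bar>occ_mgf r y - occ_mgf r x\<bar>"
      using occ_mgf_bounds[OF r, of y] xy by (intro order_trans[OF abs_triangle_ineq]) (simp add: abs_mult)
    also have "\<dots> \<le> q * (y - x) * 1 + 1 * (r * (y - x))"
    proof (intro add_mono mult_mono)
      have "\<bar>exp (- q * y) - exp (- q * x)\<bar> \<le> \<bar>- q * y - - q * x\<bar>"
        using q xy by (intro exp_lipschitz_nonpos) auto
      also have "\<dots> = q * (y - x)" using q xy by (simp flip: right_diff_distrib add: abs_mult)
      finally show "\<bar>exp (- q * y) - exp (- q * x)\<bar> \<le> q * (y - x)" .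
    qed (use q r xy occ_mgf_bounds[OF r, of y] occ_mgf_lipschitz[OF r xy] in auto)
    finally show ?thesis by (simp add: algebra_simps)
  qed
  have est: "\<bar>g y - g t + (y - t) * m t\<bar> \<le> C' * (y - t)\<^sup>2" if y: "0 \<le> y" for y
  proof -
    consider "t < y" | "y = t" | "y < t" by linarith
    thus ?thesis
    proof cases
      case 1
      have "\<bar>g y - g t + (y - t) * m t\<bar> \<le> C * (1 + lam + lam\<^sup>2) * (y - t)\<^sup>2"
        using g_estimate[OF t, of "y - t"] 1 by (simp add: m_def)
      also have "\<dots> \<le> C' * (y - t)\<^sup>2" unfolding C'_def using q r by (intro mult_right_mono) auto
      finally show ?thesis .
    next
      case 3
      have a: "\<bar>g t - g y + (t - y) * m y\<bar> \<le> C * (1 + lam + lam\<^sup>2) * (t - y)\<^sup>2"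
        using g_estimate[OF y, of "t - y"] 3 by (simp add: m_def)
      have b: "\<bar>(t - y) * (m t - m y)\<bar> \<le> (t - y) * ((q + r) * (t - y))"
        unfolding abs_mult using 3 mlip[of y t] y by (intro mult_mono) auto
      have "g y - g t + (y - t) * m t = - (g t - g y + (t - y) * m y) - (t - y) * (m t - m y)"
        by (simp add: algebra_simps)
      hence "\<bar>g y - g t + (y - t) * m t\<bar> \<le> C * (1 + lam + lam\<^sup>2) * (t - y)\<^sup>2 + (t - y) * ((q + r) * (t - y))"
        using a b by linarith
      also have "\<dots> = C' * (t - y)\<^sup>2" unfolding C'_def by (simp only: power2_eq_square algebra_simps)
      also have "(t - y)\<^sup>2 = (y - t)\<^sup>2" by (rule power2_commute)
      finally show ?thesis .
    qed simp
  qed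
  have "((\<lambda>y. (g y - g t) / (y - t) - - m t) \<longlongrightarrow> 0) (at t within {0..})"
  proof (rule Lim_null_comparison)
    show "eventually (\<lambda>y. norm ((g y - g t) / (y - t) - - m t) \<le> C' * \<bar>y - t\<bar>) (at t within {0..})"
      unfolding eventually_at_filter
    proof (intro always_eventually allI impI)
      fix y assume "y \<noteq> t" "y \<in> {0..}"
      hence "(g y - g t) / (y - t) - - m t = (g y - g t + (y - t) * m t) / (y - t)"
        by (simp add: field_simps)
      hence "norm ((g y - g t) / (y - t) - - m t) \<le> (C' * (y - t)\<^sup>2) / \<bar>y - t\<bar>"
        using est[of y] \<open>y \<in> {0..}\<close> by (simp only: real_norm_def abs_divide) (intro divide_right_mono, auto)
      also have "\<dots> = C' * \<bar>y - t\<bar>"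
        using \<open>y \<noteq> t\<close> power2_abs[of "y - t"] by (simp add: power2_eq_square divide_simps del: power2_abs)
      finally show "norm ((g y - g t) / (y - t) - - m t) \<le> C' * \<bar>y - t\<bar>" .
    qed
    have "((\<lambda>y. C' * \<bar>y - t\<bar>) \<longlongrightarrow> C' * \<bar>t - t\<bar>) (at t within {0..})" by (intro tendsto_intros)
    thus "((\<lambda>y. C' * \<bar>y - t\<bar>) \<longlongrightarrow> 0) (at t within {0..})" by simp
  qed
  hence "((\<lambda>y. (g y - g t) / (y - t)) \<longlongrightarrow> - m t) (at t within {0..})" by (rule Lim_null[THEN iffD2])
  thus ?thesis by (simp add: has_field_derivative_iff m_def)
qed

lemma g_0: "g 0 = u 1 0"
proof -
  have "Y (\<lambda>s. N s \<omega>) 0 = u 1 0" if "\<omega> \<in> space M" for \<omega>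
    using counting_path.zigzag_0[OF path[OF that]] counting_path.occupation_0[OF path[OF that]] N_zero[OF that]
    by (simp add: Y_def)
  hence "g 0 = expectation (\<lambda>_. u 1 0)" unfolding g_def by (intro Bochner_Integration.integral_cong) auto
  thus ?thesis by (simp add: prob_space)
qed

lemma g_bound:
  assumes t: "0 \<le> t" shows "\<bar>g t\<bar> \<le> exp (- q * t) * B"
proof -
  have "\<bar>g t\<bar> \<le> expectation (\<lambda>\<omega>. \<bar>Y (\<lambda>s. N s \<omega>) t\<bar>)" unfolding g_def by (rule integral_abs_bound)
  also have "\<dots> \<le> expectation (\<lambda>_. exp (- q * t) * B)"
  proof (rule integral_mono)
    fix \<omega> assume \<omega>: "\<omega> \<in> space M"
    have "0 \<le> r * occupation (\<lambda>s. N s \<omega>) t" using r counting_path.occupation_nonneg[OF path[OF \<omega>] t] by simp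
    hence "exp (- q * t - r * occupation (\<lambda>s. N s \<omega>) t) \<le> exp (- q * t)" by simp
    thus "\<bar>Y (\<lambda>s. N s \<omega>) t\<bar> \<le> exp (- q * t) * B"
      unfolding Y_def abs_mult by (intro mult_mono bound sign_mem) auto
  qed (use Y_integrable[OF t] in auto)
  finally show ?thesis by (simp add: prob_space)
qed

text \<open>The integrand is \<open>- g'\<close>, so the integral is \<open>g 0\<close> minus the
  limit of \<open>g\<close> at infinity. That limit is 0 because u is bounded and the discount
  \<open>exp (- q * t)\<close> decays.\<close>

lemma laplace_occ_mgf:
  "(LINT t:{0<..}|lborel. exp (- q * t) * occ_mgf r t) = u 1 0"
proof -
  let ?m = "\<lambda>t. exp (- q * t) * occ_mgf r t"
  have cm: "continuous_on {0..} ?m" by (intro continuous_intros occ_mgf_continuous r)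
  have int: "set_integrable lborel {0<..} ?m"
  proof (rule set_integrable_bound[OF exp_neg_integrable[OF q]])
    show "set_borel_measurable lborel {0<..} ?m"
      unfolding set_borel_measurable_def
      using borel_measurable_continuous_on_indicator[OF _ continuous_on_subset[OF cm Ioi_le_Ico]] by simp
    show "AE t in lborel. t \<in> {0<..} \<longrightarrow> norm (?m t) \<le> norm (exp (- q * t))"
      using occ_mgf_bounds[OF r] by (intro AE_I2) (auto simp: abs_mult intro!: mult_left_le)
  qed
  have "(LINT t:{0<..real k}|lborel. ?m t) = g 0 - g (real k)" for k :: nat
  proof -
    have "(?m has_integral (- g (real k)) - (- g 0)) {0..real k}"
    proof (rule fundamental_theorem_of_calculus)
      fix t assume t: "t \<in> {0..real k}"
      have "((\<lambda>t. - g t) has_real_derivative - (- ?m t)) (at t within {0..real k})"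
        by (rule DERIV_minus, rule DERIV_subset[OF g_deriv]) (use t in auto)
      thus "((\<lambda>t. - g t) has_vector_derivative ?m t) (at t within {0..real k})"
        by (simp add: has_real_derivative_iff_has_vector_derivative)
    qed simp
    hence "(?m has_integral g 0 - g (real k)) {0..real k}" by simp
    moreover have "(?m has_integral g 0 - g (real k)) {0<..real k} \<longleftrightarrow> (?m has_integral g 0 - g (real k)) {0..real k}"
      by (rule has_integral_spike_set_eq) (rule negligible_subset[of "{0}"], simp, force)+
    ultimately have hi: "(?m has_integral g 0 - g (real k)) {0<..real k}" by simp
    have "set_integrable lborel {0<..real k} ?m" by (rule set_integrable_subset[OF int]) auto
    from set_borel_integral_eq_integral(2)[OF this] integral_unique[OF hi] show ?thesis by simp
  qed
  moreover have "(\<lambda>k. LINT t:{0<..real k}|lborel. ?m t) \<longlonglongrightarrow> (LINT t:(\<Union>k. {0<..real k})|lborel. ?m t)"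
  proof (rule set_integral_cont_up)
    have U: "(\<Union>k. {0<..real k}) = {0<..}"
      by (auto simp: real_arch_simple)
    show "set_integrable lborel (\<Union>k. {0<..real k}) ?m" unfolding U by (rule int)
    show "incseq (\<lambda>k. {0<..real k})" by (auto simp: incseq_def)
  qed auto
  moreover have "(\<Union>k. {0<..real k}) = {0<..}" by (auto simp: real_arch_simple)
  ultimately have 1: "(\<lambda>k. g 0 - g (real k)) \<longlonglongrightarrow> (LINT t:{0<..}|lborel. ?m t)" by simp
  have "(\<lambda>k. exp (- q * real k) * B) \<longlonglongrightarrow> 0"
    using q by real_asymp
  hence "(\<lambda>k. g (real k)) \<longlonglongrightarrow> 0"
    by (rule Lim_null_comparison[rotated], intro always_eventually allI) (simp only: real_norm_def, rule g_bound, simp)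
  hence "(\<lambda>k. g 0 - g (real k)) \<longlonglongrightarrow> g 0 - 0" by (intro tendsto_intros)
  with 1 have "(LINT t:{0<..}|lborel. ?m t) = g 0" by (metis LIMSEQ_unique diff_zero)
  thus ?thesis by (simp add: g_0)
qed

end

text \<open>The bounded solution of the resolvent equation, glued from the exponential solutions on the
  two half-lines by continuity at \<open>0\<close>.\<close>

definition resolvent :: "real \<Rightarrow> real \<Rightarrow> real \<Rightarrow> real \<Rightarrow> real \<Rightarrow> real" where
  "resolvent lam q r \<sigma> x =
    (let s = sqrt (1 + 2 * lam / q); s' = sqrt (1 + 2 * lam / (q + r)); k = (s - s') / (2 * lam) in
     if 0 \<le> x then 1 / (q + r) + k * (s' - \<sigma>) * exp (- ((q + r) * s') * x)
     else 1 / q - k * (s + \<sigma>) * exp (q * s * x))"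

text \<open>On each half-line the equation is a linear system with constant coefficients: the
  particular solution is \<open>1 / q'\<close> or \<open>1 / q\<close>, and the homogeneous rates
  are plus and minus \<open>q' * s'\<close> or \<open>q * s\<close>, with eigenvectors
  \<open>s' - \<sigma>\<close> and \<open>s + \<sigma>\<close> for the rate that stays
  bounded.\<close>

lemma resolvent_solution:
  assumes lam: "0 < lam" and q: "0 < q" and r: "0 \<le> r"
  obtains B where "feynman_kac_solution lam q r B (resolvent lam q r)"
    "resolvent lam q r 1 0 = (sqrt (1 + 2 * lam / (q + r)) - 1) * (sqrt (1 + 2 * lam / q) + 1) / (2 * lam)"
proof -
  define q' where "q' = q + r"
  define s where "s = sqrt (1 + 2 * lam / q)"
  define s' where "s' = sqrt (1 + 2 * lam / q')"
  define k where "k = (s - s') / (2 * lam)"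
  let ?u = "resolvent lam q r"
  have q': "0 < q'" using q r by (simp add: q'_def)
  have u: "?u \<sigma> x = (if 0 \<le> x then 1 / q' + k * (s' - \<sigma>) * exp (- (q' * s') * x)
     else 1 / q - k * (s + \<sigma>) * exp (q * s * x))" for \<sigma> x
    unfolding resolvent_def Let_def q'_def[symmetric] s_def[symmetric] s'_def[symmetric] k_def[symmetric] ..
  have ss: "s\<^sup>2 = 1 + 2 * lam / q" "s'\<^sup>2 = 1 + 2 * lam / q'" using lam q q' by (auto simp: s_def s'_def)
  have s1: "1 \<le> s" "1 \<le> s'" using lam q q' by (auto simp: s_def s'_def)
  \<comment> \<open>The characteristic equation, divided by the killing rate; it is what fixes s and
    s'.\<close>
  have qs: "q * s\<^sup>2 = q + 2 * lam" "q' * s'\<^sup>2 = q' + 2 * lam" using q q' by (auto simp: ss field_simps)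
  \<comment> \<open>Continuity at 0 for both signs gives two conditions: their difference forces
    equal coefficients on the two sides, and their sum forces
    \<open>k * (s + s') = 1 / q - 1 / q'\<close>.\<close>
  have glue: "1 / q' + k * (s' - \<sigma>) = 1 / q - k * (s + \<sigma>)" for \<sigma>
  proof -
    have "k * (s + s') = (s\<^sup>2 - s'\<^sup>2) / (2 * lam)" by (simp add: k_def power2_eq_square algebra_simps)
    also have "\<dots> = 1 / q - 1 / q'" unfolding ss using lam by (simp add: diff_divide_distrib)
    finally show ?thesis by (simp add: algebra_simps)
  qed
  define B where "B = 1 / q' + 1 / q + \<bar>k\<bar> * (s' + 1) + \<bar>k\<bar> * (s + 1)"
  have "feynman_kac_solution lam q r B ?u"
  proof
    fix \<sigma> x :: real assume \<sigma>: "\<sigma> \<in> {-1, 1}"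
    \<comment> \<open>One formula for both half-lines: each branch is frozen at its value at 0 on
      the other side, and the common value is subtracted once.\<close>
    have "continuous_on UNIV (\<lambda>x. (1 / q' + k * (s' - \<sigma>) * exp (- (q' * s') * max 0 x))
       + (1 / q - k * (s + \<sigma>) * exp (q * s * min 0 x)) - (1 / q - k * (s + \<sigma>)))"
      by (intro continuous_intros)
    also have "(\<lambda>x. (1 / q' + k * (s' - \<sigma>) * exp (- (q' * s') * max 0 x))
       + (1 / q - k * (s + \<sigma>) * exp (q * s * min 0 x)) - (1 / q - k * (s + \<sigma>))) = ?u \<sigma>"
      using glue[of \<sigma>] by (auto simp: u fun_eq_iff)
    finally show "continuous_on UNIV (?u \<sigma>)" .
    have e1: "\<bar>k * (s' - \<sigma>) * exp (- (q' * s') * x)\<bar> \<le> \<bar>k\<bar> * (s' + 1)" if "0 \<le> x"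
    proof -
      have "\<bar>k\<bar> * \<bar>s' - \<sigma>\<bar> * exp (- (q' * s') * x) \<le> \<bar>k\<bar> * (s' + 1) * 1"
        using \<sigma> s1 q' that by (intro mult_mono) auto
      thus ?thesis by (simp add: abs_mult)
    qed
    have e2: "\<bar>k * (s + \<sigma>) * exp (q * s * x)\<bar> \<le> \<bar>k\<bar> * (s + 1)" if "x < 0"
    proof -
      have "q * s * x \<le> 0" using q s1 that by (intro mult_nonneg_nonpos) auto
      hence "\<bar>k\<bar> * \<bar>s + \<sigma>\<bar> * exp (q * s * x) \<le> \<bar>k\<bar> * (s + 1) * 1"
        using \<sigma> s1 by (intro mult_mono) auto
      thus ?thesis by (simp add: abs_mult)
    qed
    have pos: "0 < 1 / q" "0 < 1 / q'" "0 \<le> \<bar>k\<bar> * (s' + 1)" "0 \<le> \<bar>k\<bar> * (s + 1)" using q q' s1 by auto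
    show "\<bar>?u \<sigma> x\<bar> \<le> B"
    proof (cases "0 \<le> x")
      case True
      thus ?thesis unfolding u B_def using e1[OF True] pos by (simp only: if_True)
    next
      case False
      hence "x < 0" by simp
      thus ?thesis unfolding u B_def using e2[OF \<open>x < 0\<close>] pos False by (simp only: if_False)
    qed
    assume x: "x \<noteq> 0"
    have sq: "\<sigma> * \<sigma> = 1" using \<sigma> by auto
    show "(?u \<sigma> has_real_derivative \<sigma> * ((q + lam + r * heaviside x) * ?u \<sigma> x - lam * ?u (- \<sigma>) x - 1)) (at x)"
    proof (cases "0 < x")
      case True
      define e where "e = exp (- (q' * s') * x)"
      have "((\<lambda>x. 1 / q' + k * (s' - \<sigma>) * exp (- (q' * s') * x)) has_real_derivative - (k * (s' - \<sigma>) * (q' * s') * e)) (at x)"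
        unfolding e_def by (auto intro!: derivative_eq_intros)
      moreover have "eventually (\<lambda>y. 1 / q' + k * (s' - \<sigma>) * exp (- (q' * s') * y) = ?u \<sigma> y) (nhds x)"
        using eventually_nhds_in_open[of "{0<..}" x] True by (auto elim!: eventually_mono simp: u)
      ultimately have d: "(?u \<sigma> has_real_derivative - (k * (s' - \<sigma>) * (q' * s') * e)) (at x)"
        by (simp add: DERIV_cong_ev)
      have "- (k * (s' - \<sigma>) * (q' * s') * e) = k * e * (\<sigma> * q' * s' - q' * s'\<^sup>2)"
        by (simp add: algebra_simps power2_eq_square)
      also have "\<dots> = k * e * (\<sigma> * q' * s' - \<sigma> * \<sigma> * (q' + 2 * lam))" by (simp only: qs sq mult_1)
      also have "\<dots> = \<sigma> * ((q' + lam) * (1 / q' + k * (s' - \<sigma>) * e) - lam * (1 / q' + k * (s' - - \<sigma>) * e) - 1)"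
        using q' by (simp add: algebra_simps add_divide_distrib)
      also have "\<dots> = \<sigma> * ((q + lam + r * heaviside x) * ?u \<sigma> x - lam * ?u (- \<sigma>) x - 1)"
        using True by (simp add: u e_def heaviside_def q'_def algebra_simps)
      finally show ?thesis using d by simp
    next
      case False
      hence x: "x < 0" using x by simp
      define e where "e = exp (q * s * x)"
      have "((\<lambda>x. 1 / q - k * (s + \<sigma>) * exp (q * s * x)) has_real_derivative - (k * (s + \<sigma>) * (q * s) * e)) (at x)"
        unfolding e_def by (auto intro!: derivative_eq_intros)
      moreover have "eventually (\<lambda>y. 1 / q - k * (s + \<sigma>) * exp (q * s * y) = ?u \<sigma> y) (nhds x)"
        using eventually_nhds_in_open[of "{..<0}" x] x by (auto elim!: eventually_mono simp: u)
      ultimately have d: "(?u \<sigma> has_real_derivative - (k * (s + \<sigma>) * (q * s) * e)) (at x)"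
        by (simp add: DERIV_cong_ev)
      have "- (k * (s + \<sigma>) * (q * s) * e) = k * e * (- (\<sigma> * q * s) - q * s\<^sup>2)"
        by (simp add: algebra_simps power2_eq_square)
      also have "\<dots> = k * e * (- (\<sigma> * q * s) - \<sigma> * \<sigma> * (q + 2 * lam))" by (simp only: qs sq mult_1)
      also have "\<dots> = \<sigma> * ((q + lam) * (1 / q - k * (s + \<sigma>) * e) - lam * (1 / q - k * (s + - \<sigma>) * e) - 1)"
        using q by (simp add: algebra_simps add_divide_distrib)
      also have "\<dots> = \<sigma> * ((q + lam + r * heaviside x) * ?u \<sigma> x - lam * ?u (- \<sigma>) x - 1)"
        using x by (simp add: u e_def heaviside_def)
      finally show ?thesis using d by simp
    qed
  qed (use lam q r in auto)
  moreover have "?u 1 0 = (s' - 1) * (s + 1) / (2 * lam)"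
  proof -
    \<comment> \<open>With this, \<open>s' - 1\<close> factors out of
      \<open>1 / q' + k * (s' - 1)\<close> and leaves
      \<open>(s' + 1) + (s - s') = s + 1\<close>.\<close>
    have "1 / q' = (s'\<^sup>2 - 1) / (2 * lam)" unfolding ss using lam by simp
    thus ?thesis using lam by (simp add: u k_def power2_eq_square field_simps)
  qed
  ultimately show ?thesis using that unfolding s_def s'_def q'_def by blast
qed

section \<open>Inversion of the Laplace transform in time\<close>

context poisson_process
begin

lemma laplace_occ_mgf_eq:
  assumes q: "0 < q" and r: "0 \<le> r"
  shows "(LINT t:{0<..}|lborel. exp (- q * t) * occ_mgf r t) =
    (sqrt (1 + 2 * lam / (q + r)) - 1) * (sqrt (1 + 2 * lam / q) + 1) / (2 * lam)"
proof -
  obtain B where B: "feynman_kac_solution lam q r B (resolvent lam q r)"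
    and val: "resolvent lam q r 1 0 = (sqrt (1 + 2 * lam / (q + r)) - 1) * (sqrt (1 + 2 * lam / q) + 1) / (2 * lam)"
    using resolvent_solution[OF rate_pos q r] .
  interpret feynman_kac_solution lam q r B "resolvent lam q r" by (rule B)
  interpret poisson_feynman_kac M lam N q r B "resolvent lam q r" by unfold_locales
  show ?thesis using laplace_occ_mgf val by simp
qed

text \<open>With \<open>r\<close> fixed, both sides are continuous in time and have equal transforms
  at every natural number from 2 on.\<close>

lemma occ_mgf_eq_occ_law_laplace:
  assumes r: "0 \<le> r" and T: "0 < T"
  shows "occ_mgf r T = occ_law_laplace lam r T"
proof -
  let ?f = "\<lambda>t. occ_mgf r t - occ_law_laplace lam r t"
  obtain C where C: "\<And>t. 0 < t \<Longrightarrow> \<bar>occ_law_laplace lam r t\<bar> \<le> C * exp t"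
    and nn: "\<And>t. 0 < t \<Longrightarrow> 0 \<le> occ_law_laplace lam r t"
    by (rule occ_law_laplace_growth[OF rate_pos r]) (rule that)
  have c1: "continuous_on {0<..} (occ_mgf r)" by (rule continuous_on_subset[OF occ_mgf_continuous[OF r]]) auto
  note c2 = occ_law_laplace_continuous[OF rate_pos r]
  have "?f T = 0"
  proof (rule laplace_transform_eq_0[OF _ _ _ T])
    show "continuous_on {0<..} ?f" by (intro continuous_intros c1 c2)
    show "\<bar>?f t\<bar> \<le> (1 + C) * exp t" if "0 < t" for t
    proof -
      have "\<bar>occ_mgf r t\<bar> \<le> 1 * exp t" using occ_mgf_bounds[OF r, of t] that by (auto intro: order_trans[of _ 1])
      moreover have "\<bar>?f t\<bar> \<le> \<bar>occ_mgf r t\<bar> + \<bar>occ_law_laplace lam r t\<bar>" by linarith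
      ultimately show ?thesis using C[OF that] unfolding distrib_right by linarith
    qed
    fix n :: nat assume n: "2 \<le> n"
    hence q: "0 < real n" by simp
    let ?v = "(sqrt (1 + 2 * lam / (real n + r)) - 1) * (sqrt (1 + 2 * lam / real n) + 1) / (2 * lam)"
    have v: "0 \<le> ?v" using q r rate_pos by (intro divide_nonneg_nonneg mult_nonneg_nonneg) auto
    have i1: "set_integrable lborel {0<..} (\<lambda>t. exp (- real n * t) * occ_mgf r t)"
    proof (rule set_integrable_bound[OF exp_neg_integrable[OF q]])
      show "set_borel_measurable lborel {0<..} (\<lambda>t. exp (- real n * t) * occ_mgf r t)"
        unfolding set_borel_measurable_def
      proof -
        have "(\<lambda>t. indicator {0<..} t *\<^sub>R (exp (- real n * t) * occ_mgf r t)) \<in> borel_measurable borel"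
          by (intro borel_measurable_continuous_on_indicator continuous_intros c1) simp
        thus "(\<lambda>t. indicator {0<..} t *\<^sub>R (exp (- real n * t) * occ_mgf r t)) \<in> borel_measurable lborel" by simp
      qed
      show "AE t in lborel. t \<in> {0<..} \<longrightarrow> norm (exp (- real n * t) * occ_mgf r t) \<le> norm (exp (- real n * t))"
        using occ_mgf_bounds[OF r] by (intro AE_I2) (auto simp: abs_mult intro!: mult_left_le)
    qed
    let ?h = "\<lambda>t. indicator {0<..} t * (exp (- real n * t) * occ_law_laplace lam r t)"
    have hm: "?h \<in> borel_measurable borel"
      unfolding real_scaleR_def[symmetric]
      by (intro borel_measurable_continuous_on_indicator continuous_intros c2) simp
    have h0: "0 \<le> ?h t" for t using nn by (simp add: indicator_def)
    have "ennreal (?h t) = ennreal (indicator {0<..} t * occ_law_laplace lam r t) * ennreal (exp (- real n * t))" for t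
      using nn by (simp add: indicator_def mult.commute flip: ennreal_mult)
    hence hn: "(\<integral>\<^sup>+ t. ennreal (?h t) \<partial>lborel) = ennreal ?v"
      using nn_laplace_occ_law[OF rate_pos q r] by simp
    have i2: "integrable lborel ?h"
      using hm h0 hn by (intro integrableI_nonneg) auto
    have e2: "(LINT t|lborel. ?h t) = ?v"
    proof -
      have "(LINT t|lborel. ?h t) = enn2real (\<integral>\<^sup>+ t. ennreal (?h t) \<partial>lborel)"
        by (rule integral_eq_nn_integral) (use hm h0 in auto)
      thus ?thesis unfolding hn using v by (simp only: enn2real_ennreal)
    qed
    show "(LINT t:{0<..}|lborel. exp (- real n * t) * ?f t) = 0"
      using laplace_occ_mgf_eq[OF q r] e2 i1 i2
      unfolding set_lebesgue_integral_def set_integrable_def by (simp add: right_diff_distrib)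
  qed
  thus ?thesis by simp
qed

end

section \<open>The law of the occupation fraction\<close>

lemma psi_eq_phi:
  assumes "0 < lam" "0 < T" "0 \<le> z" "z \<le> 1"
  shows "psi lam T z = 2 * lam * T * (phi lam 1 (T * z) * phi lam 1 (T - T * z))"
  using assms phi_scale[of lam T z] phi_scale[of lam T "1 - z"] by (simp add: psi_def right_diff_distrib)

lemma psi_nonneg:
  assumes "0 < lam" "0 < T" "0 \<le> z" "z \<le> 1" shows "0 \<le> psi lam T z"
  using assms by (simp add: psi_def phi_nonneg)

text \<open>The substitution \<open>y = T * z\<close>; the factor \<open>T\<close> in
  \<open>psi\<close> is its Jacobian.\<close>

lemma psi_integral:
  assumes lam: "0 < lam" and T: "0 < T" and r: "0 \<le> r"
  shows "set_integrable lborel {0<..<1} (\<lambda>z. exp (- r * z) * psi lam T z)"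
    "(LINT z:{0<..<1}|lborel. exp (- r * z) * psi lam T z) =
      2 * lam * (LINT y:{0<..<T}|lborel. exp (- (r / T) * y) * phi lam 1 y * phi lam 1 (T - y))"
proof -
  define F where "F y = indicator {0<..<T} y * (exp (- (r / T) * y) * phi lam 1 y * phi lam 1 (T - y))" for y
  have F: "integrable lborel F" unfolding F_def using lam T r by (intro phi_conv_integrable) auto
  have e: "indicator {0<..<1} z * (exp (- r * z) * psi lam T z) = 2 * lam * T * F (0 + T * z)" for z
  proof (cases "0 < z \<and> z < 1")
    case True
    moreover have "0 < T * z" "T * z < T" using True T by auto
    ultimately show ?thesis using lam T by (simp add: F_def psi_eq_phi)
  next
    case False
    hence "\<not> (0 < T * z \<and> T * z < T)" using T by (auto simp: zero_less_mult_iff)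
    thus ?thesis using False by (auto simp: F_def indicator_def)
  qed
  show "set_integrable lborel {0<..<1} (\<lambda>z. exp (- r * z) * psi lam T z)"
    unfolding set_integrable_def real_scaleR_def e
    using lborel_integrable_real_affine[OF F, of T 0] T by simp
  have "(LINT y|lborel. F y) = \<bar>T\<bar> *\<^sub>R (LINT z|lborel. F (0 + T * z))"
    by (rule lborel_integral_real_affine) (use T in simp)
  thus "(LINT z:{0<..<1}|lborel. exp (- r * z) * psi lam T z) =
      2 * lam * (LINT y:{0<..<T}|lborel. exp (- (r / T) * y) * phi lam 1 y * phi lam 1 (T - y))"
    unfolding set_lebesgue_integral_def real_scaleR_def e using T by (simp add: F_def)
qed

lemma psi_measurable:
  assumes "0 < lam" "0 < T" shows "(\<lambda>z. indicator {0<..<1} z * psi lam T z) \<in> borel_measurable borel"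
  using borel_measurable_integrable[OF psi_integral(1)[OF assms, of 0, unfolded set_integrable_def]] by simp

text \<open>The endpoints are null. The open interval keeps both arguments of phi positive, where
  measurability comes from continuity.\<close>

lemma nn_integral_psi_Icc:
  assumes "0 < lam" "0 < T" "A \<in> sets borel"
  shows "(\<integral>\<^sup>+ y \<in> A \<inter> {0..1}. ennreal (psi lam T y) \<partial>lborel)
    = (\<integral>\<^sup>+ y. ennreal (indicator {0<..<1} y * psi lam T y) * indicator A y \<partial>lborel)"
proof (rule nn_integral_cong_AE)
  show "AE y in lborel. ennreal (psi lam T y) * indicator (A \<inter> {0..1}) y
     = ennreal (indicator {0<..<1} y * psi lam T y) * indicator A y"
    using AE_lborel_singleton[of 0] AE_lborel_singleton[of 1]
    by eventually_elim (auto simp: indicator_def)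
qed

text \<open>The claimed law, realised as an image measure: the mass of \<open>{1}\<close> is first spread over
  \<open>[1, 2)\<close>, so that no sum of measures is needed.\<close>

definition occ_frac_law :: "real \<Rightarrow> real \<Rightarrow> real measure" where
  "occ_frac_law lam T = distr (density lborel (\<lambda>z. ennreal (indicator {0<..<1} z * psi lam T z
     + indicator {1..<2} z * (2 * phi lam T 1)))) borel (\<lambda>z. min 1 z)"

lemma emeasure_occ_frac_law:
  assumes lam: "0 < lam" and T: "0 < T" and A: "A \<in> sets borel"
  shows "emeasure (occ_frac_law lam T) A = ennreal (2 * phi lam T 1) * emeasure (return borel (1::real)) A
    + (\<integral>\<^sup>+ y \<in> A \<inter> {0..1}. ennreal (psi lam T y) \<partial>lborel)"
proof -
  note [measurable] = psi_measurable[OF lam T] A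
  have p: "0 \<le> 2 * phi lam T 1" using phi_nonneg[OF lam T, of 1] by simp
  have [measurable]: "(\<lambda>z. min 1 z) -` A \<in> sets borel"
    using measurable_sets[of "\<lambda>z::real. min 1 z" borel borel A] A by simp
  let ?w = "\<lambda>z. ennreal (indicator {0<..<1} z * psi lam T z + indicator {1..<2} z * (2 * phi lam T 1))"
  have "emeasure (occ_frac_law lam T) A = (\<integral>\<^sup>+ z. ?w z * indicator ((\<lambda>z. min 1 z) -` A) z \<partial>lborel)"
    unfolding occ_frac_law_def by (subst emeasure_distr, measurable, subst emeasure_density) auto
  also have "\<dots> = (\<integral>\<^sup>+ z. ennreal (indicator {0<..<1} z * psi lam T z) * indicator A z
     + ennreal (2 * phi lam T 1) * indicator A 1 * indicator {1..<2} z \<partial>lborel)"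
    by (intro nn_integral_cong) (auto simp: indicator_def)
  also have "\<dots> = (\<integral>\<^sup>+ z. ennreal (indicator {0<..<1} z * psi lam T z) * indicator A z \<partial>lborel)
     + (\<integral>\<^sup>+ z. ennreal (2 * phi lam T 1) * indicator A 1 * indicator {1..<2::real} z \<partial>lborel)"
    by (rule nn_integral_add) measurable
  also have "(\<integral>\<^sup>+ z. ennreal (2 * phi lam T 1) * indicator A 1 * indicator {1..<2::real} z \<partial>lborel) = ennreal (2 * phi lam T 1) * indicator A 1"
    by (subst nn_integral_cmult) auto
  finally show ?thesis by (simp add: nn_integral_psi_Icc[OF lam T A] emeasure_return[OF A] add.commute)
qed

text \<open>Transforming the fraction at \<open>r\<close> is transforming the occupation time at
  \<open>r / T\<close>.\<close>

lemma integral_occ_frac_law: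
  assumes lam: "0 < lam" and T: "0 < T" and r: "0 \<le> r"
  shows "(LINT y|occ_frac_law lam T. exp (- r * y)) = occ_law_laplace lam (r / T) T"
proof -
  note [measurable] = psi_measurable[OF lam T]
  have p: "0 \<le> 2 * phi lam T 1" using phi_nonneg[OF lam T, of 1] by simp
  have w0: "0 \<le> indicator {0<..<1} z * psi lam T z + indicator {1..<2} z * (2 * phi lam T 1)" for z :: real
    using p psi_nonneg[OF lam T, of z] by (simp add: indicator_def)
  have "(LINT y|occ_frac_law lam T. exp (- r * y)) = (LINT z|lborel. (indicator {0<..<1} z * psi lam T z
     + indicator {1..<2} z * (2 * phi lam T 1)) *\<^sub>R exp (- r * min 1 z))"
    unfolding occ_frac_law_def
    by (subst integral_distr, measurable, subst integral_density) (auto simp: w0)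
  also have "\<dots> = (LINT z|lborel. indicator {0<..<1} z *\<^sub>R (exp (- r * z) * psi lam T z) + indicator {1..<2} z * (2 * phi lam T 1 * exp (- r)))"
    by (intro Bochner_Integration.integral_cong) (auto simp: indicator_def)
  also have "\<dots> = (LINT z|lborel. indicator {0<..<1} z *\<^sub>R (exp (- r * z) * psi lam T z)) + (LINT z|lborel. indicator {1..<2::real} z * (2 * phi lam T 1 * exp (- r)))"
    using psi_integral(1)[OF assms] unfolding set_integrable_def
    by (intro Bochner_Integration.integral_add integrable_mult_left integrable_real_indicator) auto
  also have "(LINT z|lborel. indicator {1..<2::real} z * (2 * phi lam T 1 * exp (- r))) = 2 * phi lam T 1 * exp (- r)"
    by simp
  also have "(LINT z|lborel. indicator {0<..<1} z *\<^sub>R (exp (- r * z) * psi lam T z)) =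
    2 * lam * (LINT y:{0<..<T}|lborel. exp (- (r / T) * y) * phi lam 1 y * phi lam 1 (T - y))"
    using psi_integral(2)[OF assms] by (simp add: set_lebesgue_integral_def)
  finally show ?thesis using T phi_scale[OF lam T, of 1] by (simp add: occ_law_laplace_def)
qed

context poisson_process
begin

definition occ_frac :: "real \<Rightarrow> 'a \<Rightarrow> real" where
  "occ_frac T \<omega> = occupation (\<lambda>s. N s \<omega>) T / T"

lemma occ_frac_measurable:
  assumes "0 < T" shows "occ_frac T \<in> borel_measurable M"
  using occupation_measurable[of T] assms unfolding occ_frac_def[abs_def] by simp

lemma occ_frac_bounds:
  assumes "0 < T" "\<omega> \<in> space M" shows "0 \<le> occ_frac T \<omega>" "occ_frac T \<omega> \<le> 1"
proof -
  note p = path[OF assms(2)]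
  show "0 \<le> occ_frac T \<omega>" using counting_path.occupation_nonneg[OF p, of T] assms by (simp add: occ_frac_def)
  have "occupation (\<lambda>s. N s \<omega>) T \<le> T"
    using counting_path.occupation_mono(2)[OF p, of 0 T] counting_path.occupation_0[OF p] assms by simp
  thus "occ_frac T \<omega> \<le> 1" using assms by (simp add: occ_frac_def)
qed

lemma distr_occ_frac:
  assumes T: "0 < T" shows "distr M borel (occ_frac T) = occ_frac_law lam T"
proof (rule prob_unit_interval_eqI)
  note m[measurable] = occ_frac_measurable[OF T]
  interpret X: prob_space "distr M borel (occ_frac T)" by (rule prob_space_distr) measurable
  have mom: "(LINT y|distr M borel (occ_frac T). exp (- real n * y)) = (LINT y|occ_frac_law lam T. exp (- real n * y))" for n
  proof -
    have "(LINT y|distr M borel (occ_frac T). exp (- real n * y)) = expectation (\<lambda>\<omega>. exp (- real n * occ_frac T \<omega>))"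
      by (rule integral_distr) measurable
    also have "\<dots> = occ_mgf (real n / T) T" by (simp add: occ_mgf_def occ_frac_def)
    also have "\<dots> = occ_law_laplace lam (real n / T) T" using T by (intro occ_mgf_eq_occ_law_laplace) auto
    also have "\<dots> = (LINT y|occ_frac_law lam T. exp (- real n * y))"
      using integral_occ_frac_law[OF rate_pos T, of "real n"] by simp
    finally show ?thesis .
  qed
  thus "\<And>n. (LINT y|distr M borel (occ_frac T). exp (- real n * y)) = (LINT y|occ_frac_law lam T. exp (- real n * y))" .
  show "real_distribution (distr M borel (occ_frac T))" by unfold_locales auto
  show "AE y in distr M borel (occ_frac T). 0 \<le> y \<and> y \<le> 1"
    by (subst AE_distr_iff) (auto intro: occ_frac_bounds[OF T])
  \<comment> \<open>That the atom and \<open>psi\<close> have total mass 1 is not computed: it is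
    the moment identity at \<open>n = 0\<close>, where the other side is a probability
    measure.\<close>
  have "measure (occ_frac_law lam T) (space (occ_frac_law lam T)) = (LINT y|occ_frac_law lam T. exp (- real 0 * y))" by simp
  also have "\<dots> = (LINT y|distr M borel (occ_frac T). exp (- real 0 * y))" by (rule mom[symmetric])
  also have "\<dots> = 1" using X.prob_space by simp
  finally have "measure (occ_frac_law lam T) (space (occ_frac_law lam T)) = 1" .
  hence "emeasure (occ_frac_law lam T) (space (occ_frac_law lam T)) = 1"
    unfolding measure_def by simp
  hence P: "prob_space (occ_frac_law lam T)" by (rule prob_spaceI)
  show "real_distribution (occ_frac_law lam T)"
    unfolding real_distribution_def real_distribution_axioms_def using P by (simp add: occ_frac_law_def)
  note [measurable] = psi_measurable[OF rate_pos T]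
  show "AE y in occ_frac_law lam T. 0 \<le> y \<and> y \<le> 1"
    unfolding occ_frac_law_def
    by (subst AE_distr_iff, measurable, subst AE_density, measurable, intro AE_I2) (auto simp: indicator_def split: if_splits)
qed

end

section \<open>Fixed and random initial sign\<close>

context poisson_process
begin

lemma eta_conditional:
  assumes "0 < c" "0 < T" "\<omega> \<in> space M"
  shows "eta (telegraph_plus c N) T 0 \<omega> = occ_frac T \<omega>"
    "eta (telegraph_minus c N) T 0 \<omega> = 1 - occ_frac T \<omega>"
  using counting_path.eta_eq_occupation[OF path[OF assms(3)] assms(1,2), of N \<omega>] by (simp_all add: occ_frac_def)

lemma eta_measurable:
  assumes "0 < T" "V \<in> borel_measurable M" shows "eta (telegraph V N) T 0 \<in> borel_measurable M"
  using assms random_variable_N N_right_continuous by (intro path_functionals_measurable(2)) auto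

lemma emeasure_occ_frac:
  assumes T: "0 < T" and A: "A \<in> sets borel"
  shows "emeasure M (occ_frac T -` A \<inter> space M) = ennreal (2 * phi lam T 1) * emeasure (return borel (1::real)) A
    + (\<integral>\<^sup>+ y \<in> A \<inter> {0..1}. ennreal (psi lam T y) \<partial>lborel)"
  using emeasure_distr[OF occ_frac_measurable[OF T] A] emeasure_occ_frac_law[OF rate_pos T A]
  by (simp only: distr_occ_frac[OF T])

text \<open>\<open>psi\<close> is invariant under y to 1 - y, so reflection leaves the density alone
  and only carries the atom from 1 to 0.\<close>

lemma emeasure_occ_frac_reflect:
  assumes T: "0 < T" and A: "A \<in> sets borel"
  shows "emeasure M ((\<lambda>\<omega>. 1 - occ_frac T \<omega>) -` A \<inter> space M) = ennreal (2 * phi lam T 1) * emeasure (return borel (0::real)) A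
    + (\<integral>\<^sup>+ y \<in> A \<inter> {0..1}. ennreal (psi lam T y) \<partial>lborel)"
proof -
  let ?A = "(\<lambda>x::real. 1 - x) -` A"
  have A': "?A \<in> sets borel" using measurable_sets[of "\<lambda>x::real. 1 - x" borel borel A] A by simp
  note [measurable] = psi_measurable[OF rate_pos T] A A'
  have "(\<lambda>\<omega>. 1 - occ_frac T \<omega>) -` A \<inter> space M = occ_frac T -` ?A \<inter> space M" by auto
  moreover have "emeasure (return borel (1::real)) ?A = emeasure (return borel (0::real)) A"
    by (simp add: emeasure_return[OF A] emeasure_return[OF A'] indicator_def)
  moreover have "(\<integral>\<^sup>+ y \<in> ?A \<inter> {0..1}. ennreal (psi lam T y) \<partial>lborel) = (\<integral>\<^sup>+ y \<in> A \<inter> {0..1}. ennreal (psi lam T y) \<partial>lborel)"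
  proof -
    have "(\<integral>\<^sup>+ y. ennreal (indicator {0<..<1} y * psi lam T y) * indicator A y \<partial>lborel)
      = ennreal \<bar>- 1\<bar> * (\<integral>\<^sup>+ y. ennreal (indicator {0<..<1} (1 + (- 1) * y) * psi lam T (1 + (- 1) * y)) * indicator A (1 + (- 1) * y) \<partial>lborel)"
      by (rule nn_integral_real_affine) auto
    also have "\<dots> = (\<integral>\<^sup>+ y. ennreal (indicator {0<..<1} y * psi lam T y) * indicator ?A y \<partial>lborel)"
    proof -
      have "psi lam T (1 - y) = psi lam T y" for y by (simp add: psi_def)
      moreover have "indicator {0<..<1} (1 - y) = (indicator {0<..<1} y :: real)" for y :: real by (auto simp: indicator_def)
      ultimately show ?thesis by (simp add: indicator_def[of ?A] indicator_def[of A])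
    qed
    finally show ?thesis by (simp only: nn_integral_psi_Icc[OF rate_pos T] A A')
  qed
  ultimately show ?thesis using emeasure_occ_frac[OF T A'] by (simp only:)
qed

text \<open>Occupation is measurable for the sigma-algebra generated by the whole path, which is the
  one that \<open>indep_of_process\<close> refers to.\<close>

lemma occ_frac_independent:
  assumes T: "0 < T" and ind: "indep_of_process M V N" and V: "V \<in> borel_measurable M"
    and A: "A \<in> sets borel" and D: "D \<in> sets borel"
  shows "prob ((V -` D \<inter> space M) \<inter> (occ_frac T -` A \<inter> space M)) = prob (V -` D \<inter> space M) * prob (occ_frac T -` A \<inter> space M)"
proof -
  let ?G = "vimage_algebra (space M) (\<lambda>\<omega>. \<lambda>t\<in>{0..}. N t \<omega>) (PiM {0..} (\<lambda>_. count_space UNIV))"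
  have N: "N s \<in> ?G \<rightarrow>\<^sub>M count_space UNIV" if "0 \<le> s" for s
  proof -
    have "(\<lambda>\<omega>. \<lambda>t\<in>{0..}. N t \<omega>) \<in> ?G \<rightarrow>\<^sub>M PiM {0..} (\<lambda>_. count_space UNIV)"
      by (rule measurable_vimage_algebra1) (auto simp: space_PiM)
    moreover have "(\<lambda>f. f s) \<in> PiM {0..} (\<lambda>_. count_space UNIV) \<rightarrow>\<^sub>M (count_space UNIV :: nat measure)"
      by (rule measurable_component_singleton) (use that in auto)
    ultimately have "(\<lambda>\<omega>. (\<lambda>t\<in>{0..}. N t \<omega>) s) \<in> ?G \<rightarrow>\<^sub>M count_space UNIV"
      by (rule measurable_compose)
    thus ?thesis using that by simp
  qed
  have "(\<lambda>\<omega>. occupation (\<lambda>s. N s \<omega>) T) \<in> borel_measurable ?G"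
    using T N N_right_continuous by (intro path_functionals_measurable(3)) auto
  hence "occ_frac T \<in> borel_measurable ?G" unfolding occ_frac_def[abs_def] by simp
  from measurable_sets[OF this A] have "occ_frac T -` A \<inter> space M \<in> sets ?G" by simp
  moreover have "V -` D \<inter> space M \<in> sets (vimage_algebra (space M) V borel)"
    by (rule in_vimage_algebra[OF D])
  ultimately show ?thesis using ind unfolding indep_of_process_def by (intro indep_setD)
qed

end

theorem theorem2p1:
  fixes M :: "'a measure" and N :: "real \<Rightarrow> 'a \<Rightarrow> nat" and V0 :: "'a \<Rightarrow> real"
    and lam c T :: real
  assumes "0 < lam" and "0 < c" and "0 < T"
    and "poisson_process M lam N"
    and "symmetric_sign M c V0"
    and "indep_of_process M V0 N"
  shows
    "(eta (telegraph_plus c N) T 0 \<in> borel_measurable M \<and>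
      (\<forall>A \<in> sets borel.
         emeasure (distr M borel (eta (telegraph_plus c N) T 0)) A =
           ennreal (2 * phi lam T 1) * emeasure (return borel (1::real)) A
           + (\<integral>\<^sup>+ y \<in> A \<inter> {0..1}. ennreal (psi lam T y) \<partial>lborel)))
     \<and>
     (eta (telegraph_minus c N) T 0 \<in> borel_measurable M \<and>
      (\<forall>A \<in> sets borel.
         emeasure (distr M borel (eta (telegraph_minus c N) T 0)) A =
           ennreal (2 * phi lam T 1) * emeasure (return borel (0::real)) A
           + (\<integral>\<^sup>+ y \<in> A \<inter> {0..1}. ennreal (psi lam T y) \<partial>lborel)))
     \<and>
     (eta (telegraph V0 N) T 0 \<in> borel_measurable M \<and>
      (\<forall>A \<in> sets borel.
         emeasure (distr M borel (eta (telegraph V0 N) T 0)) A =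
           ennreal (phi lam T 1) * emeasure (return borel (0::real)) A
           + ennreal (phi lam T 1) * emeasure (return borel (1::real)) A
           + (\<integral>\<^sup>+ y \<in> A \<inter> {0..1}. ennreal (psi lam T y) \<partial>lborel)))"
proof -
  interpret poisson_process M lam N by fact
  note c = \<open>0 < c\<close> and T = \<open>0 < T\<close>
  have V: "V0 \<in> borel_measurable M" and Vp: "prob {\<omega> \<in> space M. V0 \<omega> = c} = 1 / 2"
    and Vm: "prob {\<omega> \<in> space M. V0 \<omega> = - c} = 1 / 2"
    using \<open>symmetric_sign M c V0\<close> by (auto simp: symmetric_sign_def)
  let ?Z = "occ_frac T" and ?Z' = "\<lambda>\<omega>. 1 - occ_frac T \<omega>" and ?X = "eta (telegraph V0 N) T 0"
  have mp: "eta (telegraph_plus c N) T 0 \<in> borel_measurable M"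
    and mm: "eta (telegraph_minus c N) T 0 \<in> borel_measurable M"
    and mX: "?X \<in> borel_measurable M"
    using V by (auto intro!: eta_measurable T)
  have ep: "emeasure (distr M borel (eta (telegraph_plus c N) T 0)) A = emeasure M (?Z -` A \<inter> space M)"
    if A: "A \<in> sets borel" for A
    by (subst emeasure_distr[OF mp A], rule arg_cong[of _ _ "emeasure M"]) (auto simp: eta_conditional[OF c T])
  have em: "emeasure (distr M borel (eta (telegraph_minus c N) T 0)) A = emeasure M (?Z' -` A \<inter> space M)"
    if A: "A \<in> sets borel" for A
    by (subst emeasure_distr[OF mm A], rule arg_cong[of _ _ "emeasure M"]) (auto simp: eta_conditional[OF c T])
  have eX: "emeasure (distr M borel ?X) A = ennreal (1 / 2) * emeasure M (?Z -` A \<inter> space M) + ennreal (1 / 2) * emeasure M (?Z' -` A \<inter> space M)"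
    if A: "A \<in> sets borel" for A
  proof -
    define P where "P = V0 -` {c} \<inter> space M"
    define Q where "Q = V0 -` {- c} \<inter> space M"
    have P: "P = {\<omega> \<in> space M. V0 \<omega> = c}" and Q: "Q = {\<omega> \<in> space M. V0 \<omega> = - c}"
      by (auto simp: P_def Q_def)
    have PQ[measurable]: "P \<in> events" "Q \<in> events"
      unfolding P_def Q_def by (rule measurable_sets[OF V], simp)+
    have disj: "P \<inter> Q = {}" using c by (auto simp: P Q)
    \<comment> \<open>\<open>V0\<close> may take other values on a null set, so the split into the
      two conditional processes holds only almost everywhere.\<close>
    have "prob (P \<union> Q) = 1" using finite_measure_Union[OF PQ disj] Vp Vm by (simp add: P Q)
    hence ae: "AE \<omega> in M. \<omega> \<in> P \<union> Q" by (subst (asm) prob_eq_1) auto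
    note Z[measurable] = occ_frac_measurable[OF T]
    have sX: "?X -` A \<inter> space M \<in> events" "?Z -` A \<inter> space M \<in> events" "?Z' -` A \<inter> space M \<in> events"
      using A by (auto intro!: measurable_sets[OF mX] measurable_sets[OF Z] measurable_sets[of ?Z'])
    have XP: "?X \<omega> = ?Z \<omega>" if "\<omega> \<in> P" for \<omega>
      using that eta_conditional(1)[OF c T, of \<omega>] by (simp add: P eta_def telegraph_def)
    have XQ: "?X \<omega> = ?Z' \<omega>" if "\<omega> \<in> Q" for \<omega>
      using that eta_conditional(2)[OF c T, of \<omega>] by (simp add: Q eta_def telegraph_def)
    have "prob (?X -` A \<inter> space M) = prob ((P \<inter> (?Z -` A \<inter> space M)) \<union> (Q \<inter> (?Z' -` A \<inter> space M)))"
    proof (rule measure_eq_AE)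
      show "AE \<omega> in M. \<omega> \<in> ?X -` A \<inter> space M \<longleftrightarrow> \<omega> \<in> (P \<inter> (?Z -` A \<inter> space M)) \<union> (Q \<inter> (?Z' -` A \<inter> space M))"
        using ae by eventually_elim (use XP XQ disj in auto)
    qed (use sX PQ in auto)
    also have "\<dots> = prob (P \<inter> (?Z -` A \<inter> space M)) + prob (Q \<inter> (?Z' -` A \<inter> space M))"
      using disj sX PQ by (intro finite_measure_Union) auto
    also have "prob (P \<inter> (?Z -` A \<inter> space M)) = 1 / 2 * prob (?Z -` A \<inter> space M)"
      using occ_frac_independent[OF T \<open>indep_of_process M V0 N\<close> V A, of "{c}"] Vp unfolding P_def[symmetric] P by simp
    also have "prob (Q \<inter> (?Z' -` A \<inter> space M)) = 1 / 2 * prob (?Z' -` A \<inter> space M)"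
    proof -
      have A': "(\<lambda>x::real. 1 - x) -` A \<in> sets borel" using measurable_sets[of "\<lambda>x::real. 1 - x" borel borel A] A by simp
      have "?Z' -` A \<inter> space M = ?Z -` ((\<lambda>x. 1 - x) -` A) \<inter> space M" by auto
      thus ?thesis
        using occ_frac_independent[OF T \<open>indep_of_process M V0 N\<close> V A', of "{- c}"] Vm unfolding Q_def[symmetric] Q by simp
    qed
    finally have "prob (?X -` A \<inter> space M) = 1 / 2 * prob (?Z -` A \<inter> space M) + 1 / 2 * prob (?Z' -` A \<inter> space M)" .
    moreover have "ennreal (1 / 2 * a + 1 / 2 * b) = ennreal (1 / 2) * ennreal a + ennreal (1 / 2) * ennreal b"
      if "0 \<le> a" "0 \<le> b" for a b
      using that by (subst (1 2) ennreal_mult[symmetric], simp_all only: zero_le_divide_1_iff zero_le_numeral)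
        (subst ennreal_plus, auto)
    ultimately show ?thesis by (simp only: emeasure_distr[OF mX A] emeasure_eq_measure measure_nonneg)
  qed
  have p: "0 \<le> phi lam T 1" using phi_nonneg[OF rate_pos T, of 1] by simp
  \<comment> \<open>Averaging the two conditional laws halves each atom, while the two equal density
    parts add up to one full copy.\<close>
  have half: "ennreal (1 / 2) * (ennreal (2 * phi lam T 1) * a + i) + ennreal (1 / 2) * (ennreal (2 * phi lam T 1) * b + i)
    = ennreal (phi lam T 1) * b + ennreal (phi lam T 1) * a + i" for a b i
  proof -
    have 1: "ennreal (1 / 2) * ennreal (2 * phi lam T 1) = ennreal (phi lam T 1)"
      using p by (subst ennreal_mult[symmetric]) auto
    have "ennreal (1 / 2) + ennreal (1 / 2) = 1" by (subst ennreal_plus[symmetric]) auto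
    hence 2: "ennreal (1 / 2) * i + ennreal (1 / 2) * i = i" by (metis distrib_right mult_1)
    have "ennreal (1 / 2) * (ennreal (2 * phi lam T 1) * a + i) + ennreal (1 / 2) * (ennreal (2 * phi lam T 1) * b + i)
      = ennreal (phi lam T 1) * b + ennreal (phi lam T 1) * a + (ennreal (1 / 2) * i + ennreal (1 / 2) * i)"
      by (simp only: distrib_left mult.assoc[symmetric] 1 add_ac)
    thus ?thesis by (simp only: 2)
  qed
  show ?thesis
  proof (intro conjI ballI mp mm mX)
    fix A :: "real set" assume A: "A \<in> sets borel"
    note Z = emeasure_occ_frac[OF T A] emeasure_occ_frac_reflect[OF T A]
    show "emeasure (distr M borel (eta (telegraph_plus c N) T 0)) A =
           ennreal (2 * phi lam T 1) * emeasure (return borel (1::real)) A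
           + (\<integral>\<^sup>+ y \<in> A \<inter> {0..1}. ennreal (psi lam T y) \<partial>lborel)"
      unfolding ep[OF A] by (rule Z)
    show "emeasure (distr M borel (eta (telegraph_minus c N) T 0)) A =
           ennreal (2 * phi lam T 1) * emeasure (return borel (0::real)) A
           + (\<integral>\<^sup>+ y \<in> A \<inter> {0..1}. ennreal (psi lam T y) \<partial>lborel)"
      unfolding em[OF A] by (rule Z)
    show "emeasure (distr M borel ?X) A =
           ennreal (phi lam T 1) * emeasure (return borel (0::real)) A
           + ennreal (phi lam T 1) * emeasure (return borel (1::real)) A
           + (\<integral>\<^sup>+ y \<in> A \<inter> {0..1}. ennreal (psi lam T y) \<partial>lborel)"
      unfolding eX[OF A] Z by (rule half)
  qed
qed

end
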